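(* Let $\mathbb{F}$ be a field and let $A$ and $B$ be two nearly simple algebras over $\mathbb{F}$, with unique non-trivial ideals $I_A$ and $I_B$, respectively. Then all ideals of $A \otimes B$ are admissible if and only if all four tensor products $$Z(A/I_A)\otimes Z(B/I_B), \quad C(A)\otimes Z(B/I_B), \quad Z(A/I_A)\otimes C(B), \quad C(A)\otimes C(B)$$ are fields.
   Context: All algebras are associative algebras over the fixed field $\mathbb{F}$, and all tensor products are over $\mathbb{F}$. "Ideal" means two-sided ideal; an ideal $I$ of $A$ is non-trivial if $I\neq\{0\}$ and $I\neq A$. $Z(\cdot)$ denotes the centre of an algebra. A unital algebra $A$ is called nearly simple if it contains a unique non-trivial ideal, denoted $I_A$, and $I_A^2\neq\{0\}$. (Nearly simple algebras are prime, so the extended centroid below makes sense.) If $A$ and $B$ are nearly simple, an ideal $\mathcal{J}$ of $A\otimes B$ is called admissible if it is trivial (that is, $\{0\}$ or $A\otimes B$) or equal to one of $I_A\otimes I_B$, $I_A\otimes B$, $A\otimes I_B$, $I_A\otimes B+A\otimes I_B$. For a prime algebra $A$, $Q_s(A)$ denotes its symmetric algebra of quotients: the (unique up to isomorphism fixing $A$) unital algebra containing $A$ as a subalgebra such that (i) for every $q\in Q_s(A)$ there is a non-zero ideal $I$ of $A$ with $qI\subseteq A$ and $Iq\subseteq A$; (ii) if $q\in Q_s(A)$ and $qI=\{0\}$ or $Iq=\{0\}$ for some non-zero ideal $I$ of $A$, then $q=0$; (iii) if $I$ is a non-zero ideal of $A$, $f:I\to A$ is a right $A$-module map and $g:I\to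 A$ is a left $A$-module map with $x f(y)=g(x)y$ for all $x,y\in I$, then there is $q\in Q_s(A)$ with $f(y)=qy$ and $g(x)=xq$ for all $x,y\in I$. The extended centroid of $A$ is $C(A):=Z(Q_s(A))$; it is a field containing (a copy of) $\mathbb{F}$. *)

theory Defs
  imports "HOL-Algebra.Module" "HOL-Algebra.QuotRing" "HOL-Algebra.Ideal_Product"
begin

section \<open>Associative algebras over a field\<close>

text \<open>The library locale \<open>algebra\<close> is restricted to commutative algebras. An algebra is a
  unital ring with a compatible scalar multiplication, on a record of type \<open>module\<close>.
  Since there is a unit, every two-sided ring ideal is a linear subspace, so the ideals of an
  algebra are those of the library predicate \<^const>\<open>ideal\<close>.\<close>

locale assoc_algebra = module F A + ring A + field F
  for F :: "('f, 'm) ring_scheme" (structure) and A :: "('f, 'a) module" (structure) +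
  assumes smult_mult_left:
      "\<lbrakk>c \<in> carrier F; x \<in> carrier A; y \<in> carrier A\<rbrakk>
        \<Longrightarrow> (c \<odot>\<^bsub>A\<^esub> x) \<otimes>\<^bsub>A\<^esub> y = c \<odot>\<^bsub>A\<^esub> (x \<otimes>\<^bsub>A\<^esub> y)"
    and smult_mult_right:
      "\<lbrakk>c \<in> carrier F; x \<in> carrier A; y \<in> carrier A\<rbrakk>
        \<Longrightarrow> x \<otimes>\<^bsub>A\<^esub> (c \<odot>\<^bsub>A\<^esub> y) = c \<odot>\<^bsub>A\<^esub> (x \<otimes>\<^bsub>A\<^esub> y)"

definition algebra_hom ::
    "('f, 'm) ring_scheme \<Rightarrow> ('f, 'a) module \<Rightarrow> ('f, 'b) module \<Rightarrow> ('a \<Rightarrow> 'b) set" where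
  "algebra_hom F A B = {h \<in> ring_hom A B.
     \<forall>c \<in> carrier F. \<forall>x \<in> carrier A. h (c \<odot>\<^bsub>A\<^esub> x) = c \<odot>\<^bsub>B\<^esub> h x}"

definition center_algebra :: "('f, 'a) module \<Rightarrow> ('f, 'a) module" where
  "center_algebra A =
     A\<lparr>carrier := {z \<in> carrier A. \<forall>x \<in> carrier A. z \<otimes>\<^bsub>A\<^esub> x = x \<otimes>\<^bsub>A\<^esub> z}\<rparr>"

text \<open>The library's quotient ring \<open>A Quot I\<close> with the induced scalar multiplication
  \<open>c (I + x) = I + c x\<close>.\<close>

definition quotient_algebra :: "('f, 'a) module \<Rightarrow> 'a set \<Rightarrow> ('f, 'a set) module" where
  "quotient_algebra A I =
     ring.extend (A Quot I) (module.fields (\<lambda>c X. \<Union>x\<in>X. I +>\<^bsub>A\<^esub> (c \<odot>\<^bsub>A\<^esub> x)))"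

definition subspace_span ::
    "('f, 'm) ring_scheme \<Rightarrow> ('f, 'a) module \<Rightarrow> 'a set \<Rightarrow> 'a set" where
  "subspace_span F V X = \<Inter>{H. submodule H F V \<and> X \<subseteq> H}"


section \<open>Tensor products of algebras\<close>

text \<open>The free vector space on \<open>carrier A \<times> carrier B\<close>, realised as finitely supported
  functions vanishing outside that set. Its multiplication is the bilinear extension of
  \<open>(a, b) (a', b') = (a a', b b')\<close> on basis vectors.\<close>

definition free_tensor ::
    "('f, 'm) ring_scheme \<Rightarrow> ('f, 'a) module \<Rightarrow> ('f, 'b) module \<Rightarrow> ('f, 'a \<times> 'b \<Rightarrow> 'f) module" where
  "free_tensor F A B =
    \<lparr>carrier = {f. range f \<subseteq> carrier F \<and> finite {p. f p \<noteq> \<zero>\<^bsub>F\<^esub>} \<and>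
                   {p. f p \<noteq> \<zero>\<^bsub>F\<^esub>} \<subseteq> carrier A \<times> carrier B},
     mult = (\<lambda>f g p. \<Oplus>\<^bsub>F\<^esub>u \<in> {(x, y). f x \<noteq> \<zero>\<^bsub>F\<^esub> \<and> g y \<noteq> \<zero>\<^bsub>F\<^esub> \<and>
                        (fst x \<otimes>\<^bsub>A\<^esub> fst y, snd x \<otimes>\<^bsub>B\<^esub> snd y) = p}.
                        f (fst u) \<otimes>\<^bsub>F\<^esub> g (snd u)),
     one = (\<lambda>p. if p = (\<one>\<^bsub>A\<^esub>, \<one>\<^bsub>B\<^esub>) then \<one>\<^bsub>F\<^esub> else \<zero>\<^bsub>F\<^esub>),
     zero = (\<lambda>p. \<zero>\<^bsub>F\<^esub>),
     add = (\<lambda>f g p. f p \<oplus>\<^bsub>F\<^esub> g p),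
     smult = (\<lambda>c f p. c \<otimes>\<^bsub>F\<^esub> f p)\<rparr>"

definition free_gen :: "('f, 'm) ring_scheme \<Rightarrow> 'a \<Rightarrow> 'b \<Rightarrow> ('a \<times> 'b \<Rightarrow> 'f)" where
  "free_gen F a b = (\<lambda>p. if p = (a, b) then \<one>\<^bsub>F\<^esub> else \<zero>\<^bsub>F\<^esub>)"

definition bilinear_relations ::
    "('f, 'm) ring_scheme \<Rightarrow> ('f, 'a) module \<Rightarrow> ('f, 'b) module \<Rightarrow> ('a \<times> 'b \<Rightarrow> 'f) set" where
  "bilinear_relations F A B = (let M = free_tensor F A B in
     {free_gen F (a \<oplus>\<^bsub>A\<^esub> a') b \<ominus>\<^bsub>M\<^esub> (free_gen F a b \<oplus>\<^bsub>M\<^esub> free_gen F a' b) | a a' b.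
        a \<in> carrier A \<and> a' \<in> carrier A \<and> b \<in> carrier B} \<union>
     {free_gen F a (b \<oplus>\<^bsub>B\<^esub> b') \<ominus>\<^bsub>M\<^esub> (free_gen F a b \<oplus>\<^bsub>M\<^esub> free_gen F a b') | a b b'.
        a \<in> carrier A \<and> b \<in> carrier B \<and> b' \<in> carrier B} \<union>
     {free_gen F (c \<odot>\<^bsub>A\<^esub> a) b \<ominus>\<^bsub>M\<^esub> (c \<odot>\<^bsub>M\<^esub> free_gen F a b) | c a b.
        c \<in> carrier F \<and> a \<in> carrier A \<and> b \<in> carrier B} \<union>
     {free_gen F a (c \<odot>\<^bsub>B\<^esub> b) \<ominus>\<^bsub>M\<^esub> (c \<odot>\<^bsub>M\<^esub> free_gen F a b) | c a b.
        c \<in> carrier F \<and> a \<in> carrier A \<and> b \<in> carrier B})"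

definition tensor_kernel ::
    "('f, 'm) ring_scheme \<Rightarrow> ('f, 'a) module \<Rightarrow> ('f, 'b) module \<Rightarrow> ('a \<times> 'b \<Rightarrow> 'f) set" where
  "tensor_kernel F A B = subspace_span F (free_tensor F A B) (bilinear_relations F A B)"

text \<open>The kernel is a two-sided ideal, because left or right multiplication by a basis vector
  maps each bilinearity relation to another one. So the quotient carries the multiplication
  \<open>(a \<otimes> b) (a' \<otimes> b') = a a' \<otimes> b b'\<close>.\<close>

definition tensor_algebra ::
    "('f, 'm) ring_scheme \<Rightarrow> ('f, 'a) module \<Rightarrow> ('f, 'b) module \<Rightarrow>
      ('f, ('a \<times> 'b \<Rightarrow> 'f) set) module" where
  "tensor_algebra F A B = quotient_algebra (free_tensor F A B) (tensor_kernel F A B)"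

definition pure_tensor ::
    "('f, 'm) ring_scheme \<Rightarrow> ('f, 'a) module \<Rightarrow> ('f, 'b) module \<Rightarrow> 'a \<Rightarrow> 'b \<Rightarrow>
      ('a \<times> 'b \<Rightarrow> 'f) set" where
  "pure_tensor F A B a b = tensor_kernel F A B +>\<^bsub>free_tensor F A B\<^esub> free_gen F a b"

text \<open>For subspaces \<open>S\<close> of \<open>A\<close> and \<open>T\<close> of \<open>B\<close>, the space \<open>S \<otimes> T\<close> regarded
  as a subspace of \<open>A \<otimes> B\<close>.\<close>

definition tensor_subspace ::
    "('f, 'm) ring_scheme \<Rightarrow> ('f, 'a) module \<Rightarrow> ('f, 'b) module \<Rightarrow> 'a set \<Rightarrow> 'b set \<Rightarrow>
      ('a \<times> 'b \<Rightarrow> 'f) set set" where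
  "tensor_subspace F A B S T =
     subspace_span F (tensor_algebra F A B) {pure_tensor F A B a b | a b. a \<in> S \<and> b \<in> T}"


section \<open>Nearly simple algebras and admissible ideals\<close>

definition nontrivial_ideal :: "'a set \<Rightarrow> ('a, 'm) ring_scheme \<Rightarrow> bool" where
  "nontrivial_ideal I A \<longleftrightarrow> ideal I A \<and> I \<noteq> {\<zero>\<^bsub>A\<^esub>} \<and> I \<noteq> carrier A"

definition nearly_simple :: "('f, 'm) ring_scheme \<Rightarrow> ('f, 'a) module \<Rightarrow> bool" where
  "nearly_simple F A \<longleftrightarrow> assoc_algebra F A \<and> (\<exists>!I. nontrivial_ideal I A) \<and>
     (\<forall>I. nontrivial_ideal I A \<longrightarrow> I \<cdot>\<^bsub>A\<^esub> I \<noteq> {\<zero>\<^bsub>A\<^esub>})"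

definition admissible ::
    "('f, 'm) ring_scheme \<Rightarrow> ('f, 'a) module \<Rightarrow> ('f, 'b) module \<Rightarrow> 'a set \<Rightarrow> 'b set \<Rightarrow>
      ('a \<times> 'b \<Rightarrow> 'f) set set \<Rightarrow> bool" where
  "admissible F A B I\<^sub>A I\<^sub>B J \<longleftrightarrow>
     J = {\<zero>\<^bsub>tensor_algebra F A B\<^esub>} \<or>
     J = carrier (tensor_algebra F A B) \<or>
     J = tensor_subspace F A B I\<^sub>A I\<^sub>B \<or>
     J = tensor_subspace F A B I\<^sub>A (carrier B) \<or>
     J = tensor_subspace F A B (carrier A) I\<^sub>B \<or>
     J = tensor_subspace F A B I\<^sub>A (carrier B) <+>\<^bsub>tensor_algebra F A B\<^esub>
           tensor_subspace F A B (carrier A) I\<^sub>B"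


section \<open>Symmetric algebras of quotients\<close>

definition right_module_map :: "('a, 'm) ring_scheme \<Rightarrow> 'a set \<Rightarrow> ('a \<Rightarrow> 'a) \<Rightarrow> bool" where
  "right_module_map A I f \<longleftrightarrow> f \<in> I \<rightarrow> carrier A \<and>
     (\<forall>x\<in>I. \<forall>y\<in>I. f (x \<oplus>\<^bsub>A\<^esub> y) = f x \<oplus>\<^bsub>A\<^esub> f y) \<and>
     (\<forall>x\<in>I. \<forall>a\<in>carrier A. f (x \<otimes>\<^bsub>A\<^esub> a) = f x \<otimes>\<^bsub>A\<^esub> a)"

definition left_module_map :: "('a, 'm) ring_scheme \<Rightarrow> 'a set \<Rightarrow> ('a \<Rightarrow> 'a) \<Rightarrow> bool" where
  "left_module_map A I g \<longleftrightarrow> g \<in> I \<rightarrow> carrier A \<and>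
     (\<forall>x\<in>I. \<forall>y\<in>I. g (x \<oplus>\<^bsub>A\<^esub> y) = g x \<oplus>\<^bsub>A\<^esub> g y) \<and>
     (\<forall>x\<in>I. \<forall>a\<in>carrier A. g (a \<otimes>\<^bsub>A\<^esub> x) = a \<otimes>\<^bsub>A\<^esub> g x)"

text \<open>\<open>Q\<close>, with \<open>A\<close> embedded by \<open>e\<close>, is the symmetric algebra of quotients of \<open>A\<close>. It is
  unique up to isomorphism over \<open>A\<close>. The extended centroid of \<open>A\<close> is
  \<open>center_algebra Q\<close>. The three quantified conjuncts are, in this order: elements of \<open>Q\<close> have
  denominator ideals; no non-zero element annihilates a non-zero ideal on either side;
  compatible pairs of one-sided module maps come from elements of \<open>Q\<close>.\<close>

definition symmetric_quotient_algebra ::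
    "('f, 'm) ring_scheme \<Rightarrow> ('f, 'a) module \<Rightarrow> ('f, 'q) module \<Rightarrow> ('a \<Rightarrow> 'q) \<Rightarrow> bool" where
  "symmetric_quotient_algebra F A Q e \<longleftrightarrow>
     assoc_algebra F A \<and> assoc_algebra F Q \<and>
     e \<in> algebra_hom F A Q \<and> inj_on e (carrier A) \<and>
     (\<forall>q\<in>carrier Q. \<exists>I. ideal I A \<and> I \<noteq> {\<zero>\<^bsub>A\<^esub>} \<and>
        (\<forall>x\<in>I. q \<otimes>\<^bsub>Q\<^esub> e x \<in> e ` carrier A \<and> e x \<otimes>\<^bsub>Q\<^esub> q \<in> e ` carrier A)) \<and>
     (\<forall>q\<in>carrier Q. \<forall>I. ideal I A \<and> I \<noteq> {\<zero>\<^bsub>A\<^esub>} \<and>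
        ((\<forall>x\<in>I. q \<otimes>\<^bsub>Q\<^esub> e x = \<zero>\<^bsub>Q\<^esub>) \<or> (\<forall>x\<in>I. e x \<otimes>\<^bsub>Q\<^esub> q = \<zero>\<^bsub>Q\<^esub>)) \<longrightarrow> q = \<zero>\<^bsub>Q\<^esub>) \<and>
     (\<forall>I f g. ideal I A \<and> I \<noteq> {\<zero>\<^bsub>A\<^esub>} \<and> right_module_map A I f \<and> left_module_map A I g \<and>
        (\<forall>x\<in>I. \<forall>y\<in>I. x \<otimes>\<^bsub>A\<^esub> f y = g x \<otimes>\<^bsub>A\<^esub> y) \<longrightarrow>
        (\<exists>q\<in>carrier Q. \<forall>x\<in>I. e (f x) = q \<otimes>\<^bsub>Q\<^esub> e x \<and> e (g x) = e x \<otimes>\<^bsub>Q\<^esub> q))"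

end

theory Submission
  imports Defs
begin

text \<open>
  Call an algebra \<open>Q\<close> with an ideal \<open>I\<close> a closed monolith if \<open>I\<close> lies in every non-zero ideal of
  \<open>Q\<close>, no non-zero element of \<open>Q\<close> annihilates \<open>I\<close> on either side, and every bimodule endomorphism
  of \<open>I\<close> is the multiplication by a central element of \<open>Q\<close> (locale \<open>closed_monolith\<close>). A nearly
  simple algebra \<open>A\<close> gives two of them. One is the symmetric algebra of quotients of \<open>A\<close> with the
  image of \<open>I\<^sub>A\<close>, which is an ideal there because \<open>I\<^sub>A\<close> is idempotent; its centre is \<open>C(A)\<close>. The
  other is the simple algebra \<open>A/I\<^sub>A\<close> with itself as the ideal; its centre is \<open>Z(A/I\<^sub>A)\<close>. So each of
  the four tensor products in the theorem is \<open>Z(Q) \<otimes> Z(P)\<close> for two closed monoliths \<open>(Q, I)\<close> and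
  \<open>(P, L)\<close>.

  The core of the proof is that \<open>Z(Q) \<otimes> Z(P)\<close> is a field if and only if every non-zero ideal of
  \<open>Q \<otimes> P\<close> contains \<open>I \<otimes> L\<close> (lemmas \<open>field_imp_contains\<close> and \<open>contains_imp_field\<close>, combined in
  \<open>field_iff_contains\<close> with a passage to the subalgebra \<open>A \<otimes> B\<close>). Suppose that it is a field and
  take a non-zero element of an ideal. By Martindale's theorem (lemma \<open>martindale\<close>), if \<open>a\<close> is not
  in the \<open>Z(Q)\<close>-span of \<open>a\<^sub>1, \<dots>, a\<^sub>n\<close>, then some map \<open>x \<mapsto> \<Sum> u x v\<close> with all \<open>u, v\<close> in \<open>I\<close> kills every
  \<open>a\<^sub>i\<close> but not \<open>a\<close>. Such maps act on the first factor of \<open>Q \<otimes> P\<close> and preserve the ideal, so the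
  ideal contains \<open>(I \<otimes> 1) w\<close> for some non-zero \<open>w\<close> in \<open>Z(Q) \<otimes> P\<close>. The same argument in the second
  factor gives \<open>(I \<otimes> L) e\<close> with a non-zero \<open>e\<close> in \<open>Z(Q) \<otimes> Z(P)\<close>, and \<open>e\<close> is invertible.
  Conversely, let \<open>w\<close> be a non-zero element of \<open>Z(Q) \<otimes> Z(P)\<close>. Functionals on \<open>Q\<close> and \<open>P\<close>, linear
  over the centres and with value \<open>1\<close> at some \<open>u\<close> in \<open>I\<close> and some \<open>v\<close> in \<open>L\<close>, induce a
  \<open>Z(Q) \<otimes> Z(P)\<close>-linear map \<open>\<chi>\<close> from \<open>Q \<otimes> P\<close> to \<open>Z(Q) \<otimes> Z(P)\<close> with \<open>\<chi> (u \<otimes> v) = 1\<close>. As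
  \<open>\<chi> (w (u \<otimes> v)) = w\<close>, the ideal \<open>w (I \<otimes> L)\<close> is not zero. So it contains \<open>u \<otimes> v = w t\<close>, whence
  \<open>1 = w \<chi>(t)\<close>.

  Pulled back to \<open>A \<otimes> B\<close> along the quotient maps (lemma \<open>contains_iff_mod_kernel\<close>), the four field
  conditions say for every ideal \<open>J\<close> of \<open>A \<otimes> B\<close>: if \<open>J\<close> is not zero, it contains \<open>I\<^sub>A \<otimes> I\<^sub>B\<close>; if
  \<open>J\<close> is not contained in \<open>I\<^sub>A \<otimes> B\<close>, then \<open>J + I\<^sub>A \<otimes> B\<close> contains \<open>A \<otimes> I\<^sub>B\<close>; the same with the
  factors exchanged; and if \<open>J\<close> is not contained in \<open>I\<^sub>A \<otimes> B + A \<otimes> I\<^sub>B\<close>, then together with this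
  ideal it spans \<open>A \<otimes> B\<close>. By \<open>admissible_iff\<close> these four conditions hold exactly for the admissible
  ideals.

  The linear algebra of tensor products rests on the universal property and on linear projections
  onto subspaces: left inverses, sections and projections of the factors can be tensored, and this
  yields injectivity, kernels and intersections.
\<close>

section \<open>Linear maps and complements of subspaces\<close>

definition linear_maps ::
    "('f, 'm) ring_scheme \<Rightarrow> ('f, 'a, 'k) module_scheme \<Rightarrow> ('f, 'b, 'l) module_scheme \<Rightarrow> ('a \<Rightarrow> 'b) set" where
  "linear_maps F V W = {h \<in> carrier V \<rightarrow> carrier W.
     (\<forall>x\<in>carrier V. \<forall>y\<in>carrier V. h (x \<oplus>\<^bsub>V\<^esub> y) = h x \<oplus>\<^bsub>W\<^esub> h y) \<and>
     (\<forall>c\<in>carrier F. \<forall>x\<in>carrier V. h (c \<odot>\<^bsub>V\<^esub> x) = c \<odot>\<^bsub>W\<^esub> h x)}"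

lemma linear_mapsI:
  assumes "\<And>x. x \<in> carrier V \<Longrightarrow> h x \<in> carrier W"
    and "\<And>x y. \<lbrakk>x \<in> carrier V; y \<in> carrier V\<rbrakk> \<Longrightarrow> h (x \<oplus>\<^bsub>V\<^esub> y) = h x \<oplus>\<^bsub>W\<^esub> h y"
    and "\<And>c x. \<lbrakk>c \<in> carrier F; x \<in> carrier V\<rbrakk> \<Longrightarrow> h (c \<odot>\<^bsub>V\<^esub> x) = c \<odot>\<^bsub>W\<^esub> h x"
  shows "h \<in> linear_maps F V W"
  using assms unfolding linear_maps_def by auto

lemma linear_mapsD:
  assumes "h \<in> linear_maps F V W"
  shows "x \<in> carrier V \<Longrightarrow> h x \<in> carrier W"
    and "\<lbrakk>x \<in> carrier V; y \<in> carrier V\<rbrakk> \<Longrightarrow> h (x \<oplus>\<^bsub>V\<^esub> y) = h x \<oplus>\<^bsub>W\<^esub> h y"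
    and "\<lbrakk>c \<in> carrier F; x \<in> carrier V\<rbrakk> \<Longrightarrow> h (c \<odot>\<^bsub>V\<^esub> x) = c \<odot>\<^bsub>W\<^esub> h x"
  using assms unfolding linear_maps_def by auto

lemma additive_zero:
  assumes "abelian_group V" "abelian_group W" "h \<in> carrier V \<rightarrow> carrier W"
    and "\<And>x y. \<lbrakk>x \<in> carrier V; y \<in> carrier V\<rbrakk> \<Longrightarrow> h (x \<oplus>\<^bsub>V\<^esub> y) = h x \<oplus>\<^bsub>W\<^esub> h y"
  shows "h \<zero>\<^bsub>V\<^esub> = \<zero>\<^bsub>W\<^esub>"
proof -
  interpret V: abelian_group V by fact
  interpret W: abelian_group W by fact
  have c: "h \<zero>\<^bsub>V\<^esub> \<in> carrier W" using assms(3) by auto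
  have "h \<zero>\<^bsub>V\<^esub> \<oplus>\<^bsub>W\<^esub> h \<zero>\<^bsub>V\<^esub> = h \<zero>\<^bsub>V\<^esub>" using assms(4)[of "\<zero>\<^bsub>V\<^esub>" "\<zero>\<^bsub>V\<^esub>"] by simp
  then show ?thesis using c by (metis W.add.r_cancel_one')
qed

lemma additive_minus:
  assumes "abelian_group V" "abelian_group W" "h \<in> carrier V \<rightarrow> carrier W"
    and "\<And>x y. \<lbrakk>x \<in> carrier V; y \<in> carrier V\<rbrakk> \<Longrightarrow> h (x \<oplus>\<^bsub>V\<^esub> y) = h x \<oplus>\<^bsub>W\<^esub> h y"
    and "x \<in> carrier V"
  shows "h (\<ominus>\<^bsub>V\<^esub> x) = \<ominus>\<^bsub>W\<^esub> h x"
proof -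
  interpret V: abelian_group V by fact
  interpret W: abelian_group W by fact
  have "h (\<ominus>\<^bsub>V\<^esub> x) \<oplus>\<^bsub>W\<^esub> h x = \<zero>\<^bsub>W\<^esub>"
    using assms(4)[of "\<ominus>\<^bsub>V\<^esub> x" x] assms(5) additive_zero[OF assms(1-4)] by (simp add: V.l_neg)
  moreover have "h (\<ominus>\<^bsub>V\<^esub> x) \<in> carrier W" "h x \<in> carrier W" using assms(3,5) by auto
  ultimately show ?thesis by (metis W.minus_equality)
qed

lemma linear_maps_additive:
  assumes "h \<in> linear_maps F V W" "abelian_group V" "abelian_group W"
  shows "h \<zero>\<^bsub>V\<^esub> = \<zero>\<^bsub>W\<^esub>"
    and "x \<in> carrier V \<Longrightarrow> h (\<ominus>\<^bsub>V\<^esub> x) = \<ominus>\<^bsub>W\<^esub> h x"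
    and "\<lbrakk>x \<in> carrier V; y \<in> carrier V\<rbrakk> \<Longrightarrow> h (x \<ominus>\<^bsub>V\<^esub> y) = h x \<ominus>\<^bsub>W\<^esub> h y"
proof -
  interpret V: abelian_group V by fact
  interpret W: abelian_group W by fact
  have p: "h \<in> carrier V \<rightarrow> carrier W" using assms(1) by (auto simp: linear_maps_def)
  show "h \<zero>\<^bsub>V\<^esub> = \<zero>\<^bsub>W\<^esub>"
    by (rule additive_zero[OF assms(2,3) p linear_mapsD(2)[OF assms(1)]])
  show m: "h (\<ominus>\<^bsub>V\<^esub> x) = \<ominus>\<^bsub>W\<^esub> h x" if "x \<in> carrier V" for x
    by (rule additive_minus[OF assms(2,3) p linear_mapsD(2)[OF assms(1)] that])
  show "\<lbrakk>x \<in> carrier V; y \<in> carrier V\<rbrakk> \<Longrightarrow> h (x \<ominus>\<^bsub>V\<^esub> y) = h x \<ominus>\<^bsub>W\<^esub> h y"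
    by (simp add: V.minus_eq W.minus_eq linear_mapsD[OF assms(1)] m)
qed

lemma (in abelian_group) minus_eq_zero_iff:
  assumes "x \<in> carrier G" "y \<in> carrier G"
  shows "x \<ominus> y = \<zero> \<longleftrightarrow> x = y"
  using assms by (metis a_inv_closed add.inv_solve_right' l_zero minus_eq r_neg zero_closed)

text \<open>
  By Zorn's lemma there is a subspace that is maximal among those meeting \<open>W\<close> trivially. It is a
  complement: a vector outside the sum could be adjoined to it.
\<close>

lemma exists_complement:
  fixes V (structure)
  assumes "field k" "module k V" "submodule W k V"
  shows "\<exists>M. submodule M k V \<and> M \<inter> W = {\<zero>} \<and>
     (\<forall>x\<in>carrier V. \<exists>m\<in>M. \<exists>w\<in>W. x = m \<oplus> w)"
proof -
  interpret k: field k by fact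
  interpret V: module k V by fact
  let ?A = "{M. submodule M k V \<and> M \<inter> W = {\<zero>}}"
  note subE = V.submoduleE
  have z: "\<zero> \<in> H" if "submodule H k V" for H
    using subgroup.one_closed[OF submodule.axioms(1)[OF that]] by simp
  note WE = subE[OF assms(3)]
  have "{\<zero>} \<in> ?A" using z[OF assms(3)] by (auto intro!: V.submoduleI)
  then have ne: "?A \<noteq> {}" by blast
  have ub: "\<Union>C \<in> ?A" if C: "C \<noteq> {}" "subset.chain ?A C" for C
  proof -
    have sub: "submodule H k V" "H \<inter> W = {\<zero>}" if "H \<in> C" for H
      using C(2) that unfolding subset_chain_def by blast+
    have common: "\<exists>H\<in>C. x \<in> H \<and> y \<in> H" if xy: "x \<in> \<Union>C" "y \<in> \<Union>C" for x y
    proof -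
      obtain X Y where "X \<in> C" "Y \<in> C" "x \<in> X" "y \<in> Y" using xy by blast
      moreover have "X \<subseteq> Y \<or> Y \<subseteq> X" using C(2) calculation unfolding subset_chain_def by blast
      ultimately show ?thesis by blast
    qed
    have "submodule (\<Union>C) k V"
    proof (rule V.submoduleI)
      show "\<Union>C \<subseteq> carrier V" using subE(1)[OF sub(1)] by blast
      show "\<zero> \<in> \<Union>C" using C(1) z[OF sub(1)] by blast
      show "\<ominus> a \<in> \<Union>C" if "a \<in> \<Union>C" for a using that subE(3)[OF sub(1)] by blast
      show "a \<oplus> b \<in> \<Union>C" if "a \<in> \<Union>C" "b \<in> \<Union>C" for a b
        using common[OF that] subE(5)[OF sub(1)] by blast
      show "a \<odot> x \<in> \<Union>C" if "a \<in> carrier k" "x \<in> \<Union>C" for a x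
        using that subE(4)[OF sub(1)] by blast
    qed
    moreover have "\<Union>C \<inter> W = {\<zero>}" using sub(2) C(1) by fastforce
    ultimately show ?thesis by blast
  qed
  obtain M where M: "M \<in> ?A" and max: "\<forall>X\<in>?A. M \<subseteq> X \<longrightarrow> X = M"
    using subset_Zorn_nonempty[OF ne ub] by blast
  have Msub: "submodule M k V" and MW: "M \<inter> W = {\<zero>}" using M by auto
  note ME = subE[OF Msub]
  have "\<exists>m\<in>M. \<exists>w\<in>W. x = m \<oplus> w" if x: "x \<in> carrier V" for x
  proof (rule ccontr)
    assume no: "\<not> ?thesis"
    let ?N = "{m \<oplus> c \<odot> x | m c. m \<in> M \<and> c \<in> carrier k}"
    have mc: "m \<in> carrier V" if "m \<in> M" for m using ME(1) that by blast
    have wc: "w \<in> carrier V" if "w \<in> W" for w using WE(1) that by blast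
    have N: "submodule ?N k V"
    proof (rule V.submoduleI)
      show "?N \<subseteq> carrier V" using mc x by auto
      show "\<zero> \<in> ?N" using z[OF Msub] x
        by (auto intro!: exI[of _ "\<zero>"] exI[of _ "\<zero>\<^bsub>k\<^esub>"])
    next
      fix a assume "a \<in> ?N"
      then obtain m c where a: "m \<in> M" "c \<in> carrier k" "a = m \<oplus> c \<odot> x" by auto
      then have "\<ominus> a = \<ominus> m \<oplus> (\<ominus>\<^bsub>k\<^esub> c) \<odot> x"
        using x mc by (simp add: V.smult_l_minus V.minus_add)
      then show "\<ominus> a \<in> ?N" using ME(3) a by blast
    next
      fix a b assume "a \<in> ?N" "b \<in> ?N"
      then obtain m c n d where a: "m \<in> M" "c \<in> carrier k" "a = m \<oplus> c \<odot> x"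
        and b: "n \<in> M" "d \<in> carrier k" "b = n \<oplus> d \<odot> x" by blast
      then have "a \<oplus> b = (m \<oplus> n) \<oplus> (c \<oplus>\<^bsub>k\<^esub> d) \<odot> x"
        using x mc by (simp add: V.smult_l_distr V.add.m_ac)
      then show "a \<oplus> b \<in> ?N" using ME(5) a b by blast
    next
      fix d a assume d: "d \<in> carrier k" and "a \<in> ?N"
      then obtain m c where a: "m \<in> M" "c \<in> carrier k" "a = m \<oplus> c \<odot> x" by auto
      then have "d \<odot> a = d \<odot> m \<oplus> (d \<otimes>\<^bsub>k\<^esub> c) \<odot> x"
        using x mc d by (simp add: V.smult_r_distr V.smult_assoc1)
      then show "d \<odot> a \<in> ?N" using ME(4) a d by blast
    qed
    have NW: "?N \<inter> W \<subseteq> {\<zero>}"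
    proof
      fix w assume "w \<in> ?N \<inter> W"
      then obtain m c where w: "w \<in> W" "m \<in> M" "c \<in> carrier k" "w = m \<oplus> c \<odot> x" by auto
      show "w \<in> {\<zero>}"
      proof (cases "c = \<zero>\<^bsub>k\<^esub>")
        case True
        then have "w \<in> M \<inter> W" using w x mc by simp
        then show ?thesis using MW by blast
      next
        case False
        then have u: "inv\<^bsub>k\<^esub> c \<in> carrier k" "inv\<^bsub>k\<^esub> c \<otimes>\<^bsub>k\<^esub> c = \<one>\<^bsub>k\<^esub>"
          using w k.field_Units by auto
        have "c \<odot> x = \<ominus> m \<oplus> w"
          using w x mc wc by (simp add: V.r_neg1)
        then have "inv\<^bsub>k\<^esub> c \<odot> (c \<odot> x) = inv\<^bsub>k\<^esub> c \<odot> (\<ominus> m \<oplus> w)" by simp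
        then have "x = inv\<^bsub>k\<^esub> c \<odot> (\<ominus> m) \<oplus> inv\<^bsub>k\<^esub> c \<odot> w"
          using u w x mc wc by (simp add: V.smult_assoc1[symmetric] V.smult_r_distr)
        then show ?thesis using no u ME(3,4) WE(4) w by blast
      qed
    qed
    have MN: "M \<subseteq> ?N"
    proof
      fix m assume "m \<in> M"
      then show "m \<in> ?N" using x mc by (auto intro!: exI[of _ m] exI[of _ "\<zero>\<^bsub>k\<^esub>"])
    qed
    have xN: "x \<in> ?N" using x z[OF Msub]
      by (auto intro!: exI[of _ "\<zero>"] exI[of _ "\<one>\<^bsub>k\<^esub>"])
    have "?N \<in> ?A" using N NW z[OF N] z[OF assms(3)] by blast
    then have "?N = M" using max MN by blast
    then have "x \<in> M" using xN by simp
    moreover have "x = x \<oplus> \<zero>" using x by simp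
    ultimately show False using no z[OF assms(3)] by blast
  qed
  then show ?thesis using Msub MW by blast
qed

lemma exists_projection:
  fixes V (structure)
  assumes "field k" "module k V" "submodule W k V"
  shows "\<exists>\<pi>\<in>linear_maps k V V. (\<forall>x\<in>carrier V. \<pi> x \<in> W) \<and> (\<forall>w\<in>W. \<pi> w = w)"
proof -
  interpret k: field k by fact
  interpret V: module k V by fact
  obtain M where M: "submodule M k V" "M \<inter> W = {\<zero>}"
    and dec: "\<forall>x\<in>carrier V. \<exists>m\<in>M. \<exists>w\<in>W. x = m \<oplus> w"
    using exists_complement[OF assms] by blast
  note WE = V.submoduleE[OF assms(3)] and ME = V.submoduleE[OF M(1)]
  have mc: "m \<in> carrier V" if "m \<in> M" for m using ME(1) that by blast
  have wc: "w \<in> carrier V" if "w \<in> W" for w using WE(1) that by blast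
  define \<pi> where "\<pi> x = (SOME w. w \<in> W \<and> (\<exists>m\<in>M. x = m \<oplus> w))" for x
  have p: "\<pi> x \<in> W \<and> (\<exists>m\<in>M. x = m \<oplus> \<pi> x)" if "x \<in> carrier V" for x
    unfolding \<pi>_def by (rule someI_ex) (use dec that in blast)
  have uniq: "\<pi> x = w" if w: "w \<in> W" "m \<in> M" "x = m \<oplus> w" for x w m
  proof -
    obtain n where n: "n \<in> M" "x = n \<oplus> \<pi> x" and pw: "\<pi> x \<in> W" using p[of x] w mc wc by auto
    have c: "n \<in> carrier V" "m \<in> carrier V" "w \<in> carrier V" "\<pi> x \<in> carrier V"
      using n w pw mc wc by auto
    have "\<pi> x = \<ominus> n \<oplus> (n \<oplus> \<pi> x)" using c by (simp only: V.r_neg1)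
    also have "\<dots> = \<ominus> n \<oplus> m \<oplus> w" using n(2) w(3) c by (simp add: V.add.m_assoc)
    finally have e: "\<pi> x \<ominus> w = \<ominus> n \<oplus> m"
      using c by (metis V.add.inv_closed V.add.m_closed V.add.inv_solve_right' V.minus_eq)
    have "\<pi> x \<ominus> w \<in> W" using WE(3,5) pw w by (simp add: V.minus_eq)
    moreover have "\<pi> x \<ominus> w \<in> M" unfolding e using ME(3,5) n w by simp
    ultimately have "\<pi> x \<ominus> w = \<zero>" using M(2) by blast
    then show ?thesis using c(3,4) by (simp only: V.minus_eq_zero_iff)
  qed
  have lin: "\<pi> \<in> linear_maps k V V"
  proof (rule linear_mapsI)
    show "\<pi> x \<in> carrier V" if "x \<in> carrier V" for x using p[OF that] wc by blast
  next
    fix x y assume xy: "x \<in> carrier V" "y \<in> carrier V"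
    then obtain m n where m: "m \<in> M" "x = m \<oplus> \<pi> x" "\<pi> x \<in> W" and n: "n \<in> M" "y = n \<oplus> \<pi> y" "\<pi> y \<in> W"
      using p by meson
    have "x \<oplus> y = (m \<oplus> \<pi> x) \<oplus> (n \<oplus> \<pi> y)" using m n by simp
    also have "\<dots> = (m \<oplus> n) \<oplus> (\<pi> x \<oplus> \<pi> y)"
      using m(1,3) n(1,3) mc wc by (simp add: V.add.m_ac)
    finally show "\<pi> (x \<oplus> y) = \<pi> x \<oplus> \<pi> y"
      using uniq[OF WE(5)[OF m(3) n(3)] ME(5)[OF m(1) n(1)]] by blast
  next
    fix c x assume cx: "c \<in> carrier k" "x \<in> carrier V"
    then obtain m where m: "m \<in> M" "x = m \<oplus> \<pi> x" "\<pi> x \<in> W" using p by meson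
    have "c \<odot> x = c \<odot> (m \<oplus> \<pi> x)" using m by simp
    also have "\<dots> = c \<odot> m \<oplus> c \<odot> \<pi> x"
      using m(1,3) cx mc wc by (simp add: V.smult_r_distr)
    finally show "\<pi> (c \<odot> x) = c \<odot> \<pi> x"
      using uniq[OF WE(4)[OF cx(1) m(3)] ME(4)[OF cx(1) m(1)]] by blast
  qed
  have fx: "\<pi> w = w" if "w \<in> W" for w
    using uniq[of w "\<zero>" w] that M(2) wc by auto
  show ?thesis using lin fx p by blast
qed

text \<open>
  The coordinate along \<open>u\<close> of a projection onto the line spanned by \<open>u\<close>.
\<close>

lemma exists_functional:
  fixes V (structure)
  assumes "field k" "module k V" "u \<in> carrier V" "u \<noteq> \<zero>"
  obtains \<phi> where "\<phi> \<in> carrier V \<rightarrow> carrier k"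
    "\<And>x y. \<lbrakk>x \<in> carrier V; y \<in> carrier V\<rbrakk> \<Longrightarrow> \<phi> (x \<oplus> y) = \<phi> x \<oplus>\<^bsub>k\<^esub> \<phi> y"
    "\<And>c x. \<lbrakk>c \<in> carrier k; x \<in> carrier V\<rbrakk> \<Longrightarrow> \<phi> (c \<odot> x) = c \<otimes>\<^bsub>k\<^esub> \<phi> x"
    "\<phi> u = \<one>\<^bsub>k\<^esub>"
proof -
  interpret k: field k by fact
  interpret V: module k V by fact
  let ?W = "{c \<odot> u | c. c \<in> carrier k}"
  have W: "submodule ?W k V"
  proof (rule V.submoduleI)
    show "?W \<subseteq> carrier V" using assms by auto
    show "\<zero> \<in> ?W" using assms by (auto intro!: exI[of _ "\<zero>\<^bsub>k\<^esub>"])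
    show "\<ominus> a \<in> ?W" if "a \<in> ?W" for a
      using that assms V.smult_l_minus[symmetric] k.a_inv_closed by blast
    show "a \<oplus> b \<in> ?W" if "a \<in> ?W" "b \<in> ?W" for a b
      using that assms V.smult_l_distr[symmetric] by auto
    show "a \<odot> x \<in> ?W" if "a \<in> carrier k" "x \<in> ?W" for a x
      using that assms V.smult_assoc1[symmetric] by auto
  qed
  obtain \<pi> where \<pi>: "\<pi> \<in> linear_maps k V V" "\<And>x. x \<in> carrier V \<Longrightarrow> \<pi> x \<in> ?W" "\<And>w. w \<in> ?W \<Longrightarrow> \<pi> w = w"
    using exists_projection[OF assms(1,2) W] by meson
  have inj: "c = d" if "c \<in> carrier k" "d \<in> carrier k" "c \<odot> u = d \<odot> u" for c d
  proof (rule ccontr)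
    assume ne: "c \<noteq> d"
    let ?e = "c \<ominus>\<^bsub>k\<^esub> d"
    have e: "?e \<in> carrier k" "?e \<noteq> \<zero>\<^bsub>k\<^esub>" using that ne by (auto simp: k.minus_eq_zero_iff)
    have "?e \<odot> u = \<zero>"
      using that assms by (simp add: k.minus_eq V.smult_l_distr V.smult_l_minus V.r_neg)
    then have "inv\<^bsub>k\<^esub> ?e \<odot> (?e \<odot> u) = \<zero>" using e k.field_Units by auto
    then show False using e k.field_Units assms by (simp add: V.smult_assoc1[symmetric])
  qed
  define \<phi> where "\<phi> x = (SOME c. c \<in> carrier k \<and> \<pi> x = c \<odot> u)" for x
  have f: "\<phi> x \<in> carrier k \<and> \<pi> x = \<phi> x \<odot> u" if "x \<in> carrier V" for x
    unfolding \<phi>_def by (rule someI_ex) (use \<pi>(2)[OF that] in blast)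
  have uniq: "\<phi> x = c" if "x \<in> carrier V" "c \<in> carrier k" "\<pi> x = c \<odot> u" for x c
    using inj f[OF that(1)] that by metis
  show thesis
  proof (rule that)
    show "\<phi> \<in> carrier V \<rightarrow> carrier k" using f by blast
    show "\<phi> (x \<oplus> y) = \<phi> x \<oplus>\<^bsub>k\<^esub> \<phi> y" if "x \<in> carrier V" "y \<in> carrier V" for x y
      using that f assms linear_mapsD(2)[OF \<pi>(1)] by (intro uniq) (auto simp: V.smult_l_distr)
    show "\<phi> (c \<odot> x) = c \<otimes>\<^bsub>k\<^esub> \<phi> x" if "c \<in> carrier k" "x \<in> carrier V" for c x
      using that f assms linear_mapsD(3)[OF \<pi>(1)] by (intro uniq) (auto simp: V.smult_assoc1)
    have "u \<in> ?W" using assms by (auto intro!: exI[of _ "\<one>\<^bsub>k\<^esub>"])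
    then have "\<pi> u = u" using \<pi>(3) by blast
    then show "\<phi> u = \<one>\<^bsub>k\<^esub>" using assms by (intro uniq) auto
  qed
qed

section \<open>Quotient algebras and centres\<close>

lemma assoc_algebraI:
  assumes "field F" "ring A" "module F A"
    and "\<And>c x y. \<lbrakk>c \<in> carrier F; x \<in> carrier A; y \<in> carrier A\<rbrakk>
        \<Longrightarrow> (c \<odot>\<^bsub>A\<^esub> x) \<otimes>\<^bsub>A\<^esub> y = c \<odot>\<^bsub>A\<^esub> (x \<otimes>\<^bsub>A\<^esub> y)"
    and "\<And>c x y. \<lbrakk>c \<in> carrier F; x \<in> carrier A; y \<in> carrier A\<rbrakk>
        \<Longrightarrow> x \<otimes>\<^bsub>A\<^esub> (c \<odot>\<^bsub>A\<^esub> y) = c \<odot>\<^bsub>A\<^esub> (x \<otimes>\<^bsub>A\<^esub> y)"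
  shows "assoc_algebra F A"
  using assms unfolding assoc_algebra_def assoc_algebra_axioms_def by blast

lemma assoc_algebraD:
  assumes "assoc_algebra F A"
  shows "field F" "ring A" "module F A" "abelian_group A"
    and "\<And>c x y. \<lbrakk>c \<in> carrier F; x \<in> carrier A; y \<in> carrier A\<rbrakk>
        \<Longrightarrow> (c \<odot>\<^bsub>A\<^esub> x) \<otimes>\<^bsub>A\<^esub> y = c \<odot>\<^bsub>A\<^esub> (x \<otimes>\<^bsub>A\<^esub> y)"
    and "\<And>c x y. \<lbrakk>c \<in> carrier F; x \<in> carrier A; y \<in> carrier A\<rbrakk>
        \<Longrightarrow> x \<otimes>\<^bsub>A\<^esub> (c \<odot>\<^bsub>A\<^esub> y) = c \<odot>\<^bsub>A\<^esub> (x \<otimes>\<^bsub>A\<^esub> y)"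
    and "cring F"
  using assms unfolding assoc_algebra_def assoc_algebra_axioms_def
  by (auto simp: ring.is_abelian_group module_def)

text \<open>
  Scalars act as multiplication by elements of the algebra: \<open>c x = (c 1) x\<close>.
\<close>

lemma ideal_smult_closed:
  assumes "assoc_algebra F A" "ideal I A" "c \<in> carrier F" "x \<in> I"
  shows "c \<odot>\<^bsub>A\<^esub> x \<in> I"
proof -
  interpret A: ring A by (rule assoc_algebraD(2)[OF assms(1)])
  interpret M: module F A by (rule assoc_algebraD(3)[OF assms(1)])
  interpret I: ideal I A by fact
  have "c \<odot>\<^bsub>A\<^esub> x = (c \<odot>\<^bsub>A\<^esub> \<one>\<^bsub>A\<^esub>) \<otimes>\<^bsub>A\<^esub> x"
    using assms(3,4) assoc_algebraD(5)[OF assms(1)] by simp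
  then show ?thesis using I.I_l_closed assms(3,4) by simp
qed

lemma ideal_is_submodule:
  assumes "assoc_algebra F A" "ideal I A"
  shows "submodule I F A"
proof -
  interpret M: module F A by (rule assoc_algebraD(3)[OF assms(1)])
  interpret I: ideal I A by fact
  show ?thesis
    by (rule M.submoduleI) (auto intro: ideal_smult_closed[OF assms])
qed

lemma quotient_algebra_simps:
  "carrier (quotient_algebra A I) = a_rcosets\<^bsub>A\<^esub> I"
  "mult (quotient_algebra A I) = rcoset_mult A I"
  "one (quotient_algebra A I) = I +>\<^bsub>A\<^esub> \<one>\<^bsub>A\<^esub>"
  "zero (quotient_algebra A I) = I"
  "add (quotient_algebra A I) = set_add A"
  "smult (quotient_algebra A I) = (\<lambda>c X. \<Union>x\<in>X. I +>\<^bsub>A\<^esub> (c \<odot>\<^bsub>A\<^esub> x))"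
  by (simp_all add: quotient_algebra_def FactRing_def ring.extend_def module.fields_def)

lemma a_rcos_eq_iff:
  assumes "ideal I A" "x \<in> carrier A" "y \<in> carrier A"
  shows "I +>\<^bsub>A\<^esub> x = I +>\<^bsub>A\<^esub> y \<longleftrightarrow> x \<ominus>\<^bsub>A\<^esub> y \<in> I"
proof -
  interpret I: ideal I A by fact
  show ?thesis using I.quotient_eq_iff_same_a_r_cos[OF assms] by simp
qed

text \<open>
  For the scalar multiplication, the union over all representatives of a coset collapses to one
  coset, because \<open>I\<close> is closed under scalars.
\<close>

lemma quotient_algebra_ops:
  assumes "assoc_algebra F A" "ideal I A" "x \<in> carrier A"
  shows "I +>\<^bsub>A\<^esub> x \<in> carrier (quotient_algebra A I)"
    and "y \<in> carrier A \<Longrightarrow> (I +>\<^bsub>A\<^esub> x) \<otimes>\<^bsub>quotient_algebra A I\<^esub> (I +>\<^bsub>A\<^esub> y) = I +>\<^bsub>A\<^esub> (x \<otimes>\<^bsub>A\<^esub> y)"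
    and "y \<in> carrier A \<Longrightarrow> (I +>\<^bsub>A\<^esub> x) \<oplus>\<^bsub>quotient_algebra A I\<^esub> (I +>\<^bsub>A\<^esub> y) = I +>\<^bsub>A\<^esub> (x \<oplus>\<^bsub>A\<^esub> y)"
    and "c \<in> carrier F \<Longrightarrow> c \<odot>\<^bsub>quotient_algebra A I\<^esub> (I +>\<^bsub>A\<^esub> x) = I +>\<^bsub>A\<^esub> (c \<odot>\<^bsub>A\<^esub> x)"
proof -
  interpret A: ring A by (rule assoc_algebraD(2)[OF assms(1)])
  interpret M: module F A by (rule assoc_algebraD(3)[OF assms(1)])
  interpret I: ideal I A by fact
  show "I +>\<^bsub>A\<^esub> x \<in> carrier (quotient_algebra A I)"
    using A.a_rcosetsI[OF I.a_subset assms(3)] by (simp add: quotient_algebra_simps)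
  show "y \<in> carrier A \<Longrightarrow> (I +>\<^bsub>A\<^esub> x) \<otimes>\<^bsub>quotient_algebra A I\<^esub> (I +>\<^bsub>A\<^esub> y) = I +>\<^bsub>A\<^esub> (x \<otimes>\<^bsub>A\<^esub> y)"
    using I.rcoset_mult_add[OF assms(3)] by (simp add: quotient_algebra_simps)
  show "y \<in> carrier A \<Longrightarrow> (I +>\<^bsub>A\<^esub> x) \<oplus>\<^bsub>quotient_algebra A I\<^esub> (I +>\<^bsub>A\<^esub> y) = I +>\<^bsub>A\<^esub> (x \<oplus>\<^bsub>A\<^esub> y)"
    using I.a_rcos_sum assms(3) by (simp add: quotient_algebra_simps)
  assume c: "c \<in> carrier F"
  have "I +>\<^bsub>A\<^esub> (c \<odot>\<^bsub>A\<^esub> y) = I +>\<^bsub>A\<^esub> (c \<odot>\<^bsub>A\<^esub> x)" if y: "y \<in> I +>\<^bsub>A\<^esub> x" for y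
  proof -
    obtain i where i: "i \<in> I" "y = i \<oplus>\<^bsub>A\<^esub> x" using y by (auto simp: a_r_coset_def')
    have ic: "i \<in> carrier A" using i by auto
    have "c \<odot>\<^bsub>A\<^esub> y \<ominus>\<^bsub>A\<^esub> c \<odot>\<^bsub>A\<^esub> x = c \<odot>\<^bsub>A\<^esub> i"
      using i c ic assms(3) by (simp add: M.smult_r_distr A.minus_eq A.a_assoc A.r_neg)
    then show ?thesis using ideal_smult_closed[OF assms(1,2) c i(1)] i c ic assms(3)
      by (subst a_rcos_eq_iff[OF assms(2)]) auto
  qed
  moreover have "x \<in> I +>\<^bsub>A\<^esub> x" using I.a_rcos_self assms(3) by simp
  ultimately show "c \<odot>\<^bsub>quotient_algebra A I\<^esub> (I +>\<^bsub>A\<^esub> x) = I +>\<^bsub>A\<^esub> (c \<odot>\<^bsub>A\<^esub> x)"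
    unfolding quotient_algebra_simps by blast
qed

lemma quotient_algebra_elem:
  assumes "X \<in> carrier (quotient_algebra A I)"
  obtains x where "x \<in> carrier A" "X = I +>\<^bsub>A\<^esub> x"
  using assms by (auto simp: quotient_algebra_simps A_RCOSETS_def')

lemma ring_quotient_algebra:
  assumes "assoc_algebra F A" "ideal I A" shows "ring (quotient_algebra A I)"
proof -
  interpret A: ring A by (rule assoc_algebraD(2)[OF assms(1)])
  interpret I: ideal I A by fact
  note ops = quotient_algebra_ops[OF assms]
  have z: "\<zero>\<^bsub>quotient_algebra A I\<^esub> = I +>\<^bsub>A\<^esub> \<zero>\<^bsub>A\<^esub>"
    by (simp add: quotient_algebra_simps I.a_rcos_const)
  have o: "\<one>\<^bsub>quotient_algebra A I\<^esub> = I +>\<^bsub>A\<^esub> \<one>\<^bsub>A\<^esub>"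
    by (simp add: quotient_algebra_simps)
  have neg: "\<exists>Y\<in>carrier (quotient_algebra A I). Y \<oplus>\<^bsub>quotient_algebra A I\<^esub> X = \<zero>\<^bsub>quotient_algebra A I\<^esub>"
    if X: "X \<in> carrier (quotient_algebra A I)" for X
  proof -
    obtain x where x: "x \<in> carrier A" "X = I +>\<^bsub>A\<^esub> x" using X by (rule quotient_algebra_elem)
    show ?thesis
      by (rule bexI[of _ "I +>\<^bsub>A\<^esub> (\<ominus>\<^bsub>A\<^esub> x)"]) (simp_all add: x ops z A.l_neg)
  qed
  show ?thesis
    by (intro ringI abelian_groupI monoidI neg)
      (auto elim!: quotient_algebra_elem simp: ops z o A.add.m_ac A.m_assoc A.l_distr A.r_distr)
qed

lemma assoc_algebra_quotient:
  assumes "assoc_algebra F A" "ideal I A"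
  shows "assoc_algebra F (quotient_algebra A I)"
proof -
  interpret A: ring A by (rule assoc_algebraD(2)[OF assms(1)])
  interpret M: module F A by (rule assoc_algebraD(3)[OF assms(1)])
  interpret F: field F by (rule assoc_algebraD(1)[OF assms(1)])
  note ops = quotient_algebra_ops[OF assms]
  have R: "ring (quotient_algebra A I)" by (rule ring_quotient_algebra[OF assms])
  show ?thesis
  proof (rule assoc_algebraI[OF F.field_axioms R])
    show "module F (quotient_algebra A I)"
      by (rule moduleI[OF assoc_algebraD(7)[OF assms(1)] ring.is_abelian_group[OF R]])
        (auto elim!: quotient_algebra_elem simp: ops M.smult_l_distr M.smult_r_distr M.smult_assoc1)
  qed (auto elim!: quotient_algebra_elem simp: ops assoc_algebraD(5,6)[OF assms(1)])
qed

lemma center_algebra_simps [simp]: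
  "mult (center_algebra A) = mult A" "one (center_algebra A) = one A"
  "zero (center_algebra A) = zero A" "add (center_algebra A) = add A"
  "smult (center_algebra A) = smult A"
  by (simp_all add: center_algebra_def)

lemma center_algebraI:
  assumes "z \<in> carrier A" "\<And>x. x \<in> carrier A \<Longrightarrow> z \<otimes>\<^bsub>A\<^esub> x = x \<otimes>\<^bsub>A\<^esub> z"
  shows "z \<in> carrier (center_algebra A)"
  using assms by (simp add: center_algebra_def)

lemma center_algebraD:
  assumes "z \<in> carrier (center_algebra A)"
  shows "z \<in> carrier A" "x \<in> carrier A \<Longrightarrow> z \<otimes>\<^bsub>A\<^esub> x = x \<otimes>\<^bsub>A\<^esub> z"
  using assms by (simp_all add: center_algebra_def)

lemma center_is_submodule:
  assumes "assoc_algebra F A"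
  shows "submodule (carrier (center_algebra A)) F A"
proof -
  interpret A: ring A by (rule assoc_algebraD(2)[OF assms])
  interpret M: module F A by (rule assoc_algebraD(3)[OF assms])
  note sm = assoc_algebraD(5,6)[OF assms] and cD = center_algebraD[of _ A]
  show ?thesis
  proof (rule M.submoduleI)
    show "carrier (center_algebra A) \<subseteq> carrier A" using cD(1) by blast
    show "\<zero>\<^bsub>A\<^esub> \<in> carrier (center_algebra A)" by (rule center_algebraI) auto
    show "\<ominus>\<^bsub>A\<^esub> a \<in> carrier (center_algebra A)" if "a \<in> carrier (center_algebra A)" for a
      by (rule center_algebraI) (simp_all add: cD[OF that] A.l_minus A.r_minus)
    show "a \<oplus>\<^bsub>A\<^esub> b \<in> carrier (center_algebra A)"
      if "a \<in> carrier (center_algebra A)" "b \<in> carrier (center_algebra A)" for a b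
      by (rule center_algebraI) (simp_all add: cD[OF that(1)] cD[OF that(2)] A.l_distr A.r_distr)
    show "a \<odot>\<^bsub>A\<^esub> x \<in> carrier (center_algebra A)"
      if "a \<in> carrier F" "x \<in> carrier (center_algebra A)" for a x
      by (rule center_algebraI) (simp_all add: cD[OF that(2)] that(1) sm)
  qed
qed

lemma center_mult_closed:
  assumes "assoc_algebra F A"
    and x: "x \<in> carrier (center_algebra A)" and y: "y \<in> carrier (center_algebra A)"
  shows "x \<otimes>\<^bsub>A\<^esub> y \<in> carrier (center_algebra A)"
proof -
  interpret A: ring A by (rule assoc_algebraD(2)[OF assms(1)])
  note cx = center_algebraD[OF x] and cy = center_algebraD[OF y]
  show ?thesis
  proof (rule center_algebraI)
    fix z assume z: "z \<in> carrier A"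
    have "x \<otimes>\<^bsub>A\<^esub> y \<otimes>\<^bsub>A\<^esub> z = x \<otimes>\<^bsub>A\<^esub> (z \<otimes>\<^bsub>A\<^esub> y)"
      using A.m_assoc[OF cx(1) cy(1) z] cy(2)[OF z] by simp
    also have "\<dots> = z \<otimes>\<^bsub>A\<^esub> x \<otimes>\<^bsub>A\<^esub> y"
      using A.m_assoc[OF cx(1) z cy(1)] cx(2)[OF z] by simp
    also have "\<dots> = z \<otimes>\<^bsub>A\<^esub> (x \<otimes>\<^bsub>A\<^esub> y)"
      by (rule A.m_assoc[OF z cx(1) cy(1)])
    finally show "x \<otimes>\<^bsub>A\<^esub> y \<otimes>\<^bsub>A\<^esub> z = z \<otimes>\<^bsub>A\<^esub> (x \<otimes>\<^bsub>A\<^esub> y)" .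
  qed (use cx(1) cy(1) in simp)
qed

lemma cring_center:
  assumes "assoc_algebra F A"
  shows "cring (center_algebra A)"
proof -
  interpret A: ring A by (rule assoc_algebraD(2)[OF assms])
  interpret M: module F A by (rule assoc_algebraD(3)[OF assms])
  note cD = center_algebraD[of _ A]
    and cE = M.submoduleE[OF center_is_submodule[OF assms]]
  have z: "\<zero>\<^bsub>A\<^esub> \<in> carrier (center_algebra A)" by (rule center_algebraI) auto
  have o: "\<one>\<^bsub>A\<^esub> \<in> carrier (center_algebra A)" by (rule center_algebraI) auto
  have ab: "abelian_group (center_algebra A)"
  proof (rule abelian_groupI)
    show "\<exists>y\<in>carrier (center_algebra A). y \<oplus>\<^bsub>center_algebra A\<^esub> x = \<zero>\<^bsub>center_algebra A\<^esub>"
      if "x \<in> carrier (center_algebra A)" for x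
      using cE(3)[OF that] cD(1)[OF that] by (intro bexI[of _ "\<ominus>\<^bsub>A\<^esub> x"]) (simp_all add: A.l_neg)
  qed (simp_all add: cE cD(1) z A.add.m_ac)
  show ?thesis
  proof (rule cringI[OF ab])
    show "comm_monoid (center_algebra A)"
    proof (rule comm_monoidI)
      fix x y assume "x \<in> carrier (center_algebra A)" "y \<in> carrier (center_algebra A)"
      then show "x \<otimes>\<^bsub>center_algebra A\<^esub> y = y \<otimes>\<^bsub>center_algebra A\<^esub> x"
        unfolding center_algebra_simps by (intro cD)
    qed (simp_all add: cD(1) o center_mult_closed[OF assms] A.m_assoc)
  qed (simp add: cD(1) A.l_distr)
qed

lemma assoc_algebra_center:
  assumes "assoc_algebra F A"
  shows "assoc_algebra F (center_algebra A)"
proof -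
  interpret A: ring A by (rule assoc_algebraD(2)[OF assms])
  interpret M: module F A by (rule assoc_algebraD(3)[OF assms])
  interpret C: cring "center_algebra A" by (rule cring_center[OF assms])
  note sm = assoc_algebraD(5,6)[OF assms] and cD = center_algebraD(1)[of _ A]
    and cE = M.submoduleE[OF center_is_submodule[OF assms]]
  show ?thesis
  proof (rule assoc_algebraI[OF assoc_algebraD(1)[OF assms] C.ring_axioms])
    show "module F (center_algebra A)"
      by (rule moduleI[OF assoc_algebraD(7)[OF assms] C.abelian_group_axioms])
        (simp_all add: cD cE M.smult_l_distr M.smult_r_distr M.smult_assoc1)
  qed (simp_all add: sm cD)
qed

lemma algebra_homI:
  assumes "\<And>x. x \<in> carrier A \<Longrightarrow> h x \<in> carrier B"
    and "\<And>x y. \<lbrakk>x \<in> carrier A; y \<in> carrier A\<rbrakk> \<Longrightarrow> h (x \<otimes>\<^bsub>A\<^esub> y) = h x \<otimes>\<^bsub>B\<^esub> h y"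
    and "\<And>x y. \<lbrakk>x \<in> carrier A; y \<in> carrier A\<rbrakk> \<Longrightarrow> h (x \<oplus>\<^bsub>A\<^esub> y) = h x \<oplus>\<^bsub>B\<^esub> h y"
    and "h \<one>\<^bsub>A\<^esub> = \<one>\<^bsub>B\<^esub>"
    and "\<And>c x. \<lbrakk>c \<in> carrier F; x \<in> carrier A\<rbrakk> \<Longrightarrow> h (c \<odot>\<^bsub>A\<^esub> x) = c \<odot>\<^bsub>B\<^esub> h x"
  shows "h \<in> algebra_hom F A B"
  using assms unfolding algebra_hom_def ring_hom_def by auto

lemma algebra_homD:
  assumes "h \<in> algebra_hom F A B"
  shows "x \<in> carrier A \<Longrightarrow> h x \<in> carrier B"
    and "\<lbrakk>x \<in> carrier A; y \<in> carrier A\<rbrakk> \<Longrightarrow> h (x \<otimes>\<^bsub>A\<^esub> y) = h x \<otimes>\<^bsub>B\<^esub> h y"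
    and "\<lbrakk>x \<in> carrier A; y \<in> carrier A\<rbrakk> \<Longrightarrow> h (x \<oplus>\<^bsub>A\<^esub> y) = h x \<oplus>\<^bsub>B\<^esub> h y"
    and "h \<one>\<^bsub>A\<^esub> = \<one>\<^bsub>B\<^esub>"
    and "\<lbrakk>c \<in> carrier F; x \<in> carrier A\<rbrakk> \<Longrightarrow> h (c \<odot>\<^bsub>A\<^esub> x) = c \<odot>\<^bsub>B\<^esub> h x"
  using assms unfolding algebra_hom_def ring_hom_def by auto

lemma algebra_hom_linear: "h \<in> algebra_hom F A B \<Longrightarrow> h \<in> linear_maps F A B"
  by (rule linear_mapsI) (auto dest: algebra_homD)

lemma quotient_map_hom:
  assumes "assoc_algebra F A" "ideal I A"
  shows "(\<lambda>x. I +>\<^bsub>A\<^esub> x) \<in> algebra_hom F A (quotient_algebra A I)"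
  by (rule algebra_homI) (simp_all add: quotient_algebra_ops[OF assms] quotient_algebra_simps(3))

section \<open>The algebra of formal combinations of pairs\<close>

locale algebra_pair =
  fixes F :: "('f, 'm) ring_scheme" and A :: "('f, 'a) module" and B :: "('f, 'b) module"
  assumes A_alg: "assoc_algebra F A" and B_alg: "assoc_algebra F B"
begin

sublocale F: field F by (rule assoc_algebraD(1)[OF A_alg])
sublocale A: ring A by (rule assoc_algebraD(2)[OF A_alg])
sublocale B: ring B by (rule assoc_algebraD(2)[OF B_alg])
sublocale AM: module F A by (rule assoc_algebraD(3)[OF A_alg])
sublocale BM: module F B by (rule assoc_algebraD(3)[OF B_alg])

abbreviation "M \<equiv> free_tensor F A B"
abbreviation "gen p \<equiv> free_gen F (fst p) (snd p)"
abbreviation "pmul p q \<equiv> (fst p \<otimes>\<^bsub>A\<^esub> fst q, snd p \<otimes>\<^bsub>B\<^esub> snd q)"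

lemma free_tensor_simps:
  "mult M = (\<lambda>f g p. \<Oplus>\<^bsub>F\<^esub>u \<in> {(x, y). f x \<noteq> \<zero>\<^bsub>F\<^esub> \<and> g y \<noteq> \<zero>\<^bsub>F\<^esub> \<and> pmul x y = p}.
                        f (fst u) \<otimes>\<^bsub>F\<^esub> g (snd u))"
  "one M = free_gen F \<one>\<^bsub>A\<^esub> \<one>\<^bsub>B\<^esub>"
  "zero M = (\<lambda>p. \<zero>\<^bsub>F\<^esub>)"
  "add M = (\<lambda>f g p. f p \<oplus>\<^bsub>F\<^esub> g p)"
  "smult M = (\<lambda>c f p. c \<otimes>\<^bsub>F\<^esub> f p)"
  by (simp_all add: free_tensor_def free_gen_def)

lemma free_carrierI:
  assumes "\<And>p. f p \<in> carrier F" "finite S" "{p. f p \<noteq> \<zero>\<^bsub>F\<^esub>} \<subseteq> S" "S \<subseteq> carrier A \<times> carrier B"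
  shows "f \<in> carrier M"
  using assms finite_subset[OF assms(3,2)] unfolding free_tensor_def by auto

lemma free_carrierD:
  assumes "f \<in> carrier M"
  shows "f p \<in> carrier F" "finite {p. f p \<noteq> \<zero>\<^bsub>F\<^esub>}" "{p. f p \<noteq> \<zero>\<^bsub>F\<^esub>} \<subseteq> carrier A \<times> carrier B"
  using assms unfolding free_tensor_def by auto

lemma free_gen_carrier [simp]:
  "\<lbrakk>a \<in> carrier A; b \<in> carrier B\<rbrakk> \<Longrightarrow> free_gen F a b \<in> carrier M"
  by (rule free_carrierI[of _ "{(a, b)}"]) (auto simp: free_gen_def)

lemma free_add_closed: "\<lbrakk>f \<in> carrier M; g \<in> carrier M\<rbrakk> \<Longrightarrow> f \<oplus>\<^bsub>M\<^esub> g \<in> carrier M"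
  using free_carrierD[of f] free_carrierD[of g]
  by (intro free_carrierI[of _ "{p. f p \<noteq> \<zero>\<^bsub>F\<^esub>} \<union> {p. g p \<noteq> \<zero>\<^bsub>F\<^esub>}"])
    (auto simp: free_tensor_simps)

lemma free_smult_closed: "\<lbrakk>c \<in> carrier F; f \<in> carrier M\<rbrakk> \<Longrightarrow> c \<odot>\<^bsub>M\<^esub> f \<in> carrier M"
  using free_carrierD[of f]
  by (intro free_carrierI[of _ "{p. f p \<noteq> \<zero>\<^bsub>F\<^esub>}"]) (auto simp: free_tensor_simps)

lemma free_zero_closed: "\<zero>\<^bsub>M\<^esub> \<in> carrier M"
  by (rule free_carrierI[of _ "{}"]) (auto simp: free_tensor_simps)

lemma free_module: "module F M"
proof (rule moduleI)
  show "cring F" by (rule assoc_algebraD(7)[OF A_alg])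
  show "abelian_group M"
  proof (rule abelian_groupI)
    fix f assume f: "f \<in> carrier M"
    have "(\<ominus>\<^bsub>F\<^esub> \<one>\<^bsub>F\<^esub>) \<odot>\<^bsub>M\<^esub> f \<in> carrier M" using f by (intro free_smult_closed) auto
    moreover have "(\<ominus>\<^bsub>F\<^esub> \<one>\<^bsub>F\<^esub>) \<odot>\<^bsub>M\<^esub> f \<oplus>\<^bsub>M\<^esub> f = \<zero>\<^bsub>M\<^esub>"
      using free_carrierD(1)[OF f] by (auto simp: free_tensor_simps F.l_minus F.l_neg)
    ultimately show "\<exists>g\<in>carrier M. g \<oplus>\<^bsub>M\<^esub> f = \<zero>\<^bsub>M\<^esub>" by blast
  qed (simp_all add: free_add_closed free_zero_closed,
      auto simp: free_tensor_simps free_carrierD(1) F.add.m_ac)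
qed (auto simp: free_smult_closed, auto simp: free_tensor_simps free_carrierD(1) F.l_distr F.r_distr F.m_assoc)

sublocale M: module F M by (rule free_module)

text \<open>
  Elements have finite support, so identities that are linear in each argument need to be checked
  on generators only.
\<close>

lemma free_induct [consumes 1, case_names zero gen add]:
  assumes "f \<in> carrier M"
    and zero: "P \<zero>\<^bsub>M\<^esub>"
    and gen: "\<And>c a b. \<lbrakk>c \<in> carrier F; a \<in> carrier A; b \<in> carrier B\<rbrakk> \<Longrightarrow> P (c \<odot>\<^bsub>M\<^esub> free_gen F a b)"
    and add: "\<And>f g. \<lbrakk>f \<in> carrier M; g \<in> carrier M; P f; P g\<rbrakk> \<Longrightarrow> P (f \<oplus>\<^bsub>M\<^esub> g)"
  shows "P f"
proof -
  have "\<forall>f\<in>carrier M. {p. f p \<noteq> \<zero>\<^bsub>F\<^esub>} \<subseteq> S \<longrightarrow> P f"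
    if "finite S" "S \<subseteq> carrier A \<times> carrier B" for S
    using that
  proof (induction S rule: finite_induct)
    case empty
    have "f = \<zero>\<^bsub>M\<^esub>" if "{p. f p \<noteq> \<zero>\<^bsub>F\<^esub>} \<subseteq> {}" for f :: "'a \<times> 'b \<Rightarrow> 'f"
      using that by (auto simp: free_tensor_simps)
    then show ?case using zero by blast
  next
    case (insert q S)
    show ?case
    proof (intro ballI impI)
      fix f assume f: "f \<in> carrier M" "{p. f p \<noteq> \<zero>\<^bsub>F\<^esub>} \<subseteq> insert q S"
      let ?g = "f(q := \<zero>\<^bsub>F\<^esub>)" and ?h = "f q \<odot>\<^bsub>M\<^esub> gen q"
      have q: "fst q \<in> carrier A" "snd q \<in> carrier B" using insert.prems by auto
      have g: "?g \<in> carrier M"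
        using free_carrierD(1)[OF f(1)] insert.hyps insert.prems f(2)
        by (intro free_carrierI[of _ S]) auto
      have h: "?h \<in> carrier M" using free_carrierD(1)[OF f(1)] q by (intro free_smult_closed) auto
      have "{p. ?g p \<noteq> \<zero>\<^bsub>F\<^esub>} \<subseteq> S" using f(2) by auto
      then have "P ?g" using insert.IH insert.prems g by blast
      moreover have "P ?h" using gen q free_carrierD(1)[OF f(1)] by blast
      moreover have "f = ?g \<oplus>\<^bsub>M\<^esub> ?h"
      proof
        show "f p = (?g \<oplus>\<^bsub>M\<^esub> ?h) p" for p
          using free_carrierD(1)[OF f(1), of p] free_carrierD(1)[OF f(1), of q]
          by (simp add: free_tensor_simps free_gen_def)
      qed
      ultimately show "P f" using add[OF g h] by simp
    qed
  qed
  then show ?thesis using free_carrierD[OF assms(1)] assms(1) by blast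
qed

text \<open>
  In the definition the index set of the sum depends on both factors. Over a fixed rectangle that
  contains the supports, the products of different factors can be compared term by term.
\<close>

lemma free_mult_eval:
  assumes "f \<in> carrier M" "g \<in> carrier M" "finite S" "finite S'"
    "{p. f p \<noteq> \<zero>\<^bsub>F\<^esub>} \<subseteq> S" "{p. g p \<noteq> \<zero>\<^bsub>F\<^esub>} \<subseteq> S'"
  shows "(f \<otimes>\<^bsub>M\<^esub> g) p =
    (\<Oplus>\<^bsub>F\<^esub>u\<in>S \<times> S'. if pmul (fst u) (snd u) = p then f (fst u) \<otimes>\<^bsub>F\<^esub> g (snd u) else \<zero>\<^bsub>F\<^esub>)"
  unfolding free_tensor_simps
  using assms free_carrierD(1)[OF assms(1)] free_carrierD(1)[OF assms(2)]
  by (intro F.add.finprod_mono_neutral_cong_left) auto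

lemma free_mult_closed:
  assumes f: "f \<in> carrier M" and g: "g \<in> carrier M"
  shows "f \<otimes>\<^bsub>M\<^esub> g \<in> carrier M"
proof -
  let ?S = "{p. f p \<noteq> \<zero>\<^bsub>F\<^esub>}" and ?S' = "{p. g p \<noteq> \<zero>\<^bsub>F\<^esub>}"
  let ?T = "(\<lambda>u. pmul (fst u) (snd u)) ` (?S \<times> ?S')"
  note fD = free_carrierD[OF f] and gD = free_carrierD[OF g]
  have ev: "(f \<otimes>\<^bsub>M\<^esub> g) p =
    (\<Oplus>\<^bsub>F\<^esub>u\<in>?S \<times> ?S'. if pmul (fst u) (snd u) = p then f (fst u) \<otimes>\<^bsub>F\<^esub> g (snd u) else \<zero>\<^bsub>F\<^esub>)" for p
    by (rule free_mult_eval[OF f g fD(2) gD(2)]) auto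
  show ?thesis
  proof (rule free_carrierI)
    show "(f \<otimes>\<^bsub>M\<^esub> g) p \<in> carrier F" for p
      unfolding ev using fD(1) gD(1) by (intro F.finsum_closed) auto
    show "finite ?T" using fD(2) gD(2) by blast
    show "?T \<subseteq> carrier A \<times> carrier B"
      using fD(3) gD(3) by fastforce
    have "(f \<otimes>\<^bsub>M\<^esub> g) p = \<zero>\<^bsub>F\<^esub>" if "p \<notin> ?T" for p
      unfolding ev using that by (intro F.add.finprod_one_eqI) auto
    then show "{p. (f \<otimes>\<^bsub>M\<^esub> g) p \<noteq> \<zero>\<^bsub>F\<^esub>} \<subseteq> ?T" by blast
  qed
qed

lemma free_mult_distr:
  assumes f: "f \<in> carrier M" and g: "g \<in> carrier M" and h: "h \<in> carrier M"
  shows "(f \<oplus>\<^bsub>M\<^esub> g) \<otimes>\<^bsub>M\<^esub> h = f \<otimes>\<^bsub>M\<^esub> h \<oplus>\<^bsub>M\<^esub> g \<otimes>\<^bsub>M\<^esub> h"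
    and "h \<otimes>\<^bsub>M\<^esub> (f \<oplus>\<^bsub>M\<^esub> g) = h \<otimes>\<^bsub>M\<^esub> f \<oplus>\<^bsub>M\<^esub> h \<otimes>\<^bsub>M\<^esub> g"
proof -
  let ?S = "{p. f p \<noteq> \<zero>\<^bsub>F\<^esub>} \<union> {p. g p \<noteq> \<zero>\<^bsub>F\<^esub>}" and ?T = "{p. h p \<noteq> \<zero>\<^bsub>F\<^esub>}"
  note fD = free_carrierD[OF f] and gD = free_carrierD[OF g] and hD = free_carrierD[OF h]
  have fin: "finite ?S" "finite ?T" using fD(2) gD(2) hD(2) by auto
  have sub: "{p. (f \<oplus>\<^bsub>M\<^esub> g) p \<noteq> \<zero>\<^bsub>F\<^esub>} \<subseteq> ?S" using fD(1) gD(1) by (auto simp: free_tensor_simps)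
  have fg: "f \<oplus>\<^bsub>M\<^esub> g \<in> carrier M" using f g by (rule free_add_closed)
  have pt: "(x \<oplus>\<^bsub>M\<^esub> y) p = x p \<oplus>\<^bsub>F\<^esub> y p" for x y p by (simp add: free_tensor_simps)
  show "(f \<oplus>\<^bsub>M\<^esub> g) \<otimes>\<^bsub>M\<^esub> h = f \<otimes>\<^bsub>M\<^esub> h \<oplus>\<^bsub>M\<^esub> g \<otimes>\<^bsub>M\<^esub> h"
  proof
    fix p
    have "((f \<oplus>\<^bsub>M\<^esub> g) \<otimes>\<^bsub>M\<^esub> h) p = (\<Oplus>\<^bsub>F\<^esub>u\<in>?S \<times> ?T.
        (if pmul (fst u) (snd u) = p then f (fst u) \<otimes>\<^bsub>F\<^esub> h (snd u) else \<zero>\<^bsub>F\<^esub>) \<oplus>\<^bsub>F\<^esub>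
        (if pmul (fst u) (snd u) = p then g (fst u) \<otimes>\<^bsub>F\<^esub> h (snd u) else \<zero>\<^bsub>F\<^esub>))"
      unfolding free_mult_eval[OF fg h fin sub order_refl]
      using fD(1) gD(1) hD(1) by (intro F.finsum_cong') (auto simp: pt F.l_distr)
    also have "\<dots> = (f \<otimes>\<^bsub>M\<^esub> h \<oplus>\<^bsub>M\<^esub> g \<otimes>\<^bsub>M\<^esub> h) p"
      unfolding pt free_mult_eval[OF f h fin Un_upper1 order_refl] free_mult_eval[OF g h fin Un_upper2 order_refl]
      using fD(1) gD(1) hD(1) by (intro F.finsum_addf) auto
    finally show "((f \<oplus>\<^bsub>M\<^esub> g) \<otimes>\<^bsub>M\<^esub> h) p = (f \<otimes>\<^bsub>M\<^esub> h \<oplus>\<^bsub>M\<^esub> g \<otimes>\<^bsub>M\<^esub> h) p" .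
  qed
  show "h \<otimes>\<^bsub>M\<^esub> (f \<oplus>\<^bsub>M\<^esub> g) = h \<otimes>\<^bsub>M\<^esub> f \<oplus>\<^bsub>M\<^esub> h \<otimes>\<^bsub>M\<^esub> g"
  proof
    fix p
    have "(h \<otimes>\<^bsub>M\<^esub> (f \<oplus>\<^bsub>M\<^esub> g)) p = (\<Oplus>\<^bsub>F\<^esub>u\<in>?T \<times> ?S.
        (if pmul (fst u) (snd u) = p then h (fst u) \<otimes>\<^bsub>F\<^esub> f (snd u) else \<zero>\<^bsub>F\<^esub>) \<oplus>\<^bsub>F\<^esub>
        (if pmul (fst u) (snd u) = p then h (fst u) \<otimes>\<^bsub>F\<^esub> g (snd u) else \<zero>\<^bsub>F\<^esub>))"
      unfolding free_mult_eval[OF h fg fin(2,1) order_refl sub]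
      using fD(1) gD(1) hD(1) by (intro F.finsum_cong') (auto simp: pt F.r_distr)
    also have "\<dots> = (h \<otimes>\<^bsub>M\<^esub> f \<oplus>\<^bsub>M\<^esub> h \<otimes>\<^bsub>M\<^esub> g) p"
      unfolding pt free_mult_eval[OF h f fin(2,1) order_refl Un_upper1] free_mult_eval[OF h g fin(2,1) order_refl Un_upper2]
      using fD(1) gD(1) hD(1) by (intro F.finsum_addf) auto
    finally show "(h \<otimes>\<^bsub>M\<^esub> (f \<oplus>\<^bsub>M\<^esub> g)) p = (h \<otimes>\<^bsub>M\<^esub> f \<oplus>\<^bsub>M\<^esub> h \<otimes>\<^bsub>M\<^esub> g) p" .
  qed
qed

lemma free_mult_smult:
  assumes f: "f \<in> carrier M" and g: "g \<in> carrier M" and c: "c \<in> carrier F"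
  shows "(c \<odot>\<^bsub>M\<^esub> f) \<otimes>\<^bsub>M\<^esub> g = c \<odot>\<^bsub>M\<^esub> (f \<otimes>\<^bsub>M\<^esub> g)"
    and "f \<otimes>\<^bsub>M\<^esub> (c \<odot>\<^bsub>M\<^esub> g) = c \<odot>\<^bsub>M\<^esub> (f \<otimes>\<^bsub>M\<^esub> g)"
proof -
  let ?S = "{p. f p \<noteq> \<zero>\<^bsub>F\<^esub>}" and ?T = "{p. g p \<noteq> \<zero>\<^bsub>F\<^esub>}"
  note fD = free_carrierD[OF f] and gD = free_carrierD[OF g]
  have pt: "(c \<odot>\<^bsub>M\<^esub> x) p = c \<otimes>\<^bsub>F\<^esub> x p" for x p by (simp add: free_tensor_simps)
  have cf: "c \<odot>\<^bsub>M\<^esub> f \<in> carrier M" "{p. (c \<odot>\<^bsub>M\<^esub> f) p \<noteq> \<zero>\<^bsub>F\<^esub>} \<subseteq> ?S"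
    using f c by (auto simp: free_smult_closed pt)
  have cg: "c \<odot>\<^bsub>M\<^esub> g \<in> carrier M" "{p. (c \<odot>\<^bsub>M\<^esub> g) p \<noteq> \<zero>\<^bsub>F\<^esub>} \<subseteq> ?T"
    using g c by (auto simp: free_smult_closed pt)
  have s: "(c \<odot>\<^bsub>M\<^esub> (f \<otimes>\<^bsub>M\<^esub> g)) p = (\<Oplus>\<^bsub>F\<^esub>u\<in>?S \<times> ?T. c \<otimes>\<^bsub>F\<^esub>
      (if pmul (fst u) (snd u) = p then f (fst u) \<otimes>\<^bsub>F\<^esub> g (snd u) else \<zero>\<^bsub>F\<^esub>))" for p
    unfolding pt free_mult_eval[OF f g fD(2) gD(2) order_refl order_refl]
    using fD(1,2) gD(1,2) c by (intro F.finsum_rdistr) auto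
  show "(c \<odot>\<^bsub>M\<^esub> f) \<otimes>\<^bsub>M\<^esub> g = c \<odot>\<^bsub>M\<^esub> (f \<otimes>\<^bsub>M\<^esub> g)"
  proof
    show "((c \<odot>\<^bsub>M\<^esub> f) \<otimes>\<^bsub>M\<^esub> g) p = (c \<odot>\<^bsub>M\<^esub> (f \<otimes>\<^bsub>M\<^esub> g)) p" for p
      unfolding s free_mult_eval[OF cf(1) g fD(2) gD(2) cf(2) order_refl]
      using fD(1) gD(1) c by (intro F.finsum_cong') (auto simp: pt F.m_assoc)
  qed
  show "f \<otimes>\<^bsub>M\<^esub> (c \<odot>\<^bsub>M\<^esub> g) = c \<odot>\<^bsub>M\<^esub> (f \<otimes>\<^bsub>M\<^esub> g)"
  proof
    show "(f \<otimes>\<^bsub>M\<^esub> (c \<odot>\<^bsub>M\<^esub> g)) p = (c \<odot>\<^bsub>M\<^esub> (f \<otimes>\<^bsub>M\<^esub> g)) p" for p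
      unfolding s free_mult_eval[OF f cg(1) fD(2) gD(2) order_refl cg(2)]
      using fD(1) gD(1) c by (intro F.finsum_cong') (auto simp: pt F.m_lcomm)
  qed
qed

lemma free_gen_mult:
  assumes "a \<in> carrier A" "b \<in> carrier B" "a' \<in> carrier A" "b' \<in> carrier B"
  shows "free_gen F a b \<otimes>\<^bsub>M\<^esub> free_gen F a' b' = free_gen F (a \<otimes>\<^bsub>A\<^esub> a') (b \<otimes>\<^bsub>B\<^esub> b')"
proof
  fix p
  have "(free_gen F a b \<otimes>\<^bsub>M\<^esub> free_gen F a' b') p =
      (\<Oplus>\<^bsub>F\<^esub>u\<in>{(a, b)} \<times> {(a', b')}. if pmul (fst u) (snd u) = p
        then free_gen F a b (fst u) \<otimes>\<^bsub>F\<^esub> free_gen F a' b' (snd u) else \<zero>\<^bsub>F\<^esub>)"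
    using assms by (intro free_mult_eval) (simp_all, auto simp: free_gen_def)
  also have "{(a, b)} \<times> {(a', b')} = {((a, b), (a', b'))}" by simp
  also have "(\<Oplus>\<^bsub>F\<^esub>u\<in>{((a, b), (a', b'))}. if pmul (fst u) (snd u) = p
        then free_gen F a b (fst u) \<otimes>\<^bsub>F\<^esub> free_gen F a' b' (snd u) else \<zero>\<^bsub>F\<^esub>)
      = free_gen F (a \<otimes>\<^bsub>A\<^esub> a') (b \<otimes>\<^bsub>B\<^esub> b') p"
    by (subst F.finsum_insert) (auto simp: free_gen_def)
  finally show "(free_gen F a b \<otimes>\<^bsub>M\<^esub> free_gen F a' b') p = free_gen F (a \<otimes>\<^bsub>A\<^esub> a') (b \<otimes>\<^bsub>B\<^esub> b') p" .
qed

lemma free_mult_zero: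
  assumes "f \<in> carrier M"
  shows "\<zero>\<^bsub>M\<^esub> \<otimes>\<^bsub>M\<^esub> f = \<zero>\<^bsub>M\<^esub>" "f \<otimes>\<^bsub>M\<^esub> \<zero>\<^bsub>M\<^esub> = \<zero>\<^bsub>M\<^esub>"
  using free_mult_smult(1)[OF free_zero_closed assms F.zero_closed]
    free_mult_smult(2)[OF assms free_zero_closed F.zero_closed] assms
  by (simp_all add: free_mult_closed)

lemma free_mult_assoc:
  assumes "f \<in> carrier M" "g \<in> carrier M" "h \<in> carrier M"
  shows "f \<otimes>\<^bsub>M\<^esub> g \<otimes>\<^bsub>M\<^esub> h = f \<otimes>\<^bsub>M\<^esub> (g \<otimes>\<^bsub>M\<^esub> h)"
  using assms(1)
proof (induction f rule: free_induct)
  case (gen c a b)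
  show ?case using assms(2)
  proof (induction g rule: free_induct)
    case (gen c' a' b')
    show ?case using assms(3)
    proof (induction h rule: free_induct)
      case (gen c'' a'' b'')
      note g = gen \<open>c \<in> carrier F\<close> \<open>a \<in> carrier A\<close> \<open>b \<in> carrier B\<close> \<open>c' \<in> carrier F\<close> \<open>a' \<in> carrier A\<close> \<open>b' \<in> carrier B\<close>
      then show ?case
        by (simp add: free_mult_smult free_mult_closed free_gen_mult A.m_assoc B.m_assoc)
    qed (use gen \<open>c \<in> carrier F\<close> \<open>a \<in> carrier A\<close> \<open>b \<in> carrier B\<close> in
        \<open>simp_all add: free_mult_zero free_mult_distr free_mult_closed free_zero_closed\<close>)
  qed (use gen assms in \<open>simp_all add: free_mult_zero free_mult_distr free_mult_closed free_zero_closed\<close>)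
qed (use assms in \<open>simp_all add: free_mult_zero free_mult_distr free_mult_closed free_zero_closed\<close>)

lemma assoc_algebra_free: "assoc_algebra F M"
proof (rule assoc_algebraI)
  have one: "\<one>\<^bsub>M\<^esub> \<in> carrier M" by (simp add: free_tensor_simps(2))
  have l: "\<one>\<^bsub>M\<^esub> \<otimes>\<^bsub>M\<^esub> f = f" if "f \<in> carrier M" for f
    using that
    by (induction f rule: free_induct)
      (use one in \<open>simp_all add: free_mult_zero free_mult_distr free_mult_smult, simp add: free_tensor_simps(2) free_gen_mult\<close>)
  have r: "f \<otimes>\<^bsub>M\<^esub> \<one>\<^bsub>M\<^esub> = f" if "f \<in> carrier M" for f
    using that
    by (induction f rule: free_induct)
      (use one in \<open>simp_all add: free_mult_zero free_mult_distr free_mult_smult, simp add: free_tensor_simps(2) free_gen_mult\<close>)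
  show "ring M"
    by (intro ringI monoidI M.abelian_group_axioms)
      (simp_all add: one l r free_mult_closed free_mult_assoc free_mult_distr)
qed (simp_all add: F.field_axioms free_module free_mult_smult)

definition lin_ext :: "('f, 'v, 'k) module_scheme \<Rightarrow> ('a \<Rightarrow> 'b \<Rightarrow> 'v) \<Rightarrow> ('a \<times> 'b \<Rightarrow> 'f) \<Rightarrow> 'v" where
  "lin_ext V \<beta> f = (\<Oplus>\<^bsub>V\<^esub>p\<in>{p. f p \<noteq> \<zero>\<^bsub>F\<^esub>}. f p \<odot>\<^bsub>V\<^esub> \<beta> (fst p) (snd p))"

text \<open>
  Pairs form a basis, so a map defined on them has a linear extension.
\<close>

lemma lin_ext:
  assumes "module F V" and \<beta>: "\<And>a b. \<lbrakk>a \<in> carrier A; b \<in> carrier B\<rbrakk> \<Longrightarrow> \<beta> a b \<in> carrier V"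
  shows "lin_ext V \<beta> \<in> linear_maps F M V"
    and "\<And>a b. \<lbrakk>a \<in> carrier A; b \<in> carrier B\<rbrakk> \<Longrightarrow> lin_ext V \<beta> (free_gen F a b) = \<beta> a b"
proof -
  interpret V: module F V by fact
  have eval: "lin_ext V \<beta> f = (\<Oplus>\<^bsub>V\<^esub>p\<in>S. f p \<odot>\<^bsub>V\<^esub> \<beta> (fst p) (snd p))"
    if "f \<in> carrier M" "finite S" "{p. f p \<noteq> \<zero>\<^bsub>F\<^esub>} \<subseteq> S" "S \<subseteq> carrier A \<times> carrier B" for f S
    unfolding lin_ext_def
  proof (rule V.M.add.finprod_mono_neutral_cong_left[OF that(2,3)])
    have m: "\<beta> (fst i) (snd i) \<in> carrier V" if "i \<in> S" for i
      using \<beta> \<open>S \<subseteq> _\<close> that by auto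
    then show "f i \<odot>\<^bsub>V\<^esub> \<beta> (fst i) (snd i) = \<zero>\<^bsub>V\<^esub>" if "i \<in> S - {p. f p \<noteq> \<zero>\<^bsub>F\<^esub>}" for i
      using that by simp
    show "(\<lambda>p. f p \<odot>\<^bsub>V\<^esub> \<beta> (fst p) (snd p)) \<in> S \<rightarrow> carrier V"
      using m free_carrierD(1)[OF that(1)] by simp
  qed simp
  show "lin_ext V \<beta> \<in> linear_maps F M V"
  proof (rule linear_mapsI)
    fix f assume f: "f \<in> carrier M"
    note fD = free_carrierD[OF f]
    have b: "\<beta> (fst p) (snd p) \<in> carrier V" if "f p \<noteq> \<zero>\<^bsub>F\<^esub>" for p
    proof -
      have "p \<in> carrier A \<times> carrier B" using fD(3) that by blast
      then show ?thesis using \<beta> by auto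
    qed
    then have m: "f p \<odot>\<^bsub>V\<^esub> \<beta> (fst p) (snd p) \<in> carrier V" if "f p \<noteq> \<zero>\<^bsub>F\<^esub>" for p
      using fD(1) that by blast
    then show "lin_ext V \<beta> f \<in> carrier V" unfolding lin_ext_def by (intro V.M.finsum_closed) auto
    fix c assume c: "c \<in> carrier F"
    have "lin_ext V \<beta> (c \<odot>\<^bsub>M\<^esub> f) = (\<Oplus>\<^bsub>V\<^esub>p\<in>{p. f p \<noteq> \<zero>\<^bsub>F\<^esub>}. c \<odot>\<^bsub>V\<^esub> (f p \<odot>\<^bsub>V\<^esub> \<beta> (fst p) (snd p)))"
    proof (subst eval[OF free_smult_closed[OF c f] fD(2) _ fD(3)])
      show "{p. (c \<odot>\<^bsub>M\<^esub> f) p \<noteq> \<zero>\<^bsub>F\<^esub>} \<subseteq> {p. f p \<noteq> \<zero>\<^bsub>F\<^esub>}" using c by (auto simp: free_tensor_simps)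
      have "(c \<odot>\<^bsub>M\<^esub> f) p \<odot>\<^bsub>V\<^esub> \<beta> (fst p) (snd p) = c \<odot>\<^bsub>V\<^esub> (f p \<odot>\<^bsub>V\<^esub> \<beta> (fst p) (snd p))"
        if "f p \<noteq> \<zero>\<^bsub>F\<^esub>" for p
        using b[OF that] fD(1) c by (simp add: free_tensor_simps(5) V.smult_assoc1)
      then show "(\<Oplus>\<^bsub>V\<^esub>p\<in>{p. f p \<noteq> \<zero>\<^bsub>F\<^esub>}. (c \<odot>\<^bsub>M\<^esub> f) p \<odot>\<^bsub>V\<^esub> \<beta> (fst p) (snd p)) =
         (\<Oplus>\<^bsub>V\<^esub>p\<in>{p. f p \<noteq> \<zero>\<^bsub>F\<^esub>}. c \<odot>\<^bsub>V\<^esub> (f p \<odot>\<^bsub>V\<^esub> \<beta> (fst p) (snd p)))"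
        using m c by (intro V.M.finsum_cong') auto
    qed
    also have "\<dots> = c \<odot>\<^bsub>V\<^esub> lin_ext V \<beta> f"
      unfolding lin_ext_def using fD(2) c m by (subst V.finsum_smult_ldistr) auto
    finally show "lin_ext V \<beta> (c \<odot>\<^bsub>M\<^esub> f) = c \<odot>\<^bsub>V\<^esub> lin_ext V \<beta> f" .
  next
    fix f g assume f: "f \<in> carrier M" and g: "g \<in> carrier M"
    note fD = free_carrierD[OF f] and gD = free_carrierD[OF g]
    let ?S = "{p. f p \<noteq> \<zero>\<^bsub>F\<^esub>} \<union> {p. g p \<noteq> \<zero>\<^bsub>F\<^esub>}"
    have S: "finite ?S" "?S \<subseteq> carrier A \<times> carrier B" using fD gD by auto
    have sub: "{p. (f \<oplus>\<^bsub>M\<^esub> g) p \<noteq> \<zero>\<^bsub>F\<^esub>} \<subseteq> ?S" using fD(1) gD(1) by (auto simp: free_tensor_simps)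
    have b: "\<beta> (fst p) (snd p) \<in> carrier V" if "p \<in> ?S" for p
    proof -
      have "p \<in> carrier A \<times> carrier B" using S(2) that by (rule subsetD)
      then show ?thesis using \<beta> by auto
    qed
    have "lin_ext V \<beta> (f \<oplus>\<^bsub>M\<^esub> g) = (\<Oplus>\<^bsub>V\<^esub>p\<in>?S. f p \<odot>\<^bsub>V\<^esub> \<beta> (fst p) (snd p) \<oplus>\<^bsub>V\<^esub> g p \<odot>\<^bsub>V\<^esub> \<beta> (fst p) (snd p))"
    proof (subst eval[OF free_add_closed[OF f g] S(1) sub S(2)], rule V.M.finsum_cong'[OF refl])
      show "(\<lambda>p. f p \<odot>\<^bsub>V\<^esub> \<beta> (fst p) (snd p) \<oplus>\<^bsub>V\<^esub> g p \<odot>\<^bsub>V\<^esub> \<beta> (fst p) (snd p)) \<in> ?S \<rightarrow> carrier V"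
        using b fD(1) gD(1) by (intro Pi_I) simp
      show "(f \<oplus>\<^bsub>M\<^esub> g) p \<odot>\<^bsub>V\<^esub> \<beta> (fst p) (snd p) = f p \<odot>\<^bsub>V\<^esub> \<beta> (fst p) (snd p) \<oplus>\<^bsub>V\<^esub> g p \<odot>\<^bsub>V\<^esub> \<beta> (fst p) (snd p)"
        if "p \<in> ?S" for p
        using b[OF that] fD(1) gD(1) by (simp add: free_tensor_simps(4) V.smult_l_distr)
    qed
    also have "\<dots> = (\<Oplus>\<^bsub>V\<^esub>p\<in>?S. f p \<odot>\<^bsub>V\<^esub> \<beta> (fst p) (snd p)) \<oplus>\<^bsub>V\<^esub> (\<Oplus>\<^bsub>V\<^esub>p\<in>?S. g p \<odot>\<^bsub>V\<^esub> \<beta> (fst p) (snd p))"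
      using b fD(1) gD(1) by (intro V.M.finsum_addf Pi_I) simp_all
    also have "\<dots> = lin_ext V \<beta> f \<oplus>\<^bsub>V\<^esub> lin_ext V \<beta> g"
      using eval[OF f S(1) Un_upper1 S(2)] eval[OF g S(1) Un_upper2 S(2)] by simp
    finally show "lin_ext V \<beta> (f \<oplus>\<^bsub>M\<^esub> g) = lin_ext V \<beta> f \<oplus>\<^bsub>V\<^esub> lin_ext V \<beta> g" .
  qed
  fix a b assume ab: "a \<in> carrier A" "b \<in> carrier B"
  have "lin_ext V \<beta> (free_gen F a b) = (\<Oplus>\<^bsub>V\<^esub>p\<in>{(a, b)}. free_gen F a b p \<odot>\<^bsub>V\<^esub> \<beta> (fst p) (snd p))"
    using ab by (intro eval) (simp_all, auto simp: free_gen_def)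
  also have "\<dots> = \<beta> a b" using ab \<beta> by (subst V.M.finsum_insert) (auto simp: free_gen_def)
  finally show "lin_ext V \<beta> (free_gen F a b) = \<beta> a b" .
qed

end

section \<open>The tensor product and its universal property\<close>

lemma subspace_span:
  assumes "module F V" "X \<subseteq> carrier V"
  shows "submodule (subspace_span F V X) F V" "X \<subseteq> subspace_span F V X"
    and "\<And>H. \<lbrakk>submodule H F V; X \<subseteq> H\<rbrakk> \<Longrightarrow> subspace_span F V X \<subseteq> H"
proof -
  interpret V: module F V by fact
  have z: "\<zero>\<^bsub>V\<^esub> \<in> H" if "submodule H F V" for H
    using subgroup.one_closed[OF submodule.axioms(1)[OF that]] by simp
  show "submodule (subspace_span F V X) F V"
  proof (rule V.submoduleI)
    show "subspace_span F V X \<subseteq> carrier V"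
      unfolding subspace_span_def using V.carrier_is_submodule assms(2) by blast
  qed (auto simp: subspace_span_def z V.submoduleE)
  show "X \<subseteq> subspace_span F V X" unfolding subspace_span_def by blast
  show "subspace_span F V X \<subseteq> H" if "submodule H F V" "X \<subseteq> H" for H
    unfolding subspace_span_def using that by blast
qed

lemma submodule_zero: "submodule H F V \<Longrightarrow> \<zero>\<^bsub>V\<^esub> \<in> H"
  using subgroup.one_closed[OF submodule.axioms(1)] by fastforce

context algebra_pair
begin

abbreviation "K \<equiv> tensor_kernel F A B"

sublocale M: ring M by (rule assoc_algebraD(2)[OF assoc_algebra_free])

lemma relations_carrier: "bilinear_relations F A B \<subseteq> carrier M"
  unfolding bilinear_relations_def Let_def by (auto intro!: M.minus_closed)

lemma kernel_submodule: "submodule K F M"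
  unfolding tensor_kernel_def by (rule subspace_span(1)[OF free_module relations_carrier])

lemma relations_subset_kernel: "bilinear_relations F A B \<subseteq> K"
  unfolding tensor_kernel_def by (rule subspace_span(2)[OF free_module relations_carrier])

lemma kernel_least: "\<lbrakk>submodule H F M; bilinear_relations F A B \<subseteq> H\<rbrakk> \<Longrightarrow> K \<subseteq> H"
  unfolding tensor_kernel_def by (rule subspace_span(3)[OF free_module relations_carrier])

lemma kernel_relations:
  "\<lbrakk>a \<in> carrier A; a' \<in> carrier A; b \<in> carrier B\<rbrakk> \<Longrightarrow>
    free_gen F (a \<oplus>\<^bsub>A\<^esub> a') b \<ominus>\<^bsub>M\<^esub> (free_gen F a b \<oplus>\<^bsub>M\<^esub> free_gen F a' b) \<in> K"
  "\<lbrakk>a \<in> carrier A; b \<in> carrier B; b' \<in> carrier B\<rbrakk> \<Longrightarrow>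
    free_gen F a (b \<oplus>\<^bsub>B\<^esub> b') \<ominus>\<^bsub>M\<^esub> (free_gen F a b \<oplus>\<^bsub>M\<^esub> free_gen F a b') \<in> K"
  "\<lbrakk>c \<in> carrier F; a \<in> carrier A; b \<in> carrier B\<rbrakk> \<Longrightarrow>
    free_gen F (c \<odot>\<^bsub>A\<^esub> a) b \<ominus>\<^bsub>M\<^esub> (c \<odot>\<^bsub>M\<^esub> free_gen F a b) \<in> K"
  "\<lbrakk>c \<in> carrier F; a \<in> carrier A; b \<in> carrier B\<rbrakk> \<Longrightarrow>
    free_gen F a (c \<odot>\<^bsub>B\<^esub> b) \<ominus>\<^bsub>M\<^esub> (c \<odot>\<^bsub>M\<^esub> free_gen F a b) \<in> K"
proof -
  show "free_gen F (a \<oplus>\<^bsub>A\<^esub> a') b \<ominus>\<^bsub>M\<^esub> (free_gen F a b \<oplus>\<^bsub>M\<^esub> free_gen F a' b) \<in> K"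
    if "a \<in> carrier A" "a' \<in> carrier A" "b \<in> carrier B" for a a' b
    by (rule subsetD[OF relations_subset_kernel], unfold bilinear_relations_def Let_def,
        rule UnI1, rule UnI1, rule UnI1, intro CollectI exI conjI, rule refl) (fact that)+
  show "free_gen F a (b \<oplus>\<^bsub>B\<^esub> b') \<ominus>\<^bsub>M\<^esub> (free_gen F a b \<oplus>\<^bsub>M\<^esub> free_gen F a b') \<in> K"
    if "a \<in> carrier A" "b \<in> carrier B" "b' \<in> carrier B" for a b b'
    by (rule subsetD[OF relations_subset_kernel], unfold bilinear_relations_def Let_def,
        rule UnI1, rule UnI1, rule UnI2, intro CollectI exI conjI, rule refl) (fact that)+
  show "free_gen F (c \<odot>\<^bsub>A\<^esub> a) b \<ominus>\<^bsub>M\<^esub> (c \<odot>\<^bsub>M\<^esub> free_gen F a b) \<in> K"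
    if "c \<in> carrier F" "a \<in> carrier A" "b \<in> carrier B" for c a b
    by (rule subsetD[OF relations_subset_kernel], unfold bilinear_relations_def Let_def,
        rule UnI1, rule UnI2, intro CollectI exI conjI, rule refl) (fact that)+
  show "free_gen F a (c \<odot>\<^bsub>B\<^esub> b) \<ominus>\<^bsub>M\<^esub> (c \<odot>\<^bsub>M\<^esub> free_gen F a b) \<in> K"
    if "c \<in> carrier F" "a \<in> carrier A" "b \<in> carrier B" for c a b
    by (rule subsetD[OF relations_subset_kernel], unfold bilinear_relations_def Let_def,
        rule UnI2, intro CollectI exI conjI, rule refl) (fact that)+
qed

lemma relations_cases:
  assumes "r \<in> bilinear_relations F A B"
    and "\<And>a a' b. \<lbrakk>a \<in> carrier A; a' \<in> carrier A; b \<in> carrier B\<rbrakk> \<Longrightarrow>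
      P (free_gen F (a \<oplus>\<^bsub>A\<^esub> a') b \<ominus>\<^bsub>M\<^esub> (free_gen F a b \<oplus>\<^bsub>M\<^esub> free_gen F a' b))"
    and "\<And>a b b'. \<lbrakk>a \<in> carrier A; b \<in> carrier B; b' \<in> carrier B\<rbrakk> \<Longrightarrow>
      P (free_gen F a (b \<oplus>\<^bsub>B\<^esub> b') \<ominus>\<^bsub>M\<^esub> (free_gen F a b \<oplus>\<^bsub>M\<^esub> free_gen F a b'))"
    and "\<And>c a b. \<lbrakk>c \<in> carrier F; a \<in> carrier A; b \<in> carrier B\<rbrakk> \<Longrightarrow>
      P (free_gen F (c \<odot>\<^bsub>A\<^esub> a) b \<ominus>\<^bsub>M\<^esub> (c \<odot>\<^bsub>M\<^esub> free_gen F a b))"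
    and "\<And>c a b. \<lbrakk>c \<in> carrier F; a \<in> carrier A; b \<in> carrier B\<rbrakk> \<Longrightarrow>
      P (free_gen F a (c \<odot>\<^bsub>B\<^esub> b) \<ominus>\<^bsub>M\<^esub> (c \<odot>\<^bsub>M\<^esub> free_gen F a b))"
  shows "P r"
  using assms(1) unfolding bilinear_relations_def Let_def
  by (elim UnE CollectE exE conjE) (simp_all add: assms(2-5))

text \<open>
  A generator times a bilinearity relation is a bilinearity relation of the same kind, and the
  elements whose products with a generator stay in the kernel form a subspace.
\<close>

lemma kernel_gen_mult:
  assumes "f \<in> K" "x \<in> carrier A" "y \<in> carrier B"
  shows "free_gen F x y \<otimes>\<^bsub>M\<^esub> f \<in> K" "f \<otimes>\<^bsub>M\<^esub> free_gen F x y \<in> K"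
proof -
  let ?H = "{f \<in> carrier M. free_gen F x y \<otimes>\<^bsub>M\<^esub> f \<in> K \<and> f \<otimes>\<^bsub>M\<^esub> free_gen F x y \<in> K}"
  note KE = M.submoduleE[OF kernel_submodule]
  note xy = assms(2,3)
  have "submodule ?H F M"
  proof (rule M.submoduleI)
    have z: "free_gen F x y \<otimes>\<^bsub>M\<^esub> \<zero>\<^bsub>M\<^esub> = \<zero>\<^bsub>M\<^esub>" "\<zero>\<^bsub>M\<^esub> \<otimes>\<^bsub>M\<^esub> free_gen F x y = \<zero>\<^bsub>M\<^esub>"
      using free_mult_zero xy by simp_all
    show "?H \<subseteq> carrier M" by blast
    show "\<zero>\<^bsub>M\<^esub> \<in> ?H" using z submodule_zero[OF kernel_submodule] by simp
    show "\<ominus>\<^bsub>M\<^esub> f \<in> ?H" if "f \<in> ?H" for f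
      using that xy KE(3) by (simp add: M.r_minus M.l_minus)
    show "f \<oplus>\<^bsub>M\<^esub> g \<in> ?H" if "f \<in> ?H" "g \<in> ?H" for f g
      using that xy KE(5) by (simp add: M.r_distr M.l_distr)
    show "c \<odot>\<^bsub>M\<^esub> f \<in> ?H" if "c \<in> carrier F" "f \<in> ?H" for c f
      using that xy KE(4) by (simp add: free_mult_smult)
  qed
  moreover have "bilinear_relations F A B \<subseteq> ?H"
  proof
    fix r assume r: "r \<in> bilinear_relations F A B"
    have dl: "z \<otimes>\<^bsub>M\<^esub> (u \<ominus>\<^bsub>M\<^esub> v) = z \<otimes>\<^bsub>M\<^esub> u \<ominus>\<^bsub>M\<^esub> z \<otimes>\<^bsub>M\<^esub> v"
      if "z \<in> carrier M" "u \<in> carrier M" "v \<in> carrier M" for z u v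
      using that by (simp add: M.minus_eq M.r_distr M.r_minus)
    have dr: "(u \<ominus>\<^bsub>M\<^esub> v) \<otimes>\<^bsub>M\<^esub> z = u \<otimes>\<^bsub>M\<^esub> z \<ominus>\<^bsub>M\<^esub> v \<otimes>\<^bsub>M\<^esub> z"
      if "z \<in> carrier M" "u \<in> carrier M" "v \<in> carrier M" for z u v
      using that by (simp add: M.minus_eq M.l_distr M.l_minus)
    have "free_gen F x y \<otimes>\<^bsub>M\<^esub> r \<in> K \<and> r \<otimes>\<^bsub>M\<^esub> free_gen F x y \<in> K"
      using r
    proof (rule relations_cases)
      fix a a' b assume "a \<in> carrier A" "a' \<in> carrier A" "b \<in> carrier B"
      then show "free_gen F x y \<otimes>\<^bsub>M\<^esub> (free_gen F (a \<oplus>\<^bsub>A\<^esub> a') b \<ominus>\<^bsub>M\<^esub> (free_gen F a b \<oplus>\<^bsub>M\<^esub> free_gen F a' b)) \<in> K \<and>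
        (free_gen F (a \<oplus>\<^bsub>A\<^esub> a') b \<ominus>\<^bsub>M\<^esub> (free_gen F a b \<oplus>\<^bsub>M\<^esub> free_gen F a' b)) \<otimes>\<^bsub>M\<^esub> free_gen F x y \<in> K"
        using xy by (simp add: dl dr M.l_distr M.r_distr free_gen_mult A.l_distr A.r_distr kernel_relations(1))
    next
      fix a b b' assume "a \<in> carrier A" "b \<in> carrier B" "b' \<in> carrier B"
      then show "free_gen F x y \<otimes>\<^bsub>M\<^esub> (free_gen F a (b \<oplus>\<^bsub>B\<^esub> b') \<ominus>\<^bsub>M\<^esub> (free_gen F a b \<oplus>\<^bsub>M\<^esub> free_gen F a b')) \<in> K \<and>
        (free_gen F a (b \<oplus>\<^bsub>B\<^esub> b') \<ominus>\<^bsub>M\<^esub> (free_gen F a b \<oplus>\<^bsub>M\<^esub> free_gen F a b')) \<otimes>\<^bsub>M\<^esub> free_gen F x y \<in> K"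
        using xy by (simp add: dl dr M.l_distr M.r_distr free_gen_mult B.l_distr B.r_distr kernel_relations(2))
    next
      fix c a b assume "c \<in> carrier F" "a \<in> carrier A" "b \<in> carrier B"
      then show "free_gen F x y \<otimes>\<^bsub>M\<^esub> (free_gen F (c \<odot>\<^bsub>A\<^esub> a) b \<ominus>\<^bsub>M\<^esub> c \<odot>\<^bsub>M\<^esub> free_gen F a b) \<in> K \<and>
        (free_gen F (c \<odot>\<^bsub>A\<^esub> a) b \<ominus>\<^bsub>M\<^esub> c \<odot>\<^bsub>M\<^esub> free_gen F a b) \<otimes>\<^bsub>M\<^esub> free_gen F x y \<in> K"
        using xy by (simp add: dl dr free_mult_smult free_gen_mult assoc_algebraD(5,6)[OF A_alg] kernel_relations(3))
    next
      fix c a b assume "c \<in> carrier F" "a \<in> carrier A" "b \<in> carrier B"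
      then show "free_gen F x y \<otimes>\<^bsub>M\<^esub> (free_gen F a (c \<odot>\<^bsub>B\<^esub> b) \<ominus>\<^bsub>M\<^esub> c \<odot>\<^bsub>M\<^esub> free_gen F a b) \<in> K \<and>
        (free_gen F a (c \<odot>\<^bsub>B\<^esub> b) \<ominus>\<^bsub>M\<^esub> c \<odot>\<^bsub>M\<^esub> free_gen F a b) \<otimes>\<^bsub>M\<^esub> free_gen F x y \<in> K"
        using xy by (simp add: dl dr free_mult_smult free_gen_mult assoc_algebraD(5,6)[OF B_alg] kernel_relations(4))
    qed
    then show "r \<in> ?H" using r relations_carrier by auto
  qed
  ultimately have "K \<subseteq> ?H" by (rule kernel_least)
  then show "free_gen F x y \<otimes>\<^bsub>M\<^esub> f \<in> K" "f \<otimes>\<^bsub>M\<^esub> free_gen F x y \<in> K" using assms(1) by blast+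
qed

lemma kernel_ideal: "ideal K M"
proof (rule idealI[OF M.ring_axioms])
  note KE = M.submoduleE[OF kernel_submodule]
  show "subgroup K (add_monoid M)" by (rule submodule.axioms(1)[OF kernel_submodule])
  fix f g assume f: "f \<in> K" and g: "g \<in> carrier M"
  have fc: "f \<in> carrier M" using f KE(1) by blast
  show "g \<otimes>\<^bsub>M\<^esub> f \<in> K" using g
  proof (induction g rule: free_induct)
    case zero then show ?case using fc submodule_zero[OF kernel_submodule] by (simp add: free_mult_zero)
  next
    case (gen c a b)
    then show ?case using KE(4)[OF _ kernel_gen_mult(1)[OF f]] fc by (simp add: free_mult_smult)
  next
    case (add g h) then show ?case using KE(5) fc by (simp add: M.l_distr)
  qed
  show "f \<otimes>\<^bsub>M\<^esub> g \<in> K" using g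
  proof (induction g rule: free_induct)
    case zero then show ?case using fc submodule_zero[OF kernel_submodule] by (simp add: free_mult_zero)
  next
    case (gen c a b)
    then show ?case using KE(4)[OF _ kernel_gen_mult(2)[OF f]] fc by (simp add: free_mult_smult)
  next
    case (add g h) then show ?case using KE(5) fc by (simp add: M.r_distr)
  qed
qed

abbreviation "T \<equiv> tensor_algebra F A B"
abbreviation pure (infixl "\<otimes>\<^sub>t" 75) where "a \<otimes>\<^sub>t b \<equiv> pure_tensor F A B a b"

lemma assoc_algebra_tensor: "assoc_algebra F T"
  unfolding tensor_algebra_def by (rule assoc_algebra_quotient[OF assoc_algebra_free kernel_ideal])

sublocale T: ring T by (rule assoc_algebraD(2)[OF assoc_algebra_tensor])
sublocale TM: module F T by (rule assoc_algebraD(3)[OF assoc_algebra_tensor])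

lemma coset_eqI:
  assumes "f \<in> carrier M" "g \<in> carrier M" "f \<ominus>\<^bsub>M\<^esub> g \<in> K"
  shows "K +>\<^bsub>M\<^esub> f = K +>\<^bsub>M\<^esub> g"
  using a_rcos_eq_iff[OF kernel_ideal assms(1,2)] assms(3) by blast

lemma pure_closed [simp]: "\<lbrakk>a \<in> carrier A; b \<in> carrier B\<rbrakk> \<Longrightarrow> a \<otimes>\<^sub>t b \<in> carrier T"
  unfolding pure_tensor_def tensor_algebra_def
  by (intro quotient_algebra_ops(1)[OF assoc_algebra_free kernel_ideal]) simp

lemma pure_add_left:
  assumes "a \<in> carrier A" "a' \<in> carrier A" "b \<in> carrier B"
  shows "(a \<oplus>\<^bsub>A\<^esub> a') \<otimes>\<^sub>t b = a \<otimes>\<^sub>t b \<oplus>\<^bsub>T\<^esub> a' \<otimes>\<^sub>t b"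
  unfolding pure_tensor_def tensor_algebra_def using assms
  by (subst quotient_algebra_ops(3)[OF assoc_algebra_free kernel_ideal])
    (simp_all, rule coset_eqI, simp_all add: kernel_relations)

lemma pure_add_right:
  assumes "a \<in> carrier A" "b \<in> carrier B" "b' \<in> carrier B"
  shows "a \<otimes>\<^sub>t (b \<oplus>\<^bsub>B\<^esub> b') = a \<otimes>\<^sub>t b \<oplus>\<^bsub>T\<^esub> a \<otimes>\<^sub>t b'"
  unfolding pure_tensor_def tensor_algebra_def using assms
  by (subst quotient_algebra_ops(3)[OF assoc_algebra_free kernel_ideal])
    (simp_all, rule coset_eqI, simp_all add: kernel_relations)

lemma pure_smult_left:
  assumes "c \<in> carrier F" "a \<in> carrier A" "b \<in> carrier B"
  shows "(c \<odot>\<^bsub>A\<^esub> a) \<otimes>\<^sub>t b = c \<odot>\<^bsub>T\<^esub> (a \<otimes>\<^sub>t b)"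
  unfolding pure_tensor_def tensor_algebra_def using assms
  by (subst quotient_algebra_ops(4)[OF assoc_algebra_free kernel_ideal])
    (simp_all, rule coset_eqI, simp_all add: kernel_relations)

lemma pure_smult_right:
  assumes "c \<in> carrier F" "a \<in> carrier A" "b \<in> carrier B"
  shows "a \<otimes>\<^sub>t (c \<odot>\<^bsub>B\<^esub> b) = c \<odot>\<^bsub>T\<^esub> (a \<otimes>\<^sub>t b)"
  unfolding pure_tensor_def tensor_algebra_def using assms
  by (subst quotient_algebra_ops(4)[OF assoc_algebra_free kernel_ideal])
    (simp_all, rule coset_eqI, simp_all add: kernel_relations)

lemma pure_mult:
  assumes "a \<in> carrier A" "b \<in> carrier B" "a' \<in> carrier A" "b' \<in> carrier B"
  shows "(a \<otimes>\<^sub>t b) \<otimes>\<^bsub>T\<^esub> (a' \<otimes>\<^sub>t b') = (a \<otimes>\<^bsub>A\<^esub> a') \<otimes>\<^sub>t (b \<otimes>\<^bsub>B\<^esub> b')"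
  unfolding pure_tensor_def tensor_algebra_def using assms
  by (subst quotient_algebra_ops(2)[OF assoc_algebra_free kernel_ideal])
    (simp_all add: free_gen_mult)

lemma tensor_one: "\<one>\<^bsub>T\<^esub> = \<one>\<^bsub>A\<^esub> \<otimes>\<^sub>t \<one>\<^bsub>B\<^esub>"
  unfolding pure_tensor_def tensor_algebra_def quotient_algebra_simps by (simp add: free_tensor_simps(2))

lemma pure_zero [simp]:
  "b \<in> carrier B \<Longrightarrow> \<zero>\<^bsub>A\<^esub> \<otimes>\<^sub>t b = \<zero>\<^bsub>T\<^esub>" "a \<in> carrier A \<Longrightarrow> a \<otimes>\<^sub>t \<zero>\<^bsub>B\<^esub> = \<zero>\<^bsub>T\<^esub>"
  using pure_smult_left[of "\<zero>\<^bsub>F\<^esub>" "\<zero>\<^bsub>A\<^esub>" b] pure_smult_right[of "\<zero>\<^bsub>F\<^esub>" a "\<zero>\<^bsub>B\<^esub>"] by simp_all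

text \<open>
  Neither zero nor scalar multiples need a case of their own: \<open>0 = 0 \<otimes> 0\<close>, and a scalar can be
  moved into a factor.
\<close>

lemma tensor_induct [consumes 1, case_names pure add]:
  assumes "x \<in> carrier T"
    and pure: "\<And>a b. \<lbrakk>a \<in> carrier A; b \<in> carrier B\<rbrakk> \<Longrightarrow> P (a \<otimes>\<^sub>t b)"
    and add: "\<And>x y. \<lbrakk>x \<in> carrier T; y \<in> carrier T; P x; P y\<rbrakk> \<Longrightarrow> P (x \<oplus>\<^bsub>T\<^esub> y)"
  shows "P x"
proof -
  have coset: "K +>\<^bsub>M\<^esub> f \<in> carrier T" if "f \<in> carrier M" for f
    unfolding tensor_algebra_def by (rule quotient_algebra_ops(1)[OF assoc_algebra_free kernel_ideal that])
  have "P (K +>\<^bsub>M\<^esub> f)" if "f \<in> carrier M" for f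
    using that
  proof (induction f rule: free_induct)
    case zero
    have "K +>\<^bsub>M\<^esub> \<zero>\<^bsub>M\<^esub> = \<zero>\<^bsub>T\<^esub>"
      unfolding tensor_algebra_def quotient_algebra_simps
      using M.submoduleE(1)[OF kernel_submodule] by simp
    also have "\<dots> = \<zero>\<^bsub>A\<^esub> \<otimes>\<^sub>t \<zero>\<^bsub>B\<^esub>" by simp
    finally show ?case using pure[of "\<zero>\<^bsub>A\<^esub>" "\<zero>\<^bsub>B\<^esub>"] by simp
  next
    case (gen c a b)
    have "K +>\<^bsub>M\<^esub> (c \<odot>\<^bsub>M\<^esub> free_gen F a b) = c \<odot>\<^bsub>T\<^esub> (a \<otimes>\<^sub>t b)"
      unfolding pure_tensor_def tensor_algebra_def using gen
      by (subst quotient_algebra_ops(4)[OF assoc_algebra_free kernel_ideal]) auto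
    also have "\<dots> = (c \<odot>\<^bsub>A\<^esub> a) \<otimes>\<^sub>t b" using pure_smult_left gen by simp
    finally show ?case using pure[of "c \<odot>\<^bsub>A\<^esub> a" b] gen by simp
  next
    case (add f g)
    have "K +>\<^bsub>M\<^esub> (f \<oplus>\<^bsub>M\<^esub> g) = (K +>\<^bsub>M\<^esub> f) \<oplus>\<^bsub>T\<^esub> (K +>\<^bsub>M\<^esub> g)"
      using quotient_algebra_ops(3)[OF assoc_algebra_free kernel_ideal, of f g] add(1,2)
      by (simp add: tensor_algebra_def)
    then show ?case
      using assms(3)[OF coset coset] add by simp
  qed
  moreover obtain f where "f \<in> carrier M" "x = K +>\<^bsub>M\<^esub> f"
    using assms(1) unfolding tensor_algebra_def by (elim quotient_algebra_elem)
  ultimately show ?thesis by simp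
qed

text \<open>
  The linear extension of \<open>\<beta>\<close> to formal combinations vanishes on the bilinearity relations, hence
  on their span, and is therefore constant on cosets.
\<close>

theorem tensor_universal:
  assumes "module F V"
    and closed: "\<And>a b. \<lbrakk>a \<in> carrier A; b \<in> carrier B\<rbrakk> \<Longrightarrow> \<beta> a b \<in> carrier V"
    and "\<And>a a' b. \<lbrakk>a \<in> carrier A; a' \<in> carrier A; b \<in> carrier B\<rbrakk> \<Longrightarrow> \<beta> (a \<oplus>\<^bsub>A\<^esub> a') b = \<beta> a b \<oplus>\<^bsub>V\<^esub> \<beta> a' b"
    and "\<And>a b b'. \<lbrakk>a \<in> carrier A; b \<in> carrier B; b' \<in> carrier B\<rbrakk> \<Longrightarrow> \<beta> a (b \<oplus>\<^bsub>B\<^esub> b') = \<beta> a b \<oplus>\<^bsub>V\<^esub> \<beta> a b'"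
    and "\<And>c a b. \<lbrakk>c \<in> carrier F; a \<in> carrier A; b \<in> carrier B\<rbrakk> \<Longrightarrow> \<beta> (c \<odot>\<^bsub>A\<^esub> a) b = c \<odot>\<^bsub>V\<^esub> \<beta> a b"
    and "\<And>c a b. \<lbrakk>c \<in> carrier F; a \<in> carrier A; b \<in> carrier B\<rbrakk> \<Longrightarrow> \<beta> a (c \<odot>\<^bsub>B\<^esub> b) = c \<odot>\<^bsub>V\<^esub> \<beta> a b"
  shows "\<exists>\<theta>\<in>linear_maps F T V. \<forall>a\<in>carrier A. \<forall>b\<in>carrier B. \<theta> (a \<otimes>\<^sub>t b) = \<beta> a b"
proof -
  interpret V: module F V by fact
  let ?L = "lin_ext V \<beta>"
  have L: "?L \<in> linear_maps F M V" by (rule lin_ext(1)[OF assms(1) closed])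
  have Lgen: "?L (free_gen F a b) = \<beta> a b" if "a \<in> carrier A" "b \<in> carrier B" for a b
    by (rule lin_ext(2)[OF assms(1) closed that])
  note LD = linear_mapsD[OF L]
    and La = linear_maps_additive[OF L M.abelian_group_axioms V.abelian_group_axioms]
  have "submodule {f \<in> carrier M. ?L f = \<zero>\<^bsub>V\<^esub>} F M"
    by (rule M.submoduleI) (auto simp: La LD)
  moreover have "bilinear_relations F A B \<subseteq> {f \<in> carrier M. ?L f = \<zero>\<^bsub>V\<^esub>}"
  proof
    fix r assume r: "r \<in> bilinear_relations F A B"
    have "?L r = \<zero>\<^bsub>V\<^esub>" using r
      by (rule relations_cases) (simp_all add: La LD Lgen assms V.minus_eq V.r_neg)
    then show "r \<in> {f \<in> carrier M. ?L f = \<zero>\<^bsub>V\<^esub>}" using r relations_carrier by auto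
  qed
  ultimately have ker: "K \<subseteq> {f \<in> carrier M. ?L f = \<zero>\<^bsub>V\<^esub>}" by (rule kernel_least)
  define \<theta> where "\<theta> X = ?L (SOME f. f \<in> carrier M \<and> X = K +>\<^bsub>M\<^esub> f)" for X
  have \<theta>: "\<theta> (K +>\<^bsub>M\<^esub> f) = ?L f" if f: "f \<in> carrier M" for f
  proof -
    define g where "g = (SOME g. g \<in> carrier M \<and> K +>\<^bsub>M\<^esub> f = K +>\<^bsub>M\<^esub> g)"
    have g: "g \<in> carrier M \<and> K +>\<^bsub>M\<^esub> f = K +>\<^bsub>M\<^esub> g" 
      using someI[of "\<lambda>g. g \<in> carrier M \<and> K +>\<^bsub>M\<^esub> f = K +>\<^bsub>M\<^esub> g" f] f unfolding g_def by blast
    then have "f \<ominus>\<^bsub>M\<^esub> g \<in> K" using a_rcos_eq_iff[OF kernel_ideal f] by blast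
    then have "?L f \<ominus>\<^bsub>V\<^esub> ?L g = \<zero>\<^bsub>V\<^esub>" using ker La(3)[OF f, of g] g by auto
    then have "?L f = ?L g" using LD(1) f g V.minus_eq_zero_iff by blast
    then show ?thesis unfolding \<theta>_def g_def by simp
  qed
  note ops = quotient_algebra_ops[OF assoc_algebra_free kernel_ideal]
  have "\<theta> \<in> linear_maps F T V"
    by (rule linear_mapsI)
      (unfold tensor_algebra_def, auto elim!: quotient_algebra_elem simp: ops \<theta> LD)
  moreover have "\<theta> (a \<otimes>\<^sub>t b) = \<beta> a b" if "a \<in> carrier A" "b \<in> carrier B" for a b
    unfolding pure_tensor_def using that by (simp add: \<theta> Lgen)
  ultimately show ?thesis by blast
qed

end

section \<open>Tensor products of linear maps\<close>

lemma submodule_image: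
  assumes "module F V" "module F W" "h \<in> linear_maps F V W" "submodule H F V"
  shows "submodule (h ` H) F W"
proof -
  interpret V: module F V by fact
  interpret W: module F W by fact
  note hD = linear_mapsD[OF assms(3)]
    and ha = linear_maps_additive[OF assms(3) V.abelian_group_axioms W.abelian_group_axioms]
    and HE = V.submoduleE[OF assms(4)]
  have Hc: "x \<in> carrier V" if "x \<in> H" for x using HE(1) that by blast
  show ?thesis
  proof (rule W.submoduleI)
    show "h ` H \<subseteq> carrier W" using hD(1) Hc by blast
    show "\<zero>\<^bsub>W\<^esub> \<in> h ` H" using submodule_zero[OF assms(4)] ha(1) by force
    show "\<ominus>\<^bsub>W\<^esub> y \<in> h ` H" if "y \<in> h ` H" for y
    proof -
      obtain x where x: "x \<in> H" "y = h x" using \<open>y \<in> h ` H\<close> by blast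
      then have "\<ominus>\<^bsub>W\<^esub> y = h (\<ominus>\<^bsub>V\<^esub> x)" using ha(2) Hc by simp
      then show ?thesis using HE(3) x(1) by blast
    qed
    show "y \<oplus>\<^bsub>W\<^esub> z \<in> h ` H" if yz: "y \<in> h ` H" "z \<in> h ` H" for y z
    proof -
      obtain u v where x: "u \<in> H" "y = h u" "v \<in> H" "z = h v" using yz by blast
      then have "y \<oplus>\<^bsub>W\<^esub> z = h (u \<oplus>\<^bsub>V\<^esub> v)" using hD(2) Hc by simp
      then show ?thesis using HE(5) x(1,3) by blast
    qed
    show "c \<odot>\<^bsub>W\<^esub> y \<in> h ` H" if cy: "c \<in> carrier F" "y \<in> h ` H" for c y
    proof -
      obtain x where x: "x \<in> H" "y = h x" using cy by blast
      then have "c \<odot>\<^bsub>W\<^esub> y = h (c \<odot>\<^bsub>V\<^esub> x)" using hD(3) Hc cy by simp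
      then show ?thesis using HE(4) x(1) cy by blast
    qed
  qed
qed

lemma submodule_vimage:
  assumes "module F V" "module F W" "h \<in> linear_maps F V W" "submodule H F W"
  shows "submodule {x \<in> carrier V. h x \<in> H} F V"
proof -
  interpret V: module F V by fact
  interpret W: module F W by fact
  note hD = linear_mapsD[OF assms(3)]
    and ha = linear_maps_additive[OF assms(3) V.abelian_group_axioms W.abelian_group_axioms]
    and HE = W.submoduleE[OF assms(4)]
  show ?thesis
    by (rule V.submoduleI) (use HE(3-5) in \<open>simp_all add: hD ha submodule_zero[OF assms(4)], blast?\<close>)
qed

text \<open>
  Project onto the range of \<open>h\<close>, then invert \<open>h\<close> there.
\<close>

lemma exists_left_inverse:
  assumes "field F" "module F V" "module F W" "h \<in> linear_maps F V W" "inj_on h (carrier V)"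
  shows "\<exists>g\<in>linear_maps F W V. \<forall>x\<in>carrier V. g (h x) = x"
proof -
  interpret V: module F V by fact
  interpret W: module F W by fact
  note hD = linear_mapsD[OF assms(4)]
  have S: "submodule (h ` carrier V) F W"
    by (rule submodule_image[OF assms(2-4) V.carrier_is_submodule])
  obtain \<pi> where \<pi>: "\<pi> \<in> linear_maps F W W" "\<forall>y\<in>carrier W. \<pi> y \<in> h ` carrier V"
      "\<forall>w\<in>h ` carrier V. \<pi> w = w"
    using exists_projection[OF assms(1,3) S] by blast
  define g where "g y = inv_into (carrier V) h (\<pi> y)" for y
  have g: "g y \<in> carrier V" "h (g y) = \<pi> y" if "y \<in> carrier W" for y
    unfolding g_def using \<pi>(2) that by (auto intro: inv_into_into f_inv_into_f)
  have uniq: "x = g y" if "x \<in> carrier V" "y \<in> carrier W" "h x = \<pi> y" for x y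
    using inj_onD[OF assms(5)] g that by metis
  have "g \<in> linear_maps F W V"
  proof (rule linear_mapsI)
    show "g (x \<oplus>\<^bsub>W\<^esub> y) = g x \<oplus>\<^bsub>V\<^esub> g y" if "x \<in> carrier W" "y \<in> carrier W" for x y
      by (rule uniq[symmetric]) (use that g linear_mapsD[OF \<pi>(1)] hD in simp_all)
    show "g (c \<odot>\<^bsub>W\<^esub> x) = c \<odot>\<^bsub>V\<^esub> g x" if "c \<in> carrier F" "x \<in> carrier W" for c x
      by (rule uniq[symmetric]) (use that g linear_mapsD[OF \<pi>(1)] hD in simp_all)
  qed (rule g)
  moreover have "g (h x) = x" if "x \<in> carrier V" for x
    by (rule uniq[symmetric]) (use that \<pi>(3) hD in simp_all)
  ultimately show ?thesis by blast
qed

text \<open>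
  Removing from a preimage its projection to the kernel of \<open>h\<close> makes the preimage canonical, so it
  depends linearly on the value.
\<close>

lemma exists_section:
  assumes "field F" "module F V" "module F W" "h \<in> linear_maps F V W" "h ` carrier V = carrier W"
  shows "\<exists>s\<in>linear_maps F W V. \<forall>y\<in>carrier W. h (s y) = y"
proof -
  interpret V: module F V by fact
  interpret W: module F W by fact
  note hD = linear_mapsD[OF assms(4)]
    and ha = linear_maps_additive[OF assms(4) V.abelian_group_axioms W.abelian_group_axioms]
  let ?N = "{x \<in> carrier V. h x \<in> {\<zero>\<^bsub>W\<^esub>}}"
  have "submodule {\<zero>\<^bsub>W\<^esub>} F W" by (rule W.submoduleI) auto
  then have S: "submodule ?N F V" by (rule submodule_vimage[OF assms(2-4)])
  obtain \<pi> where \<pi>: "\<pi> \<in> linear_maps F V V" "\<forall>y\<in>carrier V. \<pi> y \<in> ?N" "\<forall>w\<in>?N. \<pi> w = w"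
    using exists_projection[OF assms(1,2) S] by blast
  note \<pi>D = linear_mapsD[OF \<pi>(1)]
    and \<pi>a = linear_maps_additive[OF \<pi>(1) V.abelian_group_axioms V.abelian_group_axioms]
  define r where "r y = inv_into (carrier V) h y" for y
  have r: "r y \<in> carrier V" "h (r y) = y" if "y \<in> carrier W" for y
    unfolding r_def using assms(5) that by (metis inv_into_into, metis f_inv_into_f)
  define s where "s y = r y \<ominus>\<^bsub>V\<^esub> \<pi> (r y)" for y
  \<comment> \<open>The value of the section does not depend on the chosen preimage.\<close>
  have s: "s (h x) = x \<ominus>\<^bsub>V\<^esub> \<pi> x" if x: "x \<in> carrier V" for x
  proof -
    let ?z = "r (h x)"
    have z: "?z \<in> carrier V" "h ?z = h x" using r hD(1)[OF x] by auto
    have hc: "h x \<in> carrier W" by (rule hD(1)[OF x])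
    have "h (?z \<ominus>\<^bsub>V\<^esub> x) = \<zero>\<^bsub>W\<^esub>" using ha(3)[OF z(1) x] z(2) hc by (simp add: W.minus_eq W.r_neg)
    then have "?z \<ominus>\<^bsub>V\<^esub> x \<in> ?N" using z x by simp
    then have "\<pi> (?z \<ominus>\<^bsub>V\<^esub> x) = ?z \<ominus>\<^bsub>V\<^esub> x" using \<pi>(3) by blast
    then have e: "\<pi> ?z \<ominus>\<^bsub>V\<^esub> \<pi> x = ?z \<ominus>\<^bsub>V\<^esub> x" using \<pi>a(3)[OF z(1) x] by simp
    have c: "\<pi> ?z \<in> carrier V" "\<pi> x \<in> carrier V" using \<pi>D(1) z x by auto
    have "?z = ?z \<ominus>\<^bsub>V\<^esub> x \<oplus>\<^bsub>V\<^esub> x" using z x by (simp add: V.minus_eq V.add.m_assoc V.l_neg)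
    also have "\<dots> = \<pi> ?z \<ominus>\<^bsub>V\<^esub> \<pi> x \<oplus>\<^bsub>V\<^esub> x" by (simp only: e)
    finally have zz: "?z = \<pi> ?z \<oplus>\<^bsub>V\<^esub> (x \<ominus>\<^bsub>V\<^esub> \<pi> x)"
      using c x by (simp add: V.minus_eq V.add.m_ac)
    have "?z \<ominus>\<^bsub>V\<^esub> \<pi> ?z = x \<ominus>\<^bsub>V\<^esub> \<pi> x"
      by (subst (1) zz) (use c x in \<open>simp add: V.minus_eq V.add.m_ac V.r_neg V.r_neg1 V.r_neg2\<close>)
    then show ?thesis unfolding s_def .
  qed
  have sub: "h (x \<ominus>\<^bsub>V\<^esub> \<pi> x) = h x" if x: "x \<in> carrier V" for x
    using \<pi>(2) ha(3)[OF x \<pi>D(1)[OF x]] hD(1)[OF x] x by (simp add: W.minus_eq)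
  have "s \<in> linear_maps F W V"
  proof (rule linear_mapsI)
    show "s y \<in> carrier V" if "y \<in> carrier W" for y unfolding s_def using r that \<pi>D(1) by simp
  next
    fix y z assume yz: "y \<in> carrier W" "z \<in> carrier W"
    have e: "y = h (r y)" "z = h (r z)" using r yz by auto
    have "s (y \<oplus>\<^bsub>W\<^esub> z) = s (h (r y \<oplus>\<^bsub>V\<^esub> r z))" using hD(2) r yz by simp
    also have "\<dots> = s y \<oplus>\<^bsub>V\<^esub> s z"
      using s r yz \<pi>D unfolding s_def[of y] s_def[of z] by (simp add: V.minus_eq V.minus_add V.add.m_ac)
    finally show "s (y \<oplus>\<^bsub>W\<^esub> z) = s y \<oplus>\<^bsub>V\<^esub> s z" .
  next
    fix c y assume cy: "c \<in> carrier F" "y \<in> carrier W"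
    have "s (c \<odot>\<^bsub>W\<^esub> y) = s (h (c \<odot>\<^bsub>V\<^esub> r y))" using hD(3) r cy by simp
    also have "\<dots> = c \<odot>\<^bsub>V\<^esub> s y"
      using s r cy \<pi>D unfolding s_def[of y] by (simp add: V.minus_eq V.smult_r_distr V.smult_r_minus)
    finally show "s (c \<odot>\<^bsub>W\<^esub> y) = c \<odot>\<^bsub>V\<^esub> s y" .
  qed
  moreover have "h (s y) = y" if "y \<in> carrier W" for y
    unfolding s_def using sub r that by simp
  ultimately show ?thesis by blast
qed

text \<open>
  The universal property only asserts existence; the choice is harmless because linear maps on the
  tensor product are determined by their values at pure tensors.
\<close>

definition tensor_map where
  "tensor_map F A B A' B' \<alpha> \<beta> = (SOME \<theta>. \<theta> \<in> linear_maps F (tensor_algebra F A B) (tensor_algebra F A' B') \<and>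
     (\<forall>a\<in>carrier A. \<forall>b\<in>carrier B. \<theta> (pure_tensor F A B a b) = pure_tensor F A' B' (\<alpha> a) (\<beta> b)))"

lemma tensor_map:
  assumes "assoc_algebra F A" "assoc_algebra F B" "assoc_algebra F A'" "assoc_algebra F B'"
    and "\<alpha> \<in> linear_maps F A A'" "\<beta> \<in> linear_maps F B B'"
  shows "tensor_map F A B A' B' \<alpha> \<beta> \<in> linear_maps F (tensor_algebra F A B) (tensor_algebra F A' B')"
    and "\<lbrakk>a \<in> carrier A; b \<in> carrier B\<rbrakk> \<Longrightarrow>
      tensor_map F A B A' B' \<alpha> \<beta> (pure_tensor F A B a b) = pure_tensor F A' B' (\<alpha> a) (\<beta> b)"
proof -
  interpret P: algebra_pair F A B by (rule algebra_pair.intro[OF assms(1,2)])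
  interpret Q: algebra_pair F A' B' by (rule algebra_pair.intro[OF assms(3,4)])
  note \<alpha> = linear_mapsD[OF assms(5)] and \<beta> = linear_mapsD[OF assms(6)]
  have "\<exists>\<theta>\<in>linear_maps F P.T (tensor_algebra F A' B').
     \<forall>a\<in>carrier A. \<forall>b\<in>carrier B. \<theta> (pure_tensor F A B a b) = pure_tensor F A' B' (\<alpha> a) (\<beta> b)"
    by (rule P.tensor_universal[OF Q.TM.module_axioms])
      (simp_all add: \<alpha> \<beta> Q.pure_add_left Q.pure_add_right Q.pure_smult_left Q.pure_smult_right)
  then have ex: "\<exists>\<theta>. \<theta> \<in> linear_maps F P.T (tensor_algebra F A' B') \<and>
     (\<forall>a\<in>carrier A. \<forall>b\<in>carrier B. \<theta> (pure_tensor F A B a b) = pure_tensor F A' B' (\<alpha> a) (\<beta> b))"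
    by blast
  note sp = someI_ex[OF ex, folded tensor_map_def]
  show "tensor_map F A B A' B' \<alpha> \<beta> \<in> linear_maps F P.T (tensor_algebra F A' B')"
    using sp by blast
  show "\<lbrakk>a \<in> carrier A; b \<in> carrier B\<rbrakk> \<Longrightarrow>
      tensor_map F A B A' B' \<alpha> \<beta> (pure_tensor F A B a b) = pure_tensor F A' B' (\<alpha> a) (\<beta> b)"
    using sp by blast
qed

lemma tensor_map_hom:
  assumes "assoc_algebra F A" "assoc_algebra F B" "assoc_algebra F A'" "assoc_algebra F B'"
    and "\<alpha> \<in> algebra_hom F A A'" "\<beta> \<in> algebra_hom F B B'"
  shows "tensor_map F A B A' B' \<alpha> \<beta> \<in> algebra_hom F (tensor_algebra F A B) (tensor_algebra F A' B')"
proof -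
  interpret P: algebra_pair F A B by (rule algebra_pair.intro[OF assms(1,2)])
  interpret Q: algebra_pair F A' B' by (rule algebra_pair.intro[OF assms(3,4)])
  let ?\<theta> = "tensor_map F A B A' B' \<alpha> \<beta>"
  note tm = tensor_map[OF assms(1-4) algebra_hom_linear[OF assms(5)] algebra_hom_linear[OF assms(6)]]
  note L = linear_mapsD[OF tm(1)] and \<alpha> = algebra_homD[OF assms(5)] and \<beta> = algebra_homD[OF assms(6)]
  show ?thesis
  proof (rule algebra_homI)
    fix x y assume x: "x \<in> carrier P.T" and y: "y \<in> carrier P.T"
    show "?\<theta> (x \<otimes>\<^bsub>P.T\<^esub> y) = ?\<theta> x \<otimes>\<^bsub>tensor_algebra F A' B'\<^esub> ?\<theta> y"
      using x
    proof (induction x rule: P.tensor_induct)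
      case (pure a b)
      show ?case using y
      proof (induction y rule: P.tensor_induct)
        case (pure a' b')
        then show ?case using \<open>a \<in> carrier A\<close> \<open>b \<in> carrier B\<close>
          by (simp add: P.pure_mult Q.pure_mult tm(2) \<alpha> \<beta>)
      next
        case (add y z)
        then show ?case using pure by (simp add: P.T.r_distr Q.T.r_distr L)
      qed
    next
      case (add x z)
      then show ?case using y by (simp add: P.T.l_distr Q.T.l_distr L)
    qed
  qed (simp_all add: L P.tensor_one Q.tensor_one tm(2) \<alpha>(4) \<beta>(4))
qed

lemma tensor_maps_eqI:
  assumes "assoc_algebra F A" "assoc_algebra F B"
    and "h \<in> linear_maps F (tensor_algebra F A B) V" "h' \<in> linear_maps F (tensor_algebra F A B) V"
    and "\<And>a b. \<lbrakk>a \<in> carrier A; b \<in> carrier B\<rbrakk> \<Longrightarrow> h (pure_tensor F A B a b) = h' (pure_tensor F A B a b)"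
    and "x \<in> carrier (tensor_algebra F A B)"
  shows "h x = h' x"
proof -
  interpret P: algebra_pair F A B by (rule algebra_pair.intro[OF assms(1,2)])
  show ?thesis using assms(6)
    by (induction x rule: P.tensor_induct) (simp_all add: assms(5) linear_mapsD[OF assms(3)] linear_mapsD[OF assms(4)])
qed

lemma linear_maps_comp:
  "\<lbrakk>h \<in> linear_maps F V W; g \<in> linear_maps F W U\<rbrakk> \<Longrightarrow> (\<lambda>x. g (h x)) \<in> linear_maps F V U"
  by (rule linear_mapsI) (simp_all add: linear_mapsD)

lemma linear_maps_id: "(\<lambda>x. x) \<in> linear_maps F V V"
  by (rule linear_mapsI) simp_all

text \<open>
  Linear left inverses of the two factors give a left inverse of the tensor product.
\<close>

lemma tensor_map_inj:
  assumes "assoc_algebra F A" "assoc_algebra F B" "assoc_algebra F A'" "assoc_algebra F B'"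
    and "\<alpha> \<in> linear_maps F A A'" "\<beta> \<in> linear_maps F B B'"
    and "inj_on \<alpha> (carrier A)" "inj_on \<beta> (carrier B)"
  shows "inj_on (tensor_map F A B A' B' \<alpha> \<beta>) (carrier (tensor_algebra F A B))"
proof -
  note m = assoc_algebraD(3) and f = assoc_algebraD(1)[OF assms(1)]
  obtain \<alpha>' where a: "\<alpha>' \<in> linear_maps F A' A" "\<forall>x\<in>carrier A. \<alpha>' (\<alpha> x) = x"
    using exists_left_inverse[OF f m[OF assms(1)] m[OF assms(3)] assms(5,7)] by blast
  obtain \<beta>' where b: "\<beta>' \<in> linear_maps F B' B" "\<forall>x\<in>carrier B. \<beta>' (\<beta> x) = x"
    using exists_left_inverse[OF f m[OF assms(2)] m[OF assms(4)] assms(6,8)] by blast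
  note t = tensor_map[OF assms(1-6)] and t' = tensor_map[OF assms(3,4,1,2) a(1) b(1)]
  have "tensor_map F A' B' A B \<alpha>' \<beta>' (tensor_map F A B A' B' \<alpha> \<beta> x) = x"
    if "x \<in> carrier (tensor_algebra F A B)" for x
    by (rule tensor_maps_eqI[OF assms(1,2) linear_maps_comp[OF t(1) t'(1)] linear_maps_id _ that])
      (use a(2) b(2) linear_mapsD(1)[OF assms(5)] linear_mapsD(1)[OF assms(6)] in \<open>simp add: t(2) t'(2)\<close>)
  then show ?thesis by (rule inj_on_inverseI)
qed

section \<open>Tensor products of ideals\<close>

lemma ideal_vimage:
  assumes "assoc_algebra F A" "assoc_algebra F B" "h \<in> algebra_hom F A B" "ideal J B"
  shows "ideal {x \<in> carrier A. h x \<in> J} A"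
proof (rule idealI)
  interpret A: ring A by (rule assoc_algebraD(2)[OF assms(1)])
  interpret J: ideal J B by fact
  note hD = algebra_homD[OF assms(3)]
  show "ring A" by (rule A.ring_axioms)
  show "subgroup {x \<in> carrier A. h x \<in> J} (add_monoid A)"
    by (rule submodule.axioms(1)[OF submodule_vimage[OF assoc_algebraD(3)[OF assms(1)]
      assoc_algebraD(3)[OF assms(2)] algebra_hom_linear[OF assms(3)] ideal_is_submodule[OF assms(2,4)]]])
  fix a x assume "a \<in> {x \<in> carrier A. h x \<in> J}" "x \<in> carrier A"
  then show "x \<otimes>\<^bsub>A\<^esub> a \<in> {x \<in> carrier A. h x \<in> J}" "a \<otimes>\<^bsub>A\<^esub> x \<in> {x \<in> carrier A. h x \<in> J}"
    by (simp_all add: hD J.I_l_closed J.I_r_closed)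
qed

lemma ideal_image:
  assumes "assoc_algebra F A" "assoc_algebra F B" "h \<in> algebra_hom F A B" "ideal J A"
    and "\<And>y x. \<lbrakk>y \<in> carrier B; x \<in> J\<rbrakk> \<Longrightarrow> \<exists>x'\<in>J. y \<otimes>\<^bsub>B\<^esub> h x = h x'"
    and "\<And>y x. \<lbrakk>y \<in> carrier B; x \<in> J\<rbrakk> \<Longrightarrow> \<exists>x'\<in>J. h x \<otimes>\<^bsub>B\<^esub> y = h x'"
  shows "ideal (h ` J) B"
proof (rule idealI)
  show "ring B" by (rule assoc_algebraD(2)[OF assms(2)])
  show "subgroup (h ` J) (add_monoid B)"
    by (rule submodule.axioms(1)[OF submodule_image[OF assoc_algebraD(3)[OF assms(1)]
      assoc_algebraD(3)[OF assms(2)] algebra_hom_linear[OF assms(3)] ideal_is_submodule[OF assms(1,4)]]])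
  fix a x assume "a \<in> h ` J" "x \<in> carrier B"
  then show "x \<otimes>\<^bsub>B\<^esub> a \<in> h ` J" "a \<otimes>\<^bsub>B\<^esub> x \<in> h ` J" using assms(5,6) by blast+
qed

lemma ideal_image_surj:
  assumes "assoc_algebra F A" "assoc_algebra F B" "h \<in> algebra_hom F A B" "ideal J A"
    and "h ` carrier A = carrier B"
  shows "ideal (h ` J) B"
proof (rule ideal_image[OF assms(1-4)])
  interpret J: ideal J A by fact
  note hD = algebra_homD[OF assms(3)]
  fix y x assume "y \<in> carrier B" "x \<in> J"
  moreover then obtain z where "z \<in> carrier A" "y = h z" using assms(5) by blast
  ultimately show "\<exists>x'\<in>J. y \<otimes>\<^bsub>B\<^esub> h x = h x'" "\<exists>x'\<in>J. h x \<otimes>\<^bsub>B\<^esub> y = h x'"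
    using J.I_l_closed J.I_r_closed hD(2) by (metis J.Icarr)+
qed

context algebra_pair
begin

lemma tensor_subspace:
  assumes "S \<subseteq> carrier A" "U \<subseteq> carrier B"
  shows "submodule (tensor_subspace F A B S U) F T"
    and "\<And>a b. \<lbrakk>a \<in> S; b \<in> U\<rbrakk> \<Longrightarrow> a \<otimes>\<^sub>t b \<in> tensor_subspace F A B S U"
    and "\<And>H. \<lbrakk>submodule H F T; \<And>a b. \<lbrakk>a \<in> S; b \<in> U\<rbrakk> \<Longrightarrow> a \<otimes>\<^sub>t b \<in> H\<rbrakk> \<Longrightarrow> tensor_subspace F A B S U \<subseteq> H"
    and "tensor_subspace F A B S U \<subseteq> carrier T"
proof -
  have X: "{a \<otimes>\<^sub>t b | a b. a \<in> S \<and> b \<in> U} \<subseteq> carrier T"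
    using assms pure_closed by blast
  note sp = subspace_span[OF TM.module_axioms X, folded tensor_subspace_def]
  show "submodule (tensor_subspace F A B S U) F T" by (rule sp(1))
  then show "tensor_subspace F A B S U \<subseteq> carrier T" by (rule TM.submoduleE(1))
  show "\<And>a b. \<lbrakk>a \<in> S; b \<in> U\<rbrakk> \<Longrightarrow> a \<otimes>\<^sub>t b \<in> tensor_subspace F A B S U" using sp(2) by blast
  show "tensor_subspace F A B S U \<subseteq> H"
    if "submodule H F T" "\<And>a b. \<lbrakk>a \<in> S; b \<in> U\<rbrakk> \<Longrightarrow> a \<otimes>\<^sub>t b \<in> H" for H
    by (rule sp(3)[OF that(1)]) (use that(2) in blast)
qed

lemma tensor_subspace_mono:
  assumes "S \<subseteq> S'" "U \<subseteq> U'" "S' \<subseteq> carrier A" "U' \<subseteq> carrier B"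
  shows "tensor_subspace F A B S U \<subseteq> tensor_subspace F A B S' U'"
  using assms by (intro tensor_subspace(3) tensor_subspace(1)) (auto intro: tensor_subspace(2)[OF assms(3,4)])

lemma tensor_subspace_top: "tensor_subspace F A B (carrier A) (carrier B) = carrier T"
proof
  note ts = tensor_subspace[OF subset_refl subset_refl]
  show "tensor_subspace F A B (carrier A) (carrier B) \<subseteq> carrier T" by (rule ts(4))
  show "carrier T \<subseteq> tensor_subspace F A B (carrier A) (carrier B)"
  proof
    fix x assume "x \<in> carrier T"
    then show "x \<in> tensor_subspace F A B (carrier A) (carrier B)"
      by (induction x rule: tensor_induct) (auto intro: ts(2) TM.submoduleE(5)[OF ts(1)])
  qed
qed

lemma idealI_pure:
  assumes H: "submodule H F T"
    and l: "\<And>a b x. \<lbrakk>a \<in> carrier A; b \<in> carrier B; x \<in> H\<rbrakk> \<Longrightarrow> (a \<otimes>\<^sub>t b) \<otimes>\<^bsub>T\<^esub> x \<in> H"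
    and r: "\<And>a b x. \<lbrakk>a \<in> carrier A; b \<in> carrier B; x \<in> H\<rbrakk> \<Longrightarrow> x \<otimes>\<^bsub>T\<^esub> (a \<otimes>\<^sub>t b) \<in> H"
  shows "ideal H T"
proof (rule idealI[OF T.ring_axioms])
  note HE = TM.submoduleE[OF H]
  show "subgroup H (add_monoid T)" by (rule submodule.axioms(1)[OF H])
  fix x y assume x: "x \<in> H" and y: "y \<in> carrier T"
  have xc: "x \<in> carrier T" using HE(1) x by blast
  show "y \<otimes>\<^bsub>T\<^esub> x \<in> H" using y
    by (induction y rule: tensor_induct) (use x xc in \<open>simp_all add: l HE(5) T.l_distr\<close>)
  show "x \<otimes>\<^bsub>T\<^esub> y \<in> H" using y
    by (induction y rule: tensor_induct) (use x xc in \<open>simp_all add: r HE(5) T.r_distr\<close>)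
qed

text \<open>
  Multiplication by a pure tensor maps the spanning pure tensors to spanning pure tensors.
\<close>

lemma tensor_subspace_ideal:
  assumes "ideal I A" "ideal L B"
  shows "ideal (tensor_subspace F A B I L) T"
proof -
  interpret I: ideal I A by fact
  interpret L: ideal L B by fact
  note ts = tensor_subspace[OF I.a_subset L.a_subset]
  let ?H = "tensor_subspace F A B I L"
  note HE = TM.submoduleE[OF ts(1)]
  have pc: "u \<otimes>\<^sub>t v \<in> carrier T" if "u \<in> I" "v \<in> L" for u v using that by auto
  have m1: "(a \<otimes>\<^sub>t b) \<otimes>\<^bsub>T\<^esub> x \<in> ?H" if ab: "a \<in> carrier A" "b \<in> carrier B" and x: "x \<in> ?H" for a b x
  proof -
    have "?H \<subseteq> {x \<in> carrier T. (a \<otimes>\<^sub>t b) \<otimes>\<^bsub>T\<^esub> x \<in> ?H}"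
    proof (rule ts(3)[OF submodule_vimage[OF TM.module_axioms TM.module_axioms _ ts(1)]])
      show "(\<lambda>x. (a \<otimes>\<^sub>t b) \<otimes>\<^bsub>T\<^esub> x) \<in> linear_maps F T T"
        by (rule linear_mapsI) (use ab in \<open>simp_all add: T.r_distr assoc_algebraD(6)[OF assoc_algebra_tensor]\<close>)
      show "u \<otimes>\<^sub>t v \<in> {x \<in> carrier T. (a \<otimes>\<^sub>t b) \<otimes>\<^bsub>T\<^esub> x \<in> ?H}" if "u \<in> I" "v \<in> L" for u v
        using that ab pc ts(2) I.I_l_closed L.I_l_closed by (simp add: pure_mult)
    qed
    then show ?thesis using x by blast
  qed
  have m2: "x \<otimes>\<^bsub>T\<^esub> (a \<otimes>\<^sub>t b) \<in> ?H" if ab: "a \<in> carrier A" "b \<in> carrier B" and x: "x \<in> ?H" for a b x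
  proof -
    have "?H \<subseteq> {x \<in> carrier T. x \<otimes>\<^bsub>T\<^esub> (a \<otimes>\<^sub>t b) \<in> ?H}"
    proof (rule ts(3)[OF submodule_vimage[OF TM.module_axioms TM.module_axioms _ ts(1)]])
      show "(\<lambda>x. x \<otimes>\<^bsub>T\<^esub> (a \<otimes>\<^sub>t b)) \<in> linear_maps F T T"
        by (rule linear_mapsI) (use ab in \<open>simp_all add: T.l_distr assoc_algebraD(5)[OF assoc_algebra_tensor]\<close>)
      show "u \<otimes>\<^sub>t v \<in> {x \<in> carrier T. x \<otimes>\<^bsub>T\<^esub> (a \<otimes>\<^sub>t b) \<in> ?H}" if "u \<in> I" "v \<in> L" for u v
        using that ab pc ts(2) I.I_r_closed L.I_r_closed by (simp add: pure_mult)
    qed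
    then show ?thesis using x by blast
  qed
  show ?thesis by (rule idealI_pure[OF ts(1) m1 m2])
qed

lemma tensor_comm:
  assumes "\<And>x y. \<lbrakk>x \<in> carrier A; y \<in> carrier A\<rbrakk> \<Longrightarrow> x \<otimes>\<^bsub>A\<^esub> y = y \<otimes>\<^bsub>A\<^esub> x"
    and "\<And>x y. \<lbrakk>x \<in> carrier B; y \<in> carrier B\<rbrakk> \<Longrightarrow> x \<otimes>\<^bsub>B\<^esub> y = y \<otimes>\<^bsub>B\<^esub> x"
  shows "cring T"
proof -
  have comm: "x \<otimes>\<^bsub>T\<^esub> y = y \<otimes>\<^bsub>T\<^esub> x" if x: "x \<in> carrier T" and y: "y \<in> carrier T" for x y
    using x
  proof (induction x rule: tensor_induct)
    case (pure a b)
    show ?case using y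
    proof (induction y rule: tensor_induct)
      case (pure a' b')
      then show ?case using \<open>a \<in> carrier A\<close> \<open>b \<in> carrier B\<close> assms
        by (simp add: pure_mult)
    next
      case (add y z)
      then show ?case using pure by (simp add: T.l_distr T.r_distr)
    qed
  next
    case (add x z)
    then show ?case using y by (simp add: T.l_distr T.r_distr)
  qed
  show ?thesis
  proof (rule cringI[OF T.abelian_group_axioms comm_monoidI])
    show "x \<otimes>\<^bsub>T\<^esub> y = y \<otimes>\<^bsub>T\<^esub> x" if "x \<in> carrier T" "y \<in> carrier T" for x y
      by (rule comm[OF that])
  qed (simp_all add: T.m_assoc T.l_distr)
qed

text \<open>
  A functional \<open>\<psi>\<close> with \<open>\<psi> b = 1\<close> induces the linear map \<open>x \<otimes> y \<mapsto> \<psi>(y) x\<close>, which sends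
  \<open>a \<otimes> b\<close> to \<open>a\<close>.
\<close>

lemma pure_nonzero:
  assumes "a \<in> carrier A" "a \<noteq> \<zero>\<^bsub>A\<^esub>" "b \<in> carrier B" "b \<noteq> \<zero>\<^bsub>B\<^esub>"
  shows "a \<otimes>\<^sub>t b \<noteq> \<zero>\<^bsub>T\<^esub>"
proof
  assume z: "a \<otimes>\<^sub>t b = \<zero>\<^bsub>T\<^esub>"
  obtain \<psi> where \<psi>: "\<psi> \<in> carrier B \<rightarrow> carrier F"
    "\<And>x y. \<lbrakk>x \<in> carrier B; y \<in> carrier B\<rbrakk> \<Longrightarrow> \<psi> (x \<oplus>\<^bsub>B\<^esub> y) = \<psi> x \<oplus>\<^bsub>F\<^esub> \<psi> y"
    "\<And>c x. \<lbrakk>c \<in> carrier F; x \<in> carrier B\<rbrakk> \<Longrightarrow> \<psi> (c \<odot>\<^bsub>B\<^esub> x) = c \<otimes>\<^bsub>F\<^esub> \<psi> x"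
    "\<psi> b = \<one>\<^bsub>F\<^esub>"
    using exists_functional[OF F.field_axioms BM.module_axioms assms(3,4)] by blast
  have c: "\<psi> y \<in> carrier F" if "y \<in> carrier B" for y using \<psi>(1) that by blast
  have "\<exists>\<theta>\<in>linear_maps F T A. \<forall>a\<in>carrier A. \<forall>b\<in>carrier B. \<theta> (a \<otimes>\<^sub>t b) = \<psi> b \<odot>\<^bsub>A\<^esub> a"
    by (rule tensor_universal[OF AM.module_axioms])
      (simp_all add: c \<psi>(2,3) AM.smult_l_distr AM.smult_r_distr AM.smult_assoc1[symmetric] F.m_comm)
  then obtain \<theta> where \<theta>: "\<theta> \<in> linear_maps F T A" "\<theta> (a \<otimes>\<^sub>t b) = \<psi> b \<odot>\<^bsub>A\<^esub> a"
    using assms by blast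
  have "\<theta> \<zero>\<^bsub>T\<^esub> = \<zero>\<^bsub>A\<^esub>"
    by (rule linear_maps_additive(1)[OF \<theta>(1) T.abelian_group_axioms A.abelian_group_axioms])
  then show False using \<theta>(2) z \<psi>(4) assms by simp
qed

text \<open>
  Let \<open>\<pi>\<close> and \<open>\<rho>\<close> be linear projections onto \<open>I\<close> and \<open>L\<close>. Then \<open>\<pi> \<otimes> id\<close> is the identity on
  \<open>I \<otimes> B\<close> and \<open>id \<otimes> \<rho>\<close> is the identity on \<open>A \<otimes> L\<close>, so an element of both is fixed by
  \<open>\<pi> \<otimes> \<rho>\<close>, whose values lie in \<open>I \<otimes> L\<close>.
\<close>

lemma tensor_subspace_inter:
  assumes "ideal I A" "ideal L B"
    and x: "x \<in> tensor_subspace F A B I (carrier B)" "x \<in> tensor_subspace F A B (carrier A) L"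
  shows "x \<in> tensor_subspace F A B I L"
proof -
  interpret I: ideal I A by fact
  interpret L: ideal L B by fact
  note sm = ideal_is_submodule[OF A_alg assms(1)] ideal_is_submodule[OF B_alg assms(2)]
  obtain \<pi> where \<pi>: "\<pi> \<in> linear_maps F A A" "\<forall>x\<in>carrier A. \<pi> x \<in> I" "\<forall>x\<in>I. \<pi> x = x"
    using exists_projection[OF F.field_axioms AM.module_axioms sm(1)] by blast
  obtain \<rho> where \<rho>: "\<rho> \<in> linear_maps F B B" "\<forall>x\<in>carrier B. \<rho> x \<in> L" "\<forall>x\<in>L. \<rho> x = x"
    using exists_projection[OF F.field_axioms BM.module_axioms sm(2)] by blast
  note one = linear_maps_id[of F]
  let ?p = "tensor_map F A B A B \<pi> (\<lambda>x. x)" and ?r = "tensor_map F A B A B (\<lambda>x. x) \<rho>"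
  note p = tensor_map[OF A_alg B_alg A_alg B_alg \<pi>(1) one]
  note r = tensor_map[OF A_alg B_alg A_alg B_alg one \<rho>(1)]
  note tI = tensor_subspace[OF I.a_subset subset_refl] and tL = tensor_subspace[OF subset_refl L.a_subset]
    and tIL = tensor_subspace[OF I.a_subset L.a_subset]
  have fix_sub: "submodule {x \<in> carrier T. h x = x} F T" if "h \<in> linear_maps F T T" for h
    by (rule TM.submoduleI)
      (use linear_mapsD[OF that] linear_maps_additive[OF that T.abelian_group_axioms T.abelian_group_axioms] in simp_all)
  have "tensor_subspace F A B I (carrier B) \<subseteq> {x \<in> carrier T. ?p x = x}"
    by (rule tI(3)[OF fix_sub[OF p(1)]]) (use \<pi>(3) p(2) in simp)
  then have px: "?p x = x" using x(1) by blast
  have "tensor_subspace F A B (carrier A) L \<subseteq> {x \<in> carrier T. ?r x = x}"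
    by (rule tL(3)[OF fix_sub[OF r(1)]]) (use \<rho>(3) r(2) in simp)
  then have rx: "?r x = x" using x(2) by blast
  have "?p (?r y) \<in> tensor_subspace F A B I L" if "y \<in> carrier T" for y
    using that
  proof (induction y rule: tensor_induct)
    case (pure a b)
    then show ?case using p(2) r(2) \<pi>(2) \<rho>(2) tIL(2) L.Icarr by simp
  next
    case (add y z)
    then show ?case
      using TM.submoduleE(5)[OF tIL(1)] by (simp add: linear_mapsD[OF p(1)] linear_mapsD[OF r(1)])
  qed
  from this[of x] show ?thesis using px rx x(1) tI(4) by auto
qed

end

lemma tensor_map_image:
  assumes "assoc_algebra F A" "assoc_algebra F B" "assoc_algebra F A'" "assoc_algebra F B'"
    and "\<alpha> \<in> linear_maps F A A'" "\<beta> \<in> linear_maps F B B'"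
    and "S \<subseteq> carrier A" "U \<subseteq> carrier B"
  shows "tensor_map F A B A' B' \<alpha> \<beta> ` tensor_subspace F A B S U = tensor_subspace F A' B' (\<alpha> ` S) (\<beta> ` U)"
proof -
  interpret P: algebra_pair F A B by (rule algebra_pair.intro[OF assms(1,2)])
  interpret Q: algebra_pair F A' B' by (rule algebra_pair.intro[OF assms(3,4)])
  let ?\<theta> = "tensor_map F A B A' B' \<alpha> \<beta>"
  note t = tensor_map[OF assms(1-6)]
  have S': "\<alpha> ` S \<subseteq> carrier A'" "\<beta> ` U \<subseteq> carrier B'"
    using assms(7,8) linear_mapsD(1)[OF assms(5)] linear_mapsD(1)[OF assms(6)] by blast+
  note p = P.tensor_subspace[OF assms(7,8)] and q = Q.tensor_subspace[OF S']
  note m = assoc_algebraD(3)[OF P.assoc_algebra_tensor] assoc_algebraD(3)[OF Q.assoc_algebra_tensor]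
  show ?thesis
  proof
    have "tensor_subspace F A B S U \<subseteq>
        {x \<in> carrier P.T. ?\<theta> x \<in> tensor_subspace F A' B' (\<alpha> ` S) (\<beta> ` U)}"
      by (rule p(3)[OF submodule_vimage[OF m t(1) q(1)]])
        (use assms(7,8) t(2) q(2) in \<open>simp add: subset_iff\<close>)
    then show "?\<theta> ` tensor_subspace F A B S U \<subseteq> tensor_subspace F A' B' (\<alpha> ` S) (\<beta> ` U)" by blast
    have im: "pure_tensor F A' B' (\<alpha> a) (\<beta> b) \<in> ?\<theta> ` tensor_subspace F A B S U"
      if "a \<in> S" "b \<in> U" for a b
    proof -
      have "pure_tensor F A' B' (\<alpha> a) (\<beta> b) = ?\<theta> (pure_tensor F A B a b)"
        using t(2) that assms(7,8) by (simp add: subset_iff)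
      then show ?thesis using p(2)[OF that] by blast
    qed
    show "tensor_subspace F A' B' (\<alpha> ` S) (\<beta> ` U) \<subseteq> ?\<theta> ` tensor_subspace F A B S U"
      by (rule q(3)[OF submodule_image[OF m t(1) p(1)]]) (use im in blast)
  qed
qed

text \<open>
  For linear sections \<open>s\<close> and \<open>t\<close> of \<open>\<alpha>\<close> and \<open>\<beta>\<close>, every \<open>x\<close> differs from
  \<open>(s \<otimes> t) ((\<alpha> \<otimes> \<beta>) x)\<close> by an element of \<open>I \<otimes> B + A \<otimes> L\<close>. On a pure tensor this is the identity
  \<open>a \<otimes> b - a' \<otimes> b' = (a - a') \<otimes> b + a' \<otimes> (b - b')\<close>.
\<close>

lemma tensor_map_kernel:
  assumes "assoc_algebra F A" "assoc_algebra F B" "assoc_algebra F A'" "assoc_algebra F B'"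
    and "\<alpha> \<in> linear_maps F A A'" "\<beta> \<in> linear_maps F B B'"
    and "\<alpha> ` carrier A = carrier A'" "\<beta> ` carrier B = carrier B'"
    and "ideal I A" "ideal L B"
    and "\<And>a. \<lbrakk>a \<in> carrier A; \<alpha> a = \<zero>\<^bsub>A'\<^esub>\<rbrakk> \<Longrightarrow> a \<in> I" "\<And>b. \<lbrakk>b \<in> carrier B; \<beta> b = \<zero>\<^bsub>B'\<^esub>\<rbrakk> \<Longrightarrow> b \<in> L"
    and x: "x \<in> carrier (tensor_algebra F A B)" "tensor_map F A B A' B' \<alpha> \<beta> x = \<zero>\<^bsub>tensor_algebra F A' B'\<^esub>"
  shows "x \<in> tensor_subspace F A B I (carrier B) <+>\<^bsub>tensor_algebra F A B\<^esub> tensor_subspace F A B (carrier A) L"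
    (is "_ \<in> ?H")
proof -
  interpret P: algebra_pair F A B by (rule algebra_pair.intro[OF assms(1,2)])
  interpret Q: algebra_pair F A' B' by (rule algebra_pair.intro[OF assms(3,4)])
  interpret I: ideal I A by fact
  interpret L: ideal L B by fact
  note md = assoc_algebraD(3) and ag = assoc_algebraD(4)
  obtain s where s: "s \<in> linear_maps F A' A" "\<forall>y\<in>carrier A'. \<alpha> (s y) = y"
    using exists_section[OF assoc_algebraD(1)[OF assms(1)] md[OF assms(1)] md[OF assms(3)] assms(5,7)] by blast
  obtain t where t: "t \<in> linear_maps F B' B" "\<forall>y\<in>carrier B'. \<beta> (t y) = y"
    using exists_section[OF assoc_algebraD(1)[OF assms(1)] md[OF assms(2)] md[OF assms(4)] assms(6,8)] by blast
  let ?\<theta> = "tensor_map F A B A' B' \<alpha> \<beta>" and ?\<sigma> = "tensor_map F A' B' A B s t"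
  note th = tensor_map[OF assms(1-6)] and si = tensor_map[OF assms(3,4,1,2) s(1) t(1)]
  note \<alpha> = linear_mapsD[OF assms(5)] and \<beta> = linear_mapsD[OF assms(6)]
  note sD = linear_mapsD[OF s(1)] and tD = linear_mapsD[OF t(1)]
  note tI = P.tensor_subspace[OF I.a_subset subset_refl] and tL = P.tensor_subspace[OF subset_refl L.a_subset]
  have iH: "ideal ?H P.T"
    by (intro P.T.add_ideals P.tensor_subspace_ideal assms P.A.oneideal P.B.oneideal)
  interpret H: ideal ?H "tensor_algebra F A B" by (rule iH)
  have "y \<ominus>\<^bsub>P.T\<^esub> ?\<sigma> (?\<theta> y) \<in> ?H" if "y \<in> carrier P.T" for y
    using that
  proof (induction y rule: P.tensor_induct)
    case (pure a b)
    let ?a = "s (\<alpha> a)" and ?b = "t (\<beta> b)"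
    have c: "?a \<in> carrier A" "?b \<in> carrier B" using pure \<alpha> \<beta> sD tD by auto
    have "\<alpha> (a \<ominus>\<^bsub>A\<^esub> ?a) = \<zero>\<^bsub>A'\<^esub>"
      using linear_maps_additive(3)[OF assms(5) ag[OF assms(1)] ag[OF assms(3)] pure(1) c(1)]
        s(2) \<alpha>(1)[OF pure(1)] abelian_group.minus_eq_zero_iff[OF ag[OF assms(3)]] by simp
    then have ai: "a \<ominus>\<^bsub>A\<^esub> ?a \<in> I" using assms(11) pure c by simp
    have "\<beta> (b \<ominus>\<^bsub>B\<^esub> ?b) = \<zero>\<^bsub>B'\<^esub>"
      using linear_maps_additive(3)[OF assms(6) ag[OF assms(2)] ag[OF assms(4)] pure(2) c(2)]
        t(2) \<beta>(1)[OF pure(2)] abelian_group.minus_eq_zero_iff[OF ag[OF assms(4)]] by simp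
    then have bi: "b \<ominus>\<^bsub>B\<^esub> ?b \<in> L" using assms(12) pure c by simp
    have e1: "a = (a \<ominus>\<^bsub>A\<^esub> ?a) \<oplus>\<^bsub>A\<^esub> ?a" using pure c by (simp add: P.A.minus_eq P.A.a_assoc P.A.l_neg)
    have e2: "b = (b \<ominus>\<^bsub>B\<^esub> ?b) \<oplus>\<^bsub>B\<^esub> ?b" using pure c by (simp add: P.B.minus_eq P.B.a_assoc P.B.l_neg)
    let ?u = "pure_tensor F A B (a \<ominus>\<^bsub>A\<^esub> ?a) b" and ?v = "pure_tensor F A B ?a (b \<ominus>\<^bsub>B\<^esub> ?b)"
      and ?w = "pure_tensor F A B ?a ?b"
    have cc: "?u \<in> carrier P.T" "?v \<in> carrier P.T" "?w \<in> carrier P.T"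
      using pure c by simp_all
    have "pure_tensor F A B a b = ?u \<oplus>\<^bsub>P.T\<^esub> pure_tensor F A B ?a b"
      by (subst (1) e1) (use pure c in \<open>simp add: P.pure_add_left\<close>)
    also have "pure_tensor F A B ?a b = ?v \<oplus>\<^bsub>P.T\<^esub> ?w"
      by (subst (1) e2) (use pure c in \<open>simp add: P.pure_add_right\<close>)
    finally have "pure_tensor F A B a b \<ominus>\<^bsub>P.T\<^esub> ?w = ?u \<oplus>\<^bsub>P.T\<^esub> ?v"
      using cc by (simp add: P.T.minus_eq P.T.a_assoc P.T.r_neg)
    moreover have "?\<sigma> (?\<theta> (pure_tensor F A B a b)) = ?w" using th(2) si(2) pure \<alpha> \<beta> by simp
    moreover have "?u \<oplus>\<^bsub>P.T\<^esub> ?v \<in> ?H"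
      using tI(2)[OF ai pure(2)] tL(2)[OF c(1) bi] unfolding set_add_def' by blast
    ultimately show ?case by simp
  next
    case (add y z)
    note D = linear_mapsD[OF th(1)] linear_mapsD[OF si(1)]
    have "y \<oplus>\<^bsub>P.T\<^esub> z \<ominus>\<^bsub>P.T\<^esub> ?\<sigma> (?\<theta> (y \<oplus>\<^bsub>P.T\<^esub> z)) =
      (y \<ominus>\<^bsub>P.T\<^esub> ?\<sigma> (?\<theta> y)) \<oplus>\<^bsub>P.T\<^esub> (z \<ominus>\<^bsub>P.T\<^esub> ?\<sigma> (?\<theta> z))"
      using add(1,2) by (simp add: D P.T.minus_eq P.T.minus_add P.T.a_ac)
    then show ?case using H.a_closed[OF add(3,4)] by simp
  qed
  from this[OF x(1)] show ?thesis
    using x linear_maps_additive(1)[OF si(1) Q.T.abelian_group_axioms P.T.abelian_group_axioms]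
    by (simp add: P.T.minus_eq)
qed

section \<open>Martindale's theorem for closed monoliths\<close>

text \<open>
  The elements of the multiplication algebra of \<open>R\<close>, given by lists of left and right factors.
  Lists compose well: concatenation adds operators, and multiplying all left or all right factors
  multiplies the values.
\<close>

fun bimult :: "('a, 'm) ring_scheme \<Rightarrow> ('a \<times> 'a) list \<Rightarrow> 'a \<Rightarrow> 'a" where
  "bimult R [] x = \<zero>\<^bsub>R\<^esub>"
| "bimult R ((u, v) # ps) x = u \<otimes>\<^bsub>R\<^esub> x \<otimes>\<^bsub>R\<^esub> v \<oplus>\<^bsub>R\<^esub> bimult R ps x"

fun center_span :: "('f, 'a) module \<Rightarrow> 'a list \<Rightarrow> 'a set" where
  "center_span Q [] = {\<zero>\<^bsub>Q\<^esub>}"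
| "center_span Q (a # as) =
    {c \<otimes>\<^bsub>Q\<^esub> a \<oplus>\<^bsub>Q\<^esub> y | c y. c \<in> carrier (center_algebra Q) \<and> y \<in> center_span Q as}"

text \<open>
  In the applications \<open>T\<close> is \<open>Q \<otimes> P\<close>, the map \<open>\<sigma>\<close> is the inclusion of one factor, and the second
  components commute with its range. A list is then a representation of an element of \<open>T\<close> with
  coefficients from the centralizer of that factor.
\<close>

fun comb :: "('t, 'm) ring_scheme \<Rightarrow> ('a \<Rightarrow> 't) \<Rightarrow> ('a \<times> 't) list \<Rightarrow> 't" where
  "comb T \<sigma> [] = \<zero>\<^bsub>T\<^esub>"
| "comb T \<sigma> ((a, r) # l) = \<sigma> a \<otimes>\<^bsub>T\<^esub> r \<oplus>\<^bsub>T\<^esub> comb T \<sigma> l"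

text \<open>
  The ideal \<open>I\<close> is the smallest non-zero ideal, and \<open>Q\<close> is its own symmetric algebra of quotients as
  far as the centre is concerned: the last assumption says that \<open>Q\<close> contains the centroid of \<open>I\<close>.
\<close>

locale closed_monolith =
  fixes F :: "('f, 'm) ring_scheme" and Q :: "('f, 'q) module" (structure) and I :: "'q set"
  assumes alg: "assoc_algebra F Q"
    and ideal_I: "ideal I Q"
    and nonzero: "I \<noteq> {\<zero>}"
    and minimal: "\<And>N. \<lbrakk>ideal N Q; N \<noteq> {\<zero>}\<rbrakk> \<Longrightarrow> I \<subseteq> N"
    and faithful_left: "\<And>q. \<lbrakk>q \<in> carrier Q; \<And>x. x \<in> I \<Longrightarrow> q \<otimes> x = \<zero>\<rbrakk> \<Longrightarrow> q = \<zero>"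
    and faithful_right: "\<And>q. \<lbrakk>q \<in> carrier Q; \<And>x. x \<in> I \<Longrightarrow> x \<otimes> q = \<zero>\<rbrakk> \<Longrightarrow> q = \<zero>"
    and central: "\<And>f. \<lbrakk>\<And>x. x \<in> I \<Longrightarrow> f x \<in> I;
        \<And>x y. \<lbrakk>x \<in> I; y \<in> I\<rbrakk> \<Longrightarrow> f (x \<oplus> y) = f x \<oplus> f y;
        \<And>q x. \<lbrakk>q \<in> carrier Q; x \<in> I\<rbrakk> \<Longrightarrow> f (q \<otimes> x) = q \<otimes> f x;
        \<And>q x. \<lbrakk>q \<in> carrier Q; x \<in> I\<rbrakk> \<Longrightarrow> f (x \<otimes> q) = f x \<otimes> q\<rbrakk>
      \<Longrightarrow> \<exists>c\<in>carrier (center_algebra Q). \<forall>x\<in>I. f x = c \<otimes> x"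
begin

sublocale Q: ring Q by (rule assoc_algebraD(2)[OF alg])
sublocale QM: module F Q by (rule assoc_algebraD(3)[OF alg])
sublocale I: ideal I Q by (rule ideal_I)
sublocale C: cring "center_algebra Q" by (rule cring_center[OF alg])

abbreviation "C \<equiv> carrier (center_algebra Q)"

lemmas CD = center_algebraD[of _ Q]

lemma one_nonzero: "\<one> \<noteq> \<zero>"
proof
  assume "\<one> = \<zero>"
  then have "carrier Q = {\<zero>}" by (simp add: Q.one_zeroD)
  then show False using nonzero I.a_subset I.zero_closed by blast
qed

lemma exists_nonzero: "\<exists>u\<in>I. u \<noteq> \<zero>"
  using nonzero I.zero_closed by blast

abbreviation "op_list ps \<equiv> set ps \<subseteq> I \<times> I"

lemma bimult_closed: "\<lbrakk>op_list ps; x \<in> carrier Q\<rbrakk> \<Longrightarrow> bimult Q ps x \<in> I"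
  by (induction ps) (auto intro!: I.a_closed I.I_l_closed)

lemma bimult_add:
  "\<lbrakk>op_list ps; x \<in> carrier Q; y \<in> carrier Q\<rbrakk> \<Longrightarrow>
    bimult Q ps (x \<oplus> y) = bimult Q ps x \<oplus> bimult Q ps y"
  by (induction ps) (auto simp: Q.l_distr Q.r_distr Q.a_ac bimult_closed[THEN I.Icarr])

lemma bimult_central:
  "\<lbrakk>op_list ps; x \<in> carrier Q; c \<in> C\<rbrakk> \<Longrightarrow> bimult Q ps (c \<otimes> x) = c \<otimes> bimult Q ps x"
proof (induction ps)
  case (Cons p ps)
  obtain u v where p: "p = (u, v)" by (cases p)
  have uv: "u \<in> carrier Q" "v \<in> carrier Q" using Cons.prems p by auto
  have c: "c \<in> carrier Q" using CD(1) Cons.prems by blast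
  have "u \<otimes> (c \<otimes> x) = c \<otimes> (u \<otimes> x)"
    using uv c Cons.prems CD(2)[OF Cons.prems(3) uv(1)] by (simp add: Q.m_assoc[symmetric])
  then show ?case
    using Cons p uv c bimult_closed[of ps x] by (simp add: Q.m_assoc Q.r_distr I.Icarr)
qed (use CD(1) in simp)

lemma bimult_append:
  "\<lbrakk>op_list ps; op_list qs; x \<in> carrier Q\<rbrakk> \<Longrightarrow> bimult Q (ps @ qs) x = bimult Q ps x \<oplus> bimult Q qs x"
  by (induction ps) (auto simp: Q.a_assoc bimult_closed[THEN I.Icarr])

abbreviation "lmul q ps \<equiv> map (\<lambda>(u, v). (q \<otimes> u, v)) ps"
abbreviation "rmul ps q \<equiv> map (\<lambda>(u, v). (u, v \<otimes> q)) ps"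

lemma bimult_lmul:
  assumes "op_list ps" "x \<in> carrier Q" "q \<in> carrier Q"
  shows "op_list (lmul q ps)" "bimult Q (lmul q ps) x = q \<otimes> bimult Q ps x"
  using assms
  by (induction ps) (auto simp: Q.m_assoc Q.r_distr I.I_l_closed bimult_closed[THEN I.Icarr])

lemma bimult_rmul:
  assumes "op_list ps" "x \<in> carrier Q" "q \<in> carrier Q"
  shows "op_list (rmul ps q)" "bimult Q (rmul ps q) x = bimult Q ps x \<otimes> q"
  using assms
  by (induction ps) (auto simp: Q.m_assoc Q.l_distr I.I_r_closed bimult_closed[THEN I.Icarr])

text \<open>
  With an empty list this ideal serves to reach all of \<open>I\<close> from one element; with a longer list it is
  the domain of the bimodule map in Martindale's theorem.
\<close>

lemma bimult_image_ideal:
  assumes a: "a \<in> carrier Q" and as: "set as \<subseteq> carrier Q"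
  shows "ideal {bimult Q ps a | ps. op_list ps \<and> (\<forall>a'\<in>set as. bimult Q ps a' = \<zero>)} Q" (is "ideal ?N Q")
proof (rule idealI[OF Q.ring_axioms])
  have mem: "bimult Q ps a \<in> ?N" if "op_list ps" "\<And>a'. a' \<in> set as \<Longrightarrow> bimult Q ps a' = \<zero>" for ps
    using that by blast
  have cl: "q \<otimes> n \<in> ?N" if nq: "n \<in> ?N" "q \<in> carrier Q" for n q
  proof -
    obtain ps where ps: "op_list ps" "\<forall>a'\<in>set as. bimult Q ps a' = \<zero>" "n = bimult Q ps a"
      using nq by blast
    have "bimult Q (lmul q ps) a' = \<zero>" if "a' \<in> set as" for a'
      using bimult_lmul(2)[OF ps(1) subsetD[OF as that] nq(2)] ps(2) that nq(2) by simp
    from mem[OF bimult_lmul(1)[OF ps(1) a nq(2)] this] show ?thesis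
      using bimult_lmul(2)[OF ps(1) a nq(2)] ps(3) by simp
  qed
  have cr: "n \<otimes> q \<in> ?N" if nq: "n \<in> ?N" "q \<in> carrier Q" for n q
  proof -
    obtain ps where ps: "op_list ps" "\<forall>a'\<in>set as. bimult Q ps a' = \<zero>" "n = bimult Q ps a"
      using nq by blast
    have "bimult Q (rmul ps q) a' = \<zero>" if "a' \<in> set as" for a'
      using bimult_rmul(2)[OF ps(1) subsetD[OF as that] nq(2)] ps(2) that nq(2) by simp
    from mem[OF bimult_rmul(1)[OF ps(1) a nq(2)] this] show ?thesis
      using bimult_rmul(2)[OF ps(1) a nq(2)] ps(3) by simp
  qed
  have ca: "n \<oplus> n' \<in> ?N" if nn: "n \<in> ?N" "n' \<in> ?N" for n n'
  proof -
    obtain ps where ps: "op_list ps" "\<forall>a'\<in>set as. bimult Q ps a' = \<zero>" "n = bimult Q ps a"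
      using nn by blast
    obtain qs where qs: "op_list qs" "\<forall>a'\<in>set as. bimult Q qs a' = \<zero>" "n' = bimult Q qs a"
      using nn by blast
    have "bimult Q (ps @ qs) a' = \<zero>" if "a' \<in> set as" for a'
      using bimult_append[OF ps(1) qs(1) subsetD[OF as that]] ps(2) qs(2) that by simp
    from mem[OF _ this] show ?thesis
      using bimult_append[OF ps(1) qs(1) a] ps(1,3) qs(1,3) by simp
  qed
  have sub: "?N \<subseteq> carrier Q" using bimult_closed a I.Icarr by blast
  show "subgroup ?N (add_monoid Q)"
  proof (rule Q.add.subgroupI)
    show "?N \<subseteq> carrier Q" by (rule sub)
    show "?N \<noteq> {}" using mem[of "[]"] by auto
    show "\<ominus> n \<in> ?N" if "n \<in> ?N" for n
      using cl[OF that, of "\<ominus> \<one>"] sub that by (simp add: Q.l_minus subset_iff)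
    show "n \<oplus> n' \<in> ?N" if "n \<in> ?N" "n' \<in> ?N" for n n' by (rule ca[OF that])
  qed
  show "x \<otimes> n \<in> ?N" "n \<otimes> x \<in> ?N" if "n \<in> ?N" "x \<in> carrier Q" for n x
    by (rule cl[OF that], rule cr[OF that])
qed

text \<open>
  No non-zero element annihilates \<open>I\<close> on the right or on the left, so \<open>u b v\<close> is non-zero for suitable
  \<open>u\<close> and \<open>v\<close>.
\<close>

lemma exists_nonzero_bimult:
  assumes "b \<in> carrier Q" "b \<noteq> \<zero>"
  shows "\<exists>ps. op_list ps \<and> bimult Q ps b \<noteq> \<zero>"
proof -
  obtain u where u: "u \<in> I" "u \<otimes> b \<noteq> \<zero>" using faithful_right assms by blast
  then obtain v where v: "v \<in> I" "u \<otimes> b \<otimes> v \<noteq> \<zero>"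
    using faithful_left[of "u \<otimes> b"] assms I.Icarr by blast
  then have "bimult Q [(u, v)] b \<noteq> \<zero>" using u(1) assms I.Icarr by simp
  then show ?thesis using u(1) v(1) by (intro exI[of _ "[(u, v)]"]) simp
qed

text \<open>
  The values at \<open>b\<close> of all operators form an ideal; it is non-zero and so contains \<open>I\<close>.
\<close>

lemma reach_monolith:
  assumes "b \<in> carrier Q" "b \<noteq> \<zero>" "u \<in> I"
  shows "\<exists>ps. op_list ps \<and> bimult Q ps b = u"
proof -
  let ?N = "{bimult Q ps b | ps. op_list ps \<and> (\<forall>a'\<in>set []. bimult Q ps a' = \<zero>)}"
  have "ideal ?N Q" by (rule bimult_image_ideal) (use assms in simp_all)
  moreover have "?N \<noteq> {\<zero>}" using exists_nonzero_bimult[OF assms(1,2)] by auto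
  ultimately have "I \<subseteq> ?N" by (rule minimal)
  then show ?thesis using assms(3) by auto
qed

text \<open>
  Induction on the list. Let \<open>a\<close> be its first entry and consider the operators that kill the other
  entries. If they all kill \<open>a\<close>, then they kill \<open>b\<close> by assumption, and the induction hypothesis
  applies to \<open>b\<close>. Otherwise their values at \<open>a\<close> fill \<open>I\<close>, and the value at \<open>a\<close> determines the value
  at \<open>b\<close>. This correspondence is a bimodule endomorphism of \<open>I\<close>, that is, multiplication by a
  central \<open>c\<close>, so that \<open>b - c a\<close> is killed and the induction hypothesis applies to it.
\<close>

theorem martindale:
  assumes "set as \<subseteq> carrier Q" "b \<in> carrier Q"
    and "\<And>ps. \<lbrakk>op_list ps; \<forall>a\<in>set as. bimult Q ps a = \<zero>\<rbrakk> \<Longrightarrow> bimult Q ps b = \<zero>"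
  shows "b \<in> center_span Q as"
  using assms
proof (induction as arbitrary: b)
  case Nil
  then show ?case using exists_nonzero_bimult by auto
next
  case (Cons a as)
  let ?O = "\<lambda>ps. op_list ps \<and> (\<forall>a\<in>set as. bimult Q ps a = \<zero>)"
  have a: "a \<in> carrier Q" and as: "set as \<subseteq> carrier Q" using Cons.prems(1) by auto
  show ?case
  proof (cases "\<forall>ps. ?O ps \<longrightarrow> bimult Q ps a = \<zero>")
    case True
    then have "b \<in> center_span Q as"
      using Cons.prems(3) by (intro Cons.IH[OF as Cons.prems(2)]) simp
    moreover have "center_span Q as \<subseteq> carrier Q"
      using as by (induction as) (auto simp: CD(1))
    ultimately show ?thesis
      using a C.zero_closed by (simp, intro exI[of _ "\<zero>"] exI[of _ b]) auto
  next
    case False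
    let ?N = "{bimult Q ps a | ps. ?O ps}"
    have "I \<subseteq> ?N"
      by (rule minimal[OF bimult_image_ideal[OF a as]]) (use False in blast)
    then have ex: "\<exists>ps. ?O ps \<and> bimult Q ps a = x" if "x \<in> I" for x using that by blast
    have wd: "bimult Q ps b = bimult Q qs b"
      if ps: "?O ps" and qs: "?O qs" and e: "bimult Q ps a = bimult Q qs a" for ps qs
    proof -
      let ?m = "\<ominus> \<one>"
      let ?r = "ps @ lmul ?m qs"
      have m: "?m \<in> carrier Q" by simp
      have ol: "op_list ps" "op_list qs" using ps qs by auto
      note l = bimult_lmul[OF ol(2) _ m]
      have r: "bimult Q ?r x = bimult Q ps x \<ominus> bimult Q qs x" if "x \<in> carrier Q" for x
        using bimult_append[OF ol(1) l(1)[OF that] that] l(2)[OF that]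
          bimult_closed[OF ol(2) that, THEN I.Icarr] by (simp add: Q.l_minus Q.minus_eq)
      have "bimult Q ?r b = \<zero>"
      proof (rule Cons.prems(3))
        show "op_list ?r" using ol l(1)[OF a] by auto
        show "\<forall>a'\<in>set (a # as). bimult Q ?r a' = \<zero>"
          using r a as ps qs e bimult_closed[OF ol(2) a, THEN I.Icarr] by (auto simp: subset_iff Q.minus_eq_zero_iff)
      qed
      then show ?thesis
        using r[OF Cons.prems(2)] bimult_closed[OF ol(1) Cons.prems(2), THEN I.Icarr]
          bimult_closed[OF ol(2) Cons.prems(2), THEN I.Icarr] by (simp add: Q.minus_eq_zero_iff)
    qed
    define f where "f x = bimult Q (SOME ps. ?O ps \<and> bimult Q ps a = x) b" for x
    have f: "f (bimult Q ps a) = bimult Q ps b" if "?O ps" for ps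
    proof -
      let ?P = "\<lambda>qs. ?O qs \<and> bimult Q qs a = bimult Q ps a"
      have "?P (SOME qs. ?P qs)" by (rule someI[of ?P ps]) (use that in blast)
      then show ?thesis unfolding f_def using wd that by blast
    qed
    have "\<exists>c\<in>C. \<forall>x\<in>I. f x = c \<otimes> x"
    proof (rule central)
      fix x assume x: "x \<in> I"
      obtain ps where ps: "?O ps" "bimult Q ps a = x" using ex[OF x] by blast
      then have fx: "f x = bimult Q ps b" using f by blast
      then show "f x \<in> I" using bimult_closed ps Cons.prems(2) by simp
      fix q assume q: "q \<in> carrier Q"
      have "bimult Q (lmul q ps) a' = \<zero>" if "a' \<in> set as" for a'
        using bimult_lmul(2)[OF _ subsetD[OF as that] q, of ps] ps(1) q that by simp
      then have "?O (lmul q ps)" using bimult_lmul(1)[OF _ a q, of ps] ps(1) by blast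
      then show "f (q \<otimes> x) = q \<otimes> f x"
        using f[of "lmul q ps"] fx ps bimult_lmul(2)[of ps _ q] a Cons.prems(2) q by simp
      have "bimult Q (rmul ps q) a' = \<zero>" if "a' \<in> set as" for a'
        using bimult_rmul(2)[OF _ subsetD[OF as that] q, of ps] ps(1) q that by simp
      then have "?O (rmul ps q)" using bimult_rmul(1)[OF _ a q, of ps] ps(1) by blast
      then show "f (x \<otimes> q) = f x \<otimes> q"
        using f[of "rmul ps q"] fx ps bimult_rmul(2)[of ps _ q] a Cons.prems(2) q by simp
    next
      fix x y assume xy: "x \<in> I" "y \<in> I"
      obtain ps where ps: "?O ps" "bimult Q ps a = x" using ex[OF xy(1)] by blast
      obtain qs where qs: "?O qs" "bimult Q qs a = y" using ex[OF xy(2)] by blast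
      have "bimult Q (ps @ qs) a' = \<zero>" if "a' \<in> set as" for a'
        using bimult_append[OF _ _ subsetD[OF as that], of ps qs] ps(1) qs(1) that by simp
      then have "?O (ps @ qs)" using ps(1) qs(1) by simp
      then show "f (x \<oplus> y) = f x \<oplus> f y"
        using f[of "ps @ qs"] f[of ps] f[of qs] ps qs bimult_append[of ps qs] a Cons.prems(2) by simp
    qed
    then obtain c where c: "c \<in> C" "\<forall>x\<in>I. f x = c \<otimes> x" by blast
    have cc: "c \<in> carrier Q" by (rule CD(1)[OF c(1)])
    let ?y = "b \<ominus> c \<otimes> a"
    have "?y \<in> center_span Q as"
    proof (rule Cons.IH[OF as])
      show "?y \<in> carrier Q" using cc a Cons.prems(2) by simp
      fix ps assume ps: "op_list ps" "\<forall>a\<in>set as. bimult Q ps a = \<zero>"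
      have ia: "bimult Q ps a \<in> I" by (rule bimult_closed[OF ps(1) a])
      have e: "bimult Q ps b = c \<otimes> bimult Q ps a" using f[of ps] ps c(2) ia by simp
      have b: "b = ?y \<oplus> c \<otimes> a" using cc a Cons.prems(2) by (simp add: Q.minus_eq Q.a_assoc Q.l_neg)
      have yc: "bimult Q ps ?y \<in> carrier Q" using bimult_closed[OF ps(1)] cc a Cons.prems(2) I.Icarr by simp
      have "bimult Q ps b = bimult Q ps ?y \<oplus> c \<otimes> bimult Q ps a"
        by (subst (1) b) (use bimult_add[OF ps(1), of ?y "c \<otimes> a"] bimult_central[OF ps(1) a c(1)]
          cc a Cons.prems(2) in simp)
      then show "bimult Q ps ?y = \<zero>"
        using e yc Q.m_closed[OF cc I.Icarr[OF ia]] by (simp add: Q.add.r_cancel_one')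
    qed
    moreover have "b = c \<otimes> a \<oplus> ?y"
      using cc a Cons.prems(2) by (simp add: Q.minus_eq Q.a_lcomm Q.r_neg)
    ultimately show ?thesis using c(1) by auto
  qed
qed

text \<open>
  Multiplication by a non-zero central element is a bijection of \<open>I\<close>. The inverse bijection is a
  bimodule endomorphism and hence multiplication by a central element, which is the inverse.
\<close>

lemma center_field: "field (center_algebra Q)"
proof (rule C.cring_fieldI2)
  show "\<zero>\<^bsub>center_algebra Q\<^esub> \<noteq> \<one>\<^bsub>center_algebra Q\<^esub>" using one_nonzero by auto
  fix c assume c: "c \<in> C" and "c \<noteq> \<zero>\<^bsub>center_algebra Q\<^esub>"
  then have c0: "c \<noteq> \<zero>" by simp
  note cc = CD(1)[OF c]
  have comm: "q \<otimes> (c \<otimes> x) = c \<otimes> (q \<otimes> x)" if "q \<in> carrier Q" "x \<in> carrier Q" for q x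
    using that cc CD(2)[OF c that(1)] by (simp add: Q.m_assoc[symmetric])
  have inj0: "x = \<zero>" if x: "x \<in> carrier Q" "c \<otimes> x = \<zero>" for x
  proof (rule ccontr)
    assume x0: "x \<noteq> \<zero>"
    have "c \<otimes> u = \<zero>" if ui: "u \<in> I" for u
    proof -
      obtain ps where ps: "op_list ps" "bimult Q ps x = u" using reach_monolith[OF x(1) x0 ui] by blast
      have "c \<otimes> u = bimult Q ps \<zero>" using bimult_central[OF ps(1) x(1) c] ps(2) x(2) by simp
      also have "\<dots> = bimult Q ps (\<zero> \<otimes> \<zero>)" by simp
      also have "\<dots> = \<zero>"
        using bimult_central[OF ps(1), of "\<zero>" "\<zero>"] C.zero_closed bimult_closed[OF ps(1), of "\<zero>"] I.Icarr by simp
      finally show ?thesis .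
    qed
    then show False using faithful_left[OF cc] c0 by blast
  qed
  have inj: "x = y" if "x \<in> carrier Q" "y \<in> carrier Q" "c \<otimes> x = c \<otimes> y" for x y
  proof -
    have "c \<otimes> (x \<ominus> y) = \<zero>" using that cc by (simp add: Q.minus_eq Q.r_distr Q.r_minus Q.r_neg)
    then have "x \<ominus> y = \<zero>" using inj0 that by simp
    then show ?thesis using that Q.minus_eq_zero_iff by simp
  qed
  obtain u where u: "u \<in> I" "u \<noteq> \<zero>" using exists_nonzero by blast
  have cu: "c \<otimes> u \<noteq> \<zero>" using inj0 u I.Icarr by blast
  have surj: "\<exists>y\<in>I. c \<otimes> y = x" if x: "x \<in> I" for x
  proof -
    obtain ps where ps: "op_list ps" "bimult Q ps (c \<otimes> u) = x"
      using reach_monolith[OF _ cu x] u cc I.Icarr by auto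
    then show ?thesis using bimult_central[OF ps(1) _ c, of u] bimult_closed[OF ps(1)] u I.Icarr by auto
  qed
  define f where "f x = (SOME y. y \<in> I \<and> c \<otimes> y = x)" for x
  have f: "f x \<in> I \<and> c \<otimes> f x = x" if "x \<in> I" for x
    unfolding f_def by (rule someI_ex) (use surj[OF that] in blast)
  have "\<exists>d\<in>C. \<forall>x\<in>I. f x = d \<otimes> x"
  proof (rule central)
    show "f x \<in> I" if "x \<in> I" for x using f that by blast
    fix x assume x: "x \<in> I"
    have fc: "f x \<in> carrier Q" using f[OF x] I.Icarr by blast
    fix q assume q: "q \<in> carrier Q"
    have c1: "q \<otimes> x \<in> I" "x \<otimes> q \<in> I" using x q by (auto intro: I.I_l_closed I.I_r_closed)
    show "f (q \<otimes> x) = q \<otimes> f x"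
    proof (rule inj)
      show "f (q \<otimes> x) \<in> carrier Q" "q \<otimes> f x \<in> carrier Q" using f[OF c1(1)] fc q by simp_all
      show "c \<otimes> f (q \<otimes> x) = c \<otimes> (q \<otimes> f x)"
        using f[OF c1(1)] f[OF x] comm[OF q fc] by simp
    qed
    show "f (x \<otimes> q) = f x \<otimes> q"
    proof (rule inj)
      show "f (x \<otimes> q) \<in> carrier Q" "f x \<otimes> q \<in> carrier Q" using f[OF c1(2)] fc q by simp_all
      show "c \<otimes> f (x \<otimes> q) = c \<otimes> (f x \<otimes> q)"
        using f[OF c1(2)] f[OF x] fc q cc by (simp add: Q.m_assoc[symmetric])
    qed
  next
    fix x y assume xy: "x \<in> I" "y \<in> I"
    have "x \<oplus> y \<in> I" using xy by simp
    note fxy = f[OF this] and fx = f[OF xy(1)] and fy = f[OF xy(2)]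
    show "f (x \<oplus> y) = f x \<oplus> f y"
    proof (rule inj)
      show "f (x \<oplus> y) \<in> carrier Q" "f x \<oplus> f y \<in> carrier Q" using fxy fx fy by simp_all
      show "c \<otimes> f (x \<oplus> y) = c \<otimes> (f x \<oplus> f y)"
        using fxy fx fy cc by (simp add: Q.r_distr)
    qed
  qed
  then obtain d where d: "d \<in> C" "\<forall>x\<in>I. f x = d \<otimes> x" by blast
  note dc = CD(1)[OF d(1)]
  have "c \<otimes> d \<ominus> \<one> = \<zero>"
  proof (rule faithful_left)
    show "c \<otimes> d \<ominus> \<one> \<in> carrier Q" using cc dc by simp
    fix x assume x: "x \<in> I"
    then have "c \<otimes> d \<otimes> x = x" using f[OF x] d(2) cc dc I.Icarr by (simp add: Q.m_assoc)
    then show "(c \<otimes> d \<ominus> \<one>) \<otimes> x = \<zero>"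
      using cc dc I.Icarr[OF x] by (simp add: Q.minus_eq Q.l_distr Q.l_minus Q.r_neg)
  qed
  then have "c \<otimes> d = \<one>" using cc dc by (simp add: Q.minus_eq_zero_iff)
  then show "\<exists>d\<in>C. c \<otimes>\<^bsub>center_algebra Q\<^esub> d = \<one>\<^bsub>center_algebra Q\<^esub>" using d(1) by auto
qed

end

section \<open>Extraction of central coefficients\<close>

context closed_monolith
begin

lemma comb_closed:
  assumes "ring T" "\<sigma> \<in> ring_hom Q T" "set l \<subseteq> carrier Q \<times> carrier T"
  shows "comb T \<sigma> l \<in> carrier T"
proof -
  interpret T: ring T by fact
  show ?thesis using assms(3)
    by (induction l) (auto simp: ring_hom_closed[OF assms(2)])
qed

lemma comb_append:
  assumes "ring T" "\<sigma> \<in> ring_hom Q T" "set l \<subseteq> carrier Q \<times> carrier T" "set l' \<subseteq> carrier Q \<times> carrier T"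
  shows "comb T \<sigma> (l @ l') = comb T \<sigma> l \<oplus>\<^bsub>T\<^esub> comb T \<sigma> l'"
proof -
  interpret T: ring T by fact
  show ?thesis using assms(3,4)
    by (induction l) (auto simp: ring_hom_closed[OF assms(2)] T.a_assoc comb_closed[OF assms(1,2)])
qed

text \<open>
  The coefficients commute with \<open>\<sigma>\<close>, so an operator can be applied to the first components by
  multiplying the whole sum from both sides with elements of \<open>\<sigma> I\<close>. This is why \<open>M\<close> needs to be
  stable under such products only.
\<close>

lemma comb_bimult:
  assumes T: "ring T" and \<sigma>: "\<sigma> \<in> ring_hom Q T"
    and l: "set l \<subseteq> carrier Q \<times> R" and R: "R \<subseteq> carrier T"
    and comm: "\<And>q r. \<lbrakk>q \<in> carrier Q; r \<in> R\<rbrakk> \<Longrightarrow> \<sigma> q \<otimes>\<^bsub>T\<^esub> r = r \<otimes>\<^bsub>T\<^esub> \<sigma> q"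
    and M0: "\<zero>\<^bsub>T\<^esub> \<in> M" and Madd: "\<And>x y. \<lbrakk>x \<in> M; y \<in> M\<rbrakk> \<Longrightarrow> x \<oplus>\<^bsub>T\<^esub> y \<in> M"
    and Mmult: "\<And>u v y. \<lbrakk>u \<in> I; v \<in> I; y \<in> M\<rbrakk> \<Longrightarrow> \<sigma> u \<otimes>\<^bsub>T\<^esub> y \<otimes>\<^bsub>T\<^esub> \<sigma> v \<in> M"
    and ps: "op_list ps" and x: "comb T \<sigma> l \<in> M"
  shows "comb T \<sigma> (map (\<lambda>(a, r). (bimult Q ps a, r)) l) \<in> M"
proof -
  interpret T: ring T by fact
  note h = ring_hom_closed[OF \<sigma>] ring_hom_add[OF \<sigma>] ring_hom_mult[OF \<sigma>]
  have h0: "\<sigma> \<zero> = \<zero>\<^bsub>T\<^esub>" by (rule ring_hom_zero[OF \<sigma> Q.ring_axioms T])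
  have step: "comb T \<sigma> (map (\<lambda>(a, r). (bimult Q ((u, v) # ps) a, r)) l) =
      \<sigma> u \<otimes>\<^bsub>T\<^esub> comb T \<sigma> l \<otimes>\<^bsub>T\<^esub> \<sigma> v \<oplus>\<^bsub>T\<^esub> comb T \<sigma> (map (\<lambda>(a, r). (bimult Q ps a, r)) l)"
    if uv: "u \<in> I" "v \<in> I" and ps: "op_list ps" for u v ps
    using l
  proof (induction l)
    case (Cons p l)
    obtain a r where p: "p = (a, r)" by (cases p)
    have c: "a \<in> carrier Q" "r \<in> R" "r \<in> carrier T" "u \<in> carrier Q" "v \<in> carrier Q" "bimult Q ps a \<in> carrier Q"
      using Cons.prems p R uv bimult_closed[OF ps] I.Icarr by auto
    have lc: "set l \<subseteq> carrier Q \<times> carrier T" "set (map (\<lambda>(a, r). (bimult Q ps a, r)) l) \<subseteq> carrier Q \<times> carrier T"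
      using Cons.prems R bimult_closed[OF ps] I.Icarr by auto
    note cc = comb_closed[OF T \<sigma> lc(1)] comb_closed[OF T \<sigma> lc(2)]
    have e: "\<sigma> (u \<otimes> a \<otimes> v) \<otimes>\<^bsub>T\<^esub> r = \<sigma> u \<otimes>\<^bsub>T\<^esub> (\<sigma> a \<otimes>\<^bsub>T\<^esub> r) \<otimes>\<^bsub>T\<^esub> \<sigma> v"
      using c h comm[OF c(5,2)] by (simp add: T.m_assoc)
    have "comb T \<sigma> (map (\<lambda>(a, r). (bimult Q ((u, v) # ps) a, r)) (p # l)) =
      (\<sigma> (u \<otimes> a \<otimes> v) \<oplus>\<^bsub>T\<^esub> \<sigma> (bimult Q ps a)) \<otimes>\<^bsub>T\<^esub> r \<oplus>\<^bsub>T\<^esub>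
        comb T \<sigma> (map (\<lambda>(a, r). (bimult Q ((u, v) # ps) a, r)) l)"
      using p c h(2) by simp
    also have "comb T \<sigma> (map (\<lambda>(a, r). (bimult Q ((u, v) # ps) a, r)) l) =
      \<sigma> u \<otimes>\<^bsub>T\<^esub> comb T \<sigma> l \<otimes>\<^bsub>T\<^esub> \<sigma> v \<oplus>\<^bsub>T\<^esub> comb T \<sigma> (map (\<lambda>(a, r). (bimult Q ps a, r)) l)"
      using Cons by simp
    finally show ?case
      using p c h(1) cc e by (simp add: T.l_distr T.r_distr T.a_ac)
  qed (use uv h(1) I.Icarr in simp)
  show ?thesis using ps
  proof (induction ps)
    case Nil
    have "comb T \<sigma> (map (\<lambda>(a, r). (bimult Q [] a, r)) l) = \<zero>\<^bsub>T\<^esub>"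
      using l R by (induction l) (auto simp: h0)
    then show ?case using M0 by simp
  next
    case (Cons p ps)
    obtain u v where p: "p = (u, v)" by (cases p)
    have uv: "u \<in> I" "v \<in> I" "op_list ps" using Cons.prems p by auto
    show ?case unfolding p step[OF uv] using Madd[OF Mmult[OF uv(1,2) x] Cons.IH[OF uv(3)]] .
  qed
qed

text \<open>
  A term whose first component lies in the span of the others can be absorbed by them, since the
  central coefficients can be moved to the second components.
\<close>

lemma comb_merge:
  assumes T: "ring T" and \<sigma>: "\<sigma> \<in> ring_hom Q T"
    and R: "R \<subseteq> carrier T" and Radd: "\<And>x y. \<lbrakk>x \<in> R; y \<in> R\<rbrakk> \<Longrightarrow> x \<oplus>\<^bsub>T\<^esub> y \<in> R"
    and Rmult: "\<And>c r. \<lbrakk>c \<in> C; r \<in> R\<rbrakk> \<Longrightarrow> \<sigma> c \<otimes>\<^bsub>T\<^esub> r \<in> R"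
    and r: "r \<in> R"
  shows "\<lbrakk>a \<in> center_span Q (map fst l); set l \<subseteq> carrier Q \<times> R\<rbrakk> \<Longrightarrow>
    \<exists>l'. length l' = length l \<and> set l' \<subseteq> carrier Q \<times> R \<and> comb T \<sigma> l' = \<sigma> a \<otimes>\<^bsub>T\<^esub> r \<oplus>\<^bsub>T\<^esub> comb T \<sigma> l"
proof (induction l arbitrary: a)
  case Nil
  interpret T: ring T by fact
  have "\<sigma> \<zero> = \<zero>\<^bsub>T\<^esub>" by (rule ring_hom_zero[OF \<sigma> Q.ring_axioms T])
  then show ?case using Nil r R by auto
next
  case (Cons p l)
  interpret T: ring T by fact
  note h = ring_hom_closed[OF \<sigma>] ring_hom_add[OF \<sigma>] ring_hom_mult[OF \<sigma>]
  obtain b s where p: "p = (b, s)" by (cases p)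
  have lR: "set l \<subseteq> carrier Q \<times> R" and b: "b \<in> carrier Q" and s: "s \<in> R" using Cons.prems(2) p by auto
  obtain c y where c: "c \<in> C" and y: "y \<in> center_span Q (map fst l)" and a: "a = c \<otimes> b \<oplus> y"
    using Cons.prems(1) p by auto
  have "center_span Q as \<subseteq> carrier Q" if "set as \<subseteq> carrier Q" for as
    using that by (induction as) (auto simp: CD(1))
  moreover have "set (map fst l) \<subseteq> carrier Q" using lR by auto
  ultimately have yc: "y \<in> carrier Q" using y by blast
  note cc = CD(1)[OF c]
  obtain l' where l': "length l' = length l" "set l' \<subseteq> carrier Q \<times> R" "comb T \<sigma> l' = \<sigma> y \<otimes>\<^bsub>T\<^esub> r \<oplus>\<^bsub>T\<^esub> comb T \<sigma> l"
    using Cons.IH[OF y lR] by blast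
  have rT: "r \<in> carrier T" "s \<in> carrier T" using r s R by auto
  have lc: "comb T \<sigma> l \<in> carrier T" by (rule comb_closed[OF T \<sigma>]) (use lR R in auto)
  have "\<sigma> (c \<otimes> b) \<otimes>\<^bsub>T\<^esub> r = \<sigma> b \<otimes>\<^bsub>T\<^esub> (\<sigma> c \<otimes>\<^bsub>T\<^esub> r)"
    using CD(2)[OF c b] h b cc rT by (simp add: T.m_assoc)
  then have "comb T \<sigma> ((b, s \<oplus>\<^bsub>T\<^esub> \<sigma> c \<otimes>\<^bsub>T\<^esub> r) # l') = \<sigma> a \<otimes>\<^bsub>T\<^esub> r \<oplus>\<^bsub>T\<^esub> comb T \<sigma> (p # l)"
    unfolding comb.simps p l'(3) a using h b cc yc rT lc
    by (simp add: T.l_distr T.r_distr T.a_ac)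
  then show ?case using l' b Radd[OF s Rmult[OF c r]]
    by (intro exI[of _ "(b, s \<oplus>\<^bsub>T\<^esub> \<sigma> c \<otimes>\<^bsub>T\<^esub> r) # l'"]) simp
qed

text \<open>
  Induction on the number of terms. If the first term is superfluous, there is a shorter
  representation. Otherwise Martindale's theorem provides an operator that kills all first
  components except that of the first term. This leaves \<open>\<sigma> b r\<close> in \<open>M\<close> with \<open>b \<noteq> 0\<close>, and all of \<open>I\<close> is
  reached from \<open>b\<close>.
\<close>

lemma extract_coefficient:
  assumes T: "ring T" and \<sigma>: "\<sigma> \<in> ring_hom Q T"
    and R: "R \<subseteq> carrier T" and Radd: "\<And>x y. \<lbrakk>x \<in> R; y \<in> R\<rbrakk> \<Longrightarrow> x \<oplus>\<^bsub>T\<^esub> y \<in> R"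
    and Rmult: "\<And>c r. \<lbrakk>c \<in> C; r \<in> R\<rbrakk> \<Longrightarrow> \<sigma> c \<otimes>\<^bsub>T\<^esub> r \<in> R"
    and comm: "\<And>q r. \<lbrakk>q \<in> carrier Q; r \<in> R\<rbrakk> \<Longrightarrow> \<sigma> q \<otimes>\<^bsub>T\<^esub> r = r \<otimes>\<^bsub>T\<^esub> \<sigma> q"
    and M0: "\<zero>\<^bsub>T\<^esub> \<in> M" and Madd: "\<And>x y. \<lbrakk>x \<in> M; y \<in> M\<rbrakk> \<Longrightarrow> x \<oplus>\<^bsub>T\<^esub> y \<in> M"
    and Mmult: "\<And>u v y. \<lbrakk>u \<in> I; v \<in> I; y \<in> M\<rbrakk> \<Longrightarrow> \<sigma> u \<otimes>\<^bsub>T\<^esub> y \<otimes>\<^bsub>T\<^esub> \<sigma> v \<in> M"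
    and l: "set l \<subseteq> carrier Q \<times> R" "comb T \<sigma> l \<in> M" "comb T \<sigma> l \<noteq> \<zero>\<^bsub>T\<^esub>"
  shows "\<exists>w\<in>R. w \<noteq> \<zero>\<^bsub>T\<^esub> \<and> (\<forall>u\<in>I. \<sigma> u \<otimes>\<^bsub>T\<^esub> w \<in> M)"
  using l
proof (induction "length l" arbitrary: l rule: less_induct)
  case less
  interpret T: ring T by fact
  note h = ring_hom_closed[OF \<sigma>] ring_hom_add[OF \<sigma>] ring_hom_mult[OF \<sigma>]
  have h0: "\<sigma> \<zero> = \<zero>\<^bsub>T\<^esub>" by (rule ring_hom_zero[OF \<sigma> Q.ring_axioms T])
  obtain a r l' where l': "l = (a, r) # l'"
    using less.prems(3) by (cases l) auto
  have a: "a \<in> carrier Q" and r: "r \<in> R" and lR: "set l' \<subseteq> carrier Q \<times> R" using less.prems(1) l' by auto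
  have rT: "r \<in> carrier T" using r R by blast
  have lc: "comb T \<sigma> l' \<in> carrier T" by (rule comb_closed[OF T \<sigma>]) (use lR R in auto)
  consider "r = \<zero>\<^bsub>T\<^esub>" | "a \<in> center_span Q (map fst l')" | "r \<noteq> \<zero>\<^bsub>T\<^esub>" "a \<notin> center_span Q (map fst l')"
    by blast
  then show ?case
  proof cases
    case 1
    then have "comb T \<sigma> l = comb T \<sigma> l'" using l' h(1) a lc by simp
    then show ?thesis using less.hyps[of l'] l' lR less.prems by simp
  next
    case 2
    obtain l'' where "length l'' = length l'" "set l'' \<subseteq> carrier Q \<times> R" "comb T \<sigma> l'' = comb T \<sigma> l"
      using comb_merge[OF T \<sigma> R Radd Rmult r 2 lR] l' by auto
    then show ?thesis using less.hyps[of l''] l' less.prems by simp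
  next
    case 3
    have "set (map fst l') \<subseteq> carrier Q" using lR by auto
    from martindale[OF this a] 3(2) obtain ps where ps: "op_list ps"
        "\<forall>a\<in>set (map fst l'). bimult Q ps a = \<zero>" "bimult Q ps a \<noteq> \<zero>"
      by blast
    let ?b = "bimult Q ps a"
    have b: "?b \<in> carrier Q" using bimult_closed[OF ps(1) a] I.Icarr by blast
    have "comb T \<sigma> (map (\<lambda>(a, r). (bimult Q ps a, r)) l') = \<zero>\<^bsub>T\<^esub>"
      using lR ps(2) R by (induction l') (auto simp: h0)
    then have "comb T \<sigma> (map (\<lambda>(a, r). (bimult Q ps a, r)) l) = \<sigma> ?b \<otimes>\<^bsub>T\<^esub> r"
      using l' h(1)[OF b] rT by simp
    then have br: "\<sigma> ?b \<otimes>\<^bsub>T\<^esub> r \<in> M"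
      using comb_bimult[OF T \<sigma> less.prems(1) R comm M0 Madd Mmult ps(1) less.prems(2)] by simp
    have "\<sigma> u \<otimes>\<^bsub>T\<^esub> r \<in> M" if u: "u \<in> I" for u
    proof -
      obtain qs where qs: "op_list qs" "bimult Q qs ?b = u" using reach_monolith[OF b ps(3) u] by blast
      have s: "set [(?b, r)] \<subseteq> carrier Q \<times> R" using b r by simp
      have "comb T \<sigma> [(?b, r)] \<in> M" using br h(1)[OF b] rT by simp
      from comb_bimult[OF T \<sigma> s R comm M0 Madd Mmult qs(1) this] show ?thesis
        using qs(2) h(1)[OF I.Icarr[OF u]] rT by simp
    qed
    then show ?thesis using r 3(1) by blast
  qed
qed

text \<open>
  The coefficients have to admit multiplication by the centre, so \<open>S\<close> is enlarged to all
  combinations of its elements with central coefficients.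
\<close>

lemma extract_central:
  assumes T: "ring T" and \<sigma>: "\<sigma> \<in> ring_hom Q T" and S: "S \<subseteq> carrier T"
    and comm: "\<And>q s. \<lbrakk>q \<in> carrier Q; s \<in> S\<rbrakk> \<Longrightarrow> \<sigma> q \<otimes>\<^bsub>T\<^esub> s = s \<otimes>\<^bsub>T\<^esub> \<sigma> q"
    and M0: "\<zero>\<^bsub>T\<^esub> \<in> M" and Madd: "\<And>x y. \<lbrakk>x \<in> M; y \<in> M\<rbrakk> \<Longrightarrow> x \<oplus>\<^bsub>T\<^esub> y \<in> M"
    and Mmult: "\<And>u v y. \<lbrakk>u \<in> I; v \<in> I; y \<in> M\<rbrakk> \<Longrightarrow> \<sigma> u \<otimes>\<^bsub>T\<^esub> y \<otimes>\<^bsub>T\<^esub> \<sigma> v \<in> M"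
    and l: "set l \<subseteq> carrier Q \<times> S" "comb T \<sigma> l \<in> M" "comb T \<sigma> l \<noteq> \<zero>\<^bsub>T\<^esub>"
  shows "\<exists>l'. set l' \<subseteq> C \<times> S \<and> comb T \<sigma> l' \<noteq> \<zero>\<^bsub>T\<^esub> \<and> (\<forall>u\<in>I. \<sigma> u \<otimes>\<^bsub>T\<^esub> comb T \<sigma> l' \<in> M)"
proof -
  interpret T: ring T by fact
  note h = ring_hom_closed[OF \<sigma>] ring_hom_add[OF \<sigma>] ring_hom_mult[OF \<sigma>]
  let ?R = "{comb T \<sigma> l | l. set l \<subseteq> C \<times> S}"
  have sub: "set l \<subseteq> carrier Q \<times> carrier T" if "set l \<subseteq> C \<times> S" for l
    using that CD(1) S by blast
  have R: "?R \<subseteq> carrier T" using comb_closed[OF T \<sigma> sub] by blast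
  have Radd: "x \<oplus>\<^bsub>T\<^esub> y \<in> ?R" if xy: "x \<in> ?R" "y \<in> ?R" for x y
  proof -
    obtain l l' where s: "set l \<subseteq> C \<times> S" "set l' \<subseteq> C \<times> S" and e: "x = comb T \<sigma> l" "y = comb T \<sigma> l'"
      using xy by blast
    have "set (l @ l') \<subseteq> C \<times> S" using s by simp
    moreover have "x \<oplus>\<^bsub>T\<^esub> y = comb T \<sigma> (l @ l')"
      unfolding e using comb_append[OF T \<sigma> sub[OF s(1)] sub[OF s(2)]] by simp
    ultimately show ?thesis by blast
  qed
  have Rmult: "\<sigma> c \<otimes>\<^bsub>T\<^esub> x \<in> ?R" if c: "c \<in> C" and x: "x \<in> ?R" for c x
  proof -
    obtain l where s: "set l \<subseteq> C \<times> S" and e: "x = comb T \<sigma> l" using x by blast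
    have "set (map (\<lambda>(a, r). (c \<otimes> a, r)) l) \<subseteq> C \<times> S"
      using s center_mult_closed[OF alg c] by auto
    moreover have "\<sigma> c \<otimes>\<^bsub>T\<^esub> comb T \<sigma> l = comb T \<sigma> (map (\<lambda>(a, r). (c \<otimes> a, r)) l)"
      using s
    proof (induction l)
      case (Cons p l)
      obtain a r where p: "p = (a, r)" by (cases p)
      have "a \<in> C" "r \<in> carrier T" "set l \<subseteq> C \<times> S" using Cons.prems p S by auto
      then show ?case using Cons.IH p h CD(1)[OF c] CD(1)[of a] comb_closed[OF T \<sigma> sub[of l]]
        by (simp add: T.r_distr T.m_assoc)
    qed (use h(1) CD(1)[OF c] in simp)
    ultimately show ?thesis unfolding e by blast
  qed
  have Rcomm: "\<sigma> q \<otimes>\<^bsub>T\<^esub> x = x \<otimes>\<^bsub>T\<^esub> \<sigma> q" if q: "q \<in> carrier Q" and x: "x \<in> ?R" for q x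
  proof -
    obtain l where s: "set l \<subseteq> C \<times> S" and e: "x = comb T \<sigma> l" using x by blast
    show ?thesis unfolding e using s
    proof (induction l)
      case (Cons p l)
      obtain a r where p: "p = (a, r)" by (cases p)
      have ar: "a \<in> C" "r \<in> S" "r \<in> carrier T" "set l \<subseteq> C \<times> S" using Cons.prems p S by auto
      note ac = CD(1)[OF ar(1)]
      have "\<sigma> q \<otimes>\<^bsub>T\<^esub> (\<sigma> a \<otimes>\<^bsub>T\<^esub> r) = \<sigma> (q \<otimes> a) \<otimes>\<^bsub>T\<^esub> r" using h q ac ar by (simp add: T.m_assoc)
      also have "\<dots> = \<sigma> a \<otimes>\<^bsub>T\<^esub> (\<sigma> q \<otimes>\<^bsub>T\<^esub> r)"
        using h q ac ar CD(2)[OF ar(1) q, symmetric] by (simp add: T.m_assoc)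
      also have "\<dots> = \<sigma> a \<otimes>\<^bsub>T\<^esub> r \<otimes>\<^bsub>T\<^esub> \<sigma> q" using comm[OF q ar(2)] h q ac ar by (simp add: T.m_assoc)
      finally show ?case using Cons.IH ar p h(1)[OF q] h(1)[OF ac] comb_closed[OF T \<sigma> sub[OF ar(4)]]
        by (simp add: T.r_distr T.l_distr)
    qed (use h(1)[OF q] in simp)
  qed
  have one: "\<one> \<in> C" using C.one_closed by simp
  have "S \<subseteq> ?R"
  proof
    fix s assume s: "s \<in> S"
    have "s = comb T \<sigma> [(\<one>, s)]" using s S ring_hom_one[OF \<sigma>] by (simp add: subset_iff)
    moreover have "set [(\<one>, s)] \<subseteq> C \<times> S" using one s by simp
    ultimately show "s \<in> ?R" by blast
  qed
  then have "set l \<subseteq> carrier Q \<times> ?R" using l(1) by blast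
  from extract_coefficient[OF T \<sigma> R Radd Rmult Rcomm M0 Madd Mmult this l(2,3)]
  show ?thesis by blast
qed

end

section \<open>Ideals of a tensor product and the tensor product of the centres\<close>

lemma center_inclusion_hom: "(\<lambda>x. x) \<in> algebra_hom F (center_algebra Q) Q"
  by (rule algebra_homI) (simp_all add: center_algebraD(1))

text \<open>
  Here \<open>Q\<close> is viewed as a vector space over its centre, which is a field. Linearity over \<open>F\<close> follows
  since \<open>c x = (c 1) x\<close> with \<open>c 1\<close> central.
\<close>

lemma (in closed_monolith) center_functional:
  assumes u: "u \<in> carrier Q" "u \<noteq> \<zero>"
  shows "\<exists>\<phi>\<in>linear_maps F Q (center_algebra Q).
    (\<forall>c\<in>C. \<forall>x\<in>carrier Q. \<phi> (c \<otimes> x) = c \<otimes> \<phi> x) \<and> \<phi> u = \<one>"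
proof -
  let ?V = "\<lparr>carrier = carrier Q, mult = mult Q, one = one Q, zero = zero Q, add = add Q, smult = mult Q\<rparr>"
  have ab: "abelian_group ?V"
  proof (rule abelian_groupI)
    show "\<exists>y\<in>carrier ?V. y \<oplus>\<^bsub>?V\<^esub> x = \<zero>\<^bsub>?V\<^esub>" if "x \<in> carrier ?V" for x
      using that Q.l_neg by (intro bexI[of _ "\<ominus> x"]) simp_all
  qed (simp_all add: Q.a_ac)
  have "module (center_algebra Q) ?V"
    by (rule moduleI[OF C.cring_axioms ab]) (simp_all add: CD(1) Q.l_distr Q.r_distr Q.m_assoc)
  then obtain \<phi> where \<phi>: "\<phi> \<in> carrier ?V \<rightarrow> C"
    "\<And>x y. \<lbrakk>x \<in> carrier ?V; y \<in> carrier ?V\<rbrakk> \<Longrightarrow> \<phi> (x \<oplus>\<^bsub>?V\<^esub> y) = \<phi> x \<oplus>\<^bsub>center_algebra Q\<^esub> \<phi> y"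
    "\<And>c x. \<lbrakk>c \<in> C; x \<in> carrier ?V\<rbrakk> \<Longrightarrow> \<phi> (c \<odot>\<^bsub>?V\<^esub> x) = c \<otimes>\<^bsub>center_algebra Q\<^esub> \<phi> x"
    "\<phi> u = \<one>\<^bsub>center_algebra Q\<^esub>"
    by (rule exists_functional[OF center_field, of ?V u]) (use u in simp_all)
  have pc: "\<phi> x \<in> C" if "x \<in> carrier Q" for x using \<phi>(1) that by auto
  have "\<phi> \<in> linear_maps F Q (center_algebra Q)"
  proof (rule linear_mapsI)
    fix c x assume c: "c \<in> carrier F" and x: "x \<in> carrier Q"
    have "\<one> \<in> C" using C.one_closed by simp
    then have cC: "c \<odot> \<one> \<in> C"
      using QM.submoduleE(4)[OF center_is_submodule[OF alg] c] by simp
    have e: "(c \<odot> \<one>) \<otimes> y = c \<odot> y" if "y \<in> carrier Q" for y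
      using assoc_algebraD(5)[OF alg c _ that] that by simp
    show "\<phi> (c \<odot> x) = c \<odot>\<^bsub>center_algebra Q\<^esub> \<phi> x"
      using \<phi>(3)[OF cC, of x] e[OF x] e[OF CD(1)[OF pc[OF x]]] x by simp
  qed (use \<phi>(2) pc in simp_all)
  then show ?thesis using \<phi>(3,4) by (intro bexI[of _ \<phi>]) simp_all
qed

locale monolith_pair = X: closed_monolith F Q I + Y: closed_monolith F P L
  for F :: "('f, 'm) ring_scheme" and Q :: "('f, 'q) module" and I :: "'q set"
    and P :: "('f, 'p) module" and L :: "'p set"
begin

abbreviation "CQ \<equiv> center_algebra Q"
abbreviation "CP \<equiv> center_algebra P"
abbreviation "TQP \<equiv> tensor_algebra F Q P"
abbreviation "E \<equiv> tensor_algebra F CQ CP"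

sublocale T: algebra_pair F Q P by (rule algebra_pair.intro[OF X.alg Y.alg])
sublocale E: algebra_pair F CQ CP
  by (rule algebra_pair.intro[OF assoc_algebra_center[OF X.alg] assoc_algebra_center[OF Y.alg]])

notation T.pure (infixl "\<otimes>\<^sub>t" 75)

abbreviation "\<sigma> q \<equiv> q \<otimes>\<^sub>t \<one>\<^bsub>P\<^esub>"
abbreviation "\<rho> p \<equiv> \<one>\<^bsub>Q\<^esub> \<otimes>\<^sub>t p"

definition incl where "incl = tensor_map F CQ CP Q P (\<lambda>x. x) (\<lambda>x. x)"

lemma incl_hom: "incl \<in> algebra_hom F E TQP"
  unfolding incl_def
  by (rule tensor_map_hom[OF E.A_alg E.B_alg T.A_alg T.B_alg center_inclusion_hom center_inclusion_hom])

lemmas inclD = algebra_homD[OF incl_hom]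

lemma incl_pure: "\<lbrakk>c \<in> X.C; d \<in> Y.C\<rbrakk> \<Longrightarrow> incl (pure_tensor F CQ CP c d) = c \<otimes>\<^sub>t d"
  unfolding incl_def
  using tensor_map(2)[OF E.A_alg E.B_alg T.A_alg T.B_alg
    algebra_hom_linear[OF center_inclusion_hom] algebra_hom_linear[OF center_inclusion_hom]] by blast

lemma E_cring: "cring E"
  by (rule E.tensor_comm) (fact X.C.m_comm, fact Y.C.m_comm)

lemma E_nontrivial: "\<zero>\<^bsub>E\<^esub> \<noteq> \<one>\<^bsub>E\<^esub>"
  using E.pure_nonzero[of "\<one>\<^bsub>Q\<^esub>" "\<one>\<^bsub>P\<^esub>"] X.C.one_closed Y.C.one_closed X.one_nonzero Y.one_nonzero
  by (auto simp: E.tensor_one)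

lemma sigma_hom: "\<sigma> \<in> ring_hom Q TQP"
  by (rule ring_hom_memI) (simp_all add: T.pure_mult T.pure_add_left T.tensor_one)

lemma rho_hom: "\<rho> \<in> ring_hom P TQP"
  by (rule ring_hom_memI) (simp_all add: T.pure_mult T.pure_add_right T.tensor_one)

lemma sigma_rho:
  assumes "q \<in> carrier Q" "p \<in> carrier P"
  shows "\<sigma> q \<otimes>\<^bsub>TQP\<^esub> \<rho> p = q \<otimes>\<^sub>t p" "\<rho> p \<otimes>\<^bsub>TQP\<^esub> \<sigma> q = q \<otimes>\<^sub>t p"
  using assms by (simp_all add: T.pure_mult)

text \<open>
  Two extractions, one in each factor, replace a non-zero element of \<open>J\<close> by a non-zero \<open>e\<close> in the image
  of \<open>E\<close> with \<open>(I \<otimes> L) e\<close> inside \<open>J\<close>. Since \<open>I \<otimes> L\<close> is stable under \<open>E\<close>, the inverse of \<open>e\<close> can be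
  absorbed on its left. The subspace \<open>J\<close> is assumed to be stable only under the copies
  of \<open>I\<close> and \<open>L\<close>, because the statement is applied to the image of an ideal of a smaller algebra.
\<close>

lemma field_imp_contains:
  assumes E: "field E"
    and J: "submodule J F TQP"
    and Jl: "\<And>u y. \<lbrakk>u \<in> I; y \<in> J\<rbrakk> \<Longrightarrow> \<sigma> u \<otimes>\<^bsub>TQP\<^esub> y \<in> J" "\<And>v y. \<lbrakk>v \<in> L; y \<in> J\<rbrakk> \<Longrightarrow> \<rho> v \<otimes>\<^bsub>TQP\<^esub> y \<in> J"
    and Jr: "\<And>u y. \<lbrakk>u \<in> I; y \<in> J\<rbrakk> \<Longrightarrow> y \<otimes>\<^bsub>TQP\<^esub> \<sigma> u \<in> J" "\<And>v y. \<lbrakk>v \<in> L; y \<in> J\<rbrakk> \<Longrightarrow> y \<otimes>\<^bsub>TQP\<^esub> \<rho> v \<in> J"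
    and nz: "J \<noteq> {\<zero>\<^bsub>TQP\<^esub>}"
  shows "tensor_subspace F Q P I L \<subseteq> J"
proof -
  interpret EF: field E by (rule E)
  note JE = T.TM.submoduleE[OF J]
  have J0: "\<zero>\<^bsub>TQP\<^esub> \<in> J" by (rule submodule_zero[OF J])
  note sh = ring_hom_closed[OF sigma_hom] and rh = ring_hom_closed[OF rho_hom]
  have commute: "\<sigma> q \<otimes>\<^bsub>TQP\<^esub> \<rho> p = \<rho> p \<otimes>\<^bsub>TQP\<^esub> \<sigma> q" if "q \<in> carrier Q" "p \<in> carrier P" for q p
    using sigma_rho[OF that] by simp
  obtain x where x: "x \<in> J" "x \<noteq> \<zero>\<^bsub>TQP\<^esub>" using nz J0 by blast
  have xT: "x \<in> carrier TQP" using x JE(1) by blast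
  have S1: "\<rho> ` carrier P \<subseteq> carrier TQP" and S2: "\<sigma> ` X.C \<subseteq> carrier TQP"
    using rh sh X.CD(1) by blast+
  have "\<exists>l. set l \<subseteq> carrier Q \<times> \<rho> ` carrier P \<and> comb TQP \<sigma> l = x"
    using xT
  proof (induction x rule: T.tensor_induct)
    case (pure a b)
    then show ?case by (intro exI[of _ "[(a, \<rho> b)]"]) (simp add: sigma_rho)
  next
    case (add x y)
    then obtain l l' where l: "set l \<subseteq> carrier Q \<times> \<rho> ` carrier P" "comb TQP \<sigma> l = x"
      and l': "set l' \<subseteq> carrier Q \<times> \<rho> ` carrier P" "comb TQP \<sigma> l' = y" by blast
    have "comb TQP \<sigma> (l @ l') = x \<oplus>\<^bsub>TQP\<^esub> y"
      unfolding l(2)[symmetric] l'(2)[symmetric]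
      by (rule X.comb_append[OF T.T.ring_axioms sigma_hom]) (use l(1) l'(1) S1 in blast)+
    then show ?case using l(1) l'(1) by (intro exI[of _ "l @ l'"]) auto
  qed
  then obtain l where l: "set l \<subseteq> carrier Q \<times> \<rho> ` carrier P" "comb TQP \<sigma> l = x" by blast
  have c1: "\<sigma> q \<otimes>\<^bsub>TQP\<^esub> s = s \<otimes>\<^bsub>TQP\<^esub> \<sigma> q" if "q \<in> carrier Q" "s \<in> \<rho> ` carrier P" for q s
    using that commute by blast
  have m1: "\<sigma> u \<otimes>\<^bsub>TQP\<^esub> y \<otimes>\<^bsub>TQP\<^esub> \<sigma> v \<in> J" if "u \<in> I" "v \<in> I" "y \<in> J" for u v y
    using Jl(1) Jr(1) that by blast
  \<comment> \<open>The first extraction replaces \<open>x\<close> by an element of \<open>Z(Q) \<otimes> P\<close>.\<close>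
  obtain l1 where l1: "set l1 \<subseteq> X.C \<times> \<rho> ` carrier P" "comb TQP \<sigma> l1 \<noteq> \<zero>\<^bsub>TQP\<^esub>"
      "\<forall>u\<in>I. \<sigma> u \<otimes>\<^bsub>TQP\<^esub> comb TQP \<sigma> l1 \<in> J"
    using X.extract_central[OF T.T.ring_axioms sigma_hom S1 c1 J0 JE(5) m1 l(1)] l(2) x by blast
  have "\<exists>l'. set l' \<subseteq> carrier P \<times> \<sigma> ` X.C \<and> comb TQP \<rho> l' = comb TQP \<sigma> l1"
    using l1(1)
  proof (induction l1)
    case Nil
    show ?case by (intro exI[of _ "[]"]) simp
  next
    case (Cons q l)
    then obtain c p where q: "q = (c, \<rho> p)" "c \<in> X.C" "p \<in> carrier P" by auto
    obtain l' where "set l' \<subseteq> carrier P \<times> \<sigma> ` X.C" "comb TQP \<rho> l' = comb TQP \<sigma> l"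
      using Cons by auto
    then show ?case using q commute[OF X.CD(1)[OF q(2)] q(3)] by (intro exI[of _ "(p, \<sigma> c) # l'"]) simp
  qed
  then obtain l2 where l2: "set l2 \<subseteq> carrier P \<times> \<sigma> ` X.C" "comb TQP \<rho> l2 = comb TQP \<sigma> l1" by blast
  \<comment> \<open>For the second extraction, \<open>J\<close> is replaced by its transporter from \<open>I \<otimes> 1\<close>, which is
    stable under \<open>1 \<otimes> L\<close> as the two factors commute.\<close>
  let ?M = "{y \<in> carrier TQP. \<forall>u\<in>I. \<sigma> u \<otimes>\<^bsub>TQP\<^esub> y \<in> J}"
  have c2: "\<rho> p \<otimes>\<^bsub>TQP\<^esub> s = s \<otimes>\<^bsub>TQP\<^esub> \<rho> p" if "p \<in> carrier P" "s \<in> \<sigma> ` X.C" for p s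
    using that commute X.CD(1) by force
  have M0: "\<zero>\<^bsub>TQP\<^esub> \<in> ?M" using J0 sh X.I.Icarr by simp
  have Madd: "y \<oplus>\<^bsub>TQP\<^esub> z \<in> ?M" if "y \<in> ?M" "z \<in> ?M" for y z
    using that JE(5) sh X.I.Icarr by (simp add: T.T.r_distr)
  have m2: "\<rho> v \<otimes>\<^bsub>TQP\<^esub> y \<otimes>\<^bsub>TQP\<^esub> \<rho> v' \<in> ?M" if v: "v \<in> L" "v' \<in> L" and y: "y \<in> ?M" for v v' y
  proof -
    have c: "\<rho> v \<in> carrier TQP" "\<rho> v' \<in> carrier TQP" "y \<in> carrier TQP" using v y rh Y.I.Icarr by auto
    have "\<sigma> u \<otimes>\<^bsub>TQP\<^esub> (\<rho> v \<otimes>\<^bsub>TQP\<^esub> y \<otimes>\<^bsub>TQP\<^esub> \<rho> v') \<in> J" if u: "u \<in> I" for u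
    proof -
      have su: "\<sigma> u \<in> carrier TQP" using sh u X.I.Icarr by blast
      have "\<sigma> u \<otimes>\<^bsub>TQP\<^esub> (\<rho> v \<otimes>\<^bsub>TQP\<^esub> y \<otimes>\<^bsub>TQP\<^esub> \<rho> v') = (\<sigma> u \<otimes>\<^bsub>TQP\<^esub> \<rho> v) \<otimes>\<^bsub>TQP\<^esub> (y \<otimes>\<^bsub>TQP\<^esub> \<rho> v')"
        using c su by (simp add: T.T.m_assoc)
      also have "\<dots> = \<rho> v \<otimes>\<^bsub>TQP\<^esub> (\<sigma> u \<otimes>\<^bsub>TQP\<^esub> y) \<otimes>\<^bsub>TQP\<^esub> \<rho> v'"
        using c su commute[OF X.I.Icarr[OF u] Y.I.Icarr[OF v(1)]] by (simp add: T.T.m_assoc)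
      finally show ?thesis using y u v Jl(2) Jr(2) by simp
    qed
    then show ?thesis using c by simp
  qed
  have l2M: "comb TQP \<rho> l2 \<in> ?M" "comb TQP \<rho> l2 \<noteq> \<zero>\<^bsub>TQP\<^esub>"
  proof -
    have "set l1 \<subseteq> carrier Q \<times> carrier TQP" using l1(1) S1 X.CD(1) by blast
    from X.comb_closed[OF T.T.ring_axioms sigma_hom this]
    show "comb TQP \<rho> l2 \<in> ?M" "comb TQP \<rho> l2 \<noteq> \<zero>\<^bsub>TQP\<^esub>"
      unfolding l2(2) using l1(2,3) by blast+
  qed
  obtain l3 where l3: "set l3 \<subseteq> Y.C \<times> \<sigma> ` X.C" "comb TQP \<rho> l3 \<noteq> \<zero>\<^bsub>TQP\<^esub>"
      "\<forall>v\<in>L. \<rho> v \<otimes>\<^bsub>TQP\<^esub> comb TQP \<rho> l3 \<in> ?M"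
    using Y.extract_central[OF T.T.ring_axioms rho_hom S2 c2 M0 Madd m2 l2(1) l2M] by blast
  have "\<exists>e\<in>carrier E. incl e = comb TQP \<rho> l3"
    using l3(1)
  proof (induction l3)
    case Nil
    have "incl \<zero>\<^bsub>E\<^esub> = \<zero>\<^bsub>TQP\<^esub>"
      by (rule linear_maps_additive(1)[OF algebra_hom_linear[OF incl_hom] E.T.abelian_group_axioms T.T.abelian_group_axioms])
    then show ?case by (intro bexI[of _ "\<zero>\<^bsub>E\<^esub>"]) simp_all
  next
    case (Cons q l)
    then obtain c d where q: "q = (d, \<sigma> c)" "c \<in> X.C" "d \<in> Y.C" by auto
    obtain e where e: "e \<in> carrier E" "incl e = comb TQP \<rho> l" using Cons by auto
    have "incl (pure_tensor F CQ CP c d \<oplus>\<^bsub>E\<^esub> e) = comb TQP \<rho> (q # l)"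
      using inclD(3)[OF E.pure_closed[OF q(2,3)] e(1)] incl_pure[OF q(2,3)] e(2) q(1)
        sigma_rho(2)[OF X.CD(1)[OF q(2)] Y.CD(1)[OF q(3)]] by simp
    then show ?case using E.pure_closed[OF q(2,3)] e(1) by (intro bexI[of _ "pure_tensor F CQ CP c d \<oplus>\<^bsub>E\<^esub> e"]) simp_all
  qed
  then obtain e where e: "e \<in> carrier E" "incl e = comb TQP \<rho> l3" by blast
  have eT: "incl e \<in> carrier TQP" by (rule inclD(1)[OF e(1)])
  have uve: "(u \<otimes>\<^sub>t v) \<otimes>\<^bsub>TQP\<^esub> incl e \<in> J" if u: "u \<in> I" and v: "v \<in> L" for u v
  proof -
    have "\<sigma> u \<otimes>\<^bsub>TQP\<^esub> (\<rho> v \<otimes>\<^bsub>TQP\<^esub> incl e) \<in> J" using l3(3) u v e(2) by simp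
    then show ?thesis
      using sigma_rho(1)[OF X.I.Icarr[OF u] Y.I.Icarr[OF v]] sh[OF X.I.Icarr[OF u]] rh[OF Y.I.Icarr[OF v]] eT
      by (simp add: T.T.m_assoc[symmetric])
  qed
  have "incl \<zero>\<^bsub>E\<^esub> = \<zero>\<^bsub>TQP\<^esub>"
    by (rule linear_maps_additive(1)[OF algebra_hom_linear[OF incl_hom] E.T.abelian_group_axioms T.T.abelian_group_axioms])
  then have "e \<noteq> \<zero>\<^bsub>E\<^esub>" using e(2) l3(2) by auto
  then have eU: "e \<in> Units E" using e(1) EF.field_Units by blast
  have uvye: "(u \<otimes>\<^sub>t v) \<otimes>\<^bsub>TQP\<^esub> incl y \<otimes>\<^bsub>TQP\<^esub> incl e \<in> J"
    if u: "u \<in> I" and v: "v \<in> L" and y: "y \<in> carrier E" for u v y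
    using y
  proof (induction y rule: E.tensor_induct)
    case (pure c d)
    have cd: "c \<in> carrier Q" "d \<in> carrier P" using pure X.CD(1) Y.CD(1) by auto
    have "(u \<otimes>\<^sub>t v) \<otimes>\<^bsub>TQP\<^esub> incl (pure_tensor F CQ CP c d) = (u \<otimes>\<^bsub>Q\<^esub> c) \<otimes>\<^sub>t (v \<otimes>\<^bsub>P\<^esub> d)"
      using incl_pure[OF pure] T.pure_mult[OF X.I.Icarr[OF u] Y.I.Icarr[OF v] cd] by simp
    then show ?case using uve[OF X.I.I_r_closed[OF u cd(1)] Y.I.I_r_closed[OF v cd(2)]] by simp
  next
    case (add y z)
    have c: "u \<otimes>\<^sub>t v \<in> carrier TQP" "incl y \<in> carrier TQP" "incl z \<in> carrier TQP"
      using X.I.Icarr[OF u] Y.I.Icarr[OF v] inclD(1) add by simp_all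
    have "(u \<otimes>\<^sub>t v) \<otimes>\<^bsub>TQP\<^esub> incl (y \<oplus>\<^bsub>E\<^esub> z) \<otimes>\<^bsub>TQP\<^esub> incl e =
      (u \<otimes>\<^sub>t v) \<otimes>\<^bsub>TQP\<^esub> incl y \<otimes>\<^bsub>TQP\<^esub> incl e \<oplus>\<^bsub>TQP\<^esub> (u \<otimes>\<^sub>t v) \<otimes>\<^bsub>TQP\<^esub> incl z \<otimes>\<^bsub>TQP\<^esub> incl e"
      using inclD(3)[OF add(1,2)] c eT by (simp add: T.T.r_distr T.T.l_distr)
    then show ?case using JE(5)[OF add(3,4)] by simp
  qed
  have iT: "inv\<^bsub>E\<^esub> e \<in> carrier E" "inv\<^bsub>E\<^esub> e \<otimes>\<^bsub>E\<^esub> e = \<one>\<^bsub>E\<^esub>" using eU by simp_all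
  have "incl (inv\<^bsub>E\<^esub> e) \<otimes>\<^bsub>TQP\<^esub> incl e = \<one>\<^bsub>TQP\<^esub>" using inclD(2)[OF iT(1) e(1)] inclD(4) iT(2) by simp
  then have "u \<otimes>\<^sub>t v \<in> J" if "u \<in> I" "v \<in> L" for u v
    using uvye[OF that iT(1)] T.pure_closed[OF X.I.Icarr[OF that(1)] Y.I.Icarr[OF that(2)]]
      inclD(1)[OF iT(1)] eT by (simp add: T.T.m_assoc)
  then show ?thesis by (rule T.tensor_subspace(3)[OF X.I.a_subset Y.I.a_subset J])
qed

lemma incl_central:
  assumes "y \<in> carrier E" "t \<in> carrier TQP"
  shows "t \<otimes>\<^bsub>TQP\<^esub> incl y = incl y \<otimes>\<^bsub>TQP\<^esub> t"
  using assms(1)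
proof (induction y rule: E.tensor_induct)
  case (pure c d)
  have cd: "c \<in> carrier Q" "d \<in> carrier P" using pure X.CD(1) Y.CD(1) by auto
  show ?case using assms(2)
  proof (induction t rule: T.tensor_induct)
    case (pure a b)
    then show ?case
      using X.CD(2)[OF \<open>c \<in> X.C\<close> pure(1)] Y.CD(2)[OF \<open>d \<in> Y.C\<close> pure(2)] cd
      by (simp add: incl_pure[OF \<open>c \<in> X.C\<close> \<open>d \<in> Y.C\<close>] T.pure_mult)
  next
    case (add x z)
    then show ?case using inclD(1)[OF E.pure_closed[OF pure]] by (simp add: T.T.l_distr T.T.r_distr)
  qed
next
  case (add y z)
  then show ?case using assms(2) inclD(1) by (simp add: inclD(3) T.T.l_distr T.T.r_distr)
qed

text \<open>
  For \<open>w \<noteq> 0\<close> in \<open>E\<close>, the ideal \<open>w (I \<otimes> L)\<close> is tested with the \<open>E\<close>-linear map \<open>\<chi> = \<phi> \<otimes> \<psi>\<close>, where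
  \<open>\<phi>\<close> and \<open>\<psi>\<close> are functionals over the centres with \<open>\<phi> u = 1\<close> and \<open>\<psi> v = 1\<close>. The map \<open>\<chi>\<close> shows
  that the ideal is not zero and, once \<open>u \<otimes> v\<close> is in it, that \<open>w\<close> has an inverse.
\<close>

lemma contains_imp_field:
  assumes large: "\<And>J. \<lbrakk>ideal J TQP; J \<noteq> {\<zero>\<^bsub>TQP\<^esub>}; J \<subseteq> tensor_subspace F Q P I L\<rbrakk> \<Longrightarrow>
    tensor_subspace F Q P I L \<subseteq> J"
  shows "field E"
proof -
  interpret EC: cring E by (rule E_cring)
  obtain u where u: "u \<in> I" "u \<noteq> \<zero>\<^bsub>Q\<^esub>" using X.exists_nonzero by blast
  obtain v where v: "v \<in> L" "v \<noteq> \<zero>\<^bsub>P\<^esub>" using Y.exists_nonzero by blast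
  note uc = X.I.Icarr[OF u(1)] and vc = Y.I.Icarr[OF v(1)]
  obtain \<phi> where \<phi>: "\<phi> \<in> linear_maps F Q CQ"
      "\<forall>c\<in>X.C. \<forall>x\<in>carrier Q. \<phi> (c \<otimes>\<^bsub>Q\<^esub> x) = c \<otimes>\<^bsub>Q\<^esub> \<phi> x" "\<phi> u = \<one>\<^bsub>Q\<^esub>"
    using X.center_functional[OF uc u(2)] by blast
  obtain \<psi> where \<psi>: "\<psi> \<in> linear_maps F P CP"
      "\<forall>c\<in>Y.C. \<forall>x\<in>carrier P. \<psi> (c \<otimes>\<^bsub>P\<^esub> x) = c \<otimes>\<^bsub>P\<^esub> \<psi> x" "\<psi> v = \<one>\<^bsub>P\<^esub>"
    using Y.center_functional[OF vc v(2)] by blast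
  define \<chi> where "\<chi> = tensor_map F Q P CQ CP \<phi> \<psi>"
  note ch = tensor_map[OF T.A_alg T.B_alg E.A_alg E.B_alg \<phi>(1) \<psi>(1), folded \<chi>_def]
  note chD = linear_mapsD[OF ch(1)]
  have ch_lin: "\<chi> (incl y \<otimes>\<^bsub>TQP\<^esub> t) = y \<otimes>\<^bsub>E\<^esub> \<chi> t" if y: "y \<in> carrier E" and t: "t \<in> carrier TQP" for y t
    using y
  proof (induction y rule: E.tensor_induct)
    case (pure c d)
    have cd: "c \<in> carrier Q" "d \<in> carrier P" using pure X.CD(1) Y.CD(1) by auto
    show ?case using t
    proof (induction t rule: T.tensor_induct)
      case (pure a b)
      have ab: "\<phi> a \<in> X.C" "\<psi> b \<in> Y.C" using linear_mapsD(1)[OF \<phi>(1)] linear_mapsD(1)[OF \<psi>(1)] pure by auto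
      have "\<chi> (incl (pure_tensor F CQ CP c d) \<otimes>\<^bsub>TQP\<^esub> (a \<otimes>\<^sub>t b)) =
          pure_tensor F CQ CP (c \<otimes>\<^bsub>Q\<^esub> \<phi> a) (d \<otimes>\<^bsub>P\<^esub> \<psi> b)"
        using pure cd \<phi>(2) \<psi>(2) \<open>c \<in> X.C\<close> \<open>d \<in> Y.C\<close> by (simp add: incl_pure T.pure_mult ch(2))
      also have "\<dots> = pure_tensor F CQ CP c d \<otimes>\<^bsub>E\<^esub> \<chi> (a \<otimes>\<^sub>t b)"
        using E.pure_mult[OF \<open>c \<in> X.C\<close> \<open>d \<in> Y.C\<close> ab] pure by (simp add: ch(2))
      finally show ?case .
    next
      case (add x z)
      then show ?case using inclD(1)[OF E.pure_closed[OF pure]] E.pure_closed[OF pure]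
        by (simp add: T.T.r_distr E.T.r_distr chD)
    qed
  next
    case (add y z)
    then show ?case using t inclD(1) by (simp add: inclD(3) T.T.l_distr E.T.l_distr chD)
  qed
  have uvT: "u \<otimes>\<^sub>t v \<in> carrier TQP" using uc vc by simp
  have ch1: "\<chi> (u \<otimes>\<^sub>t v) = \<one>\<^bsub>E\<^esub>" using ch(2)[OF uc vc] \<phi>(3) \<psi>(3) by (simp add: E.tensor_one)
  let ?N = "tensor_subspace F Q P I L"
  note ts = T.tensor_subspace[OF X.I.a_subset Y.I.a_subset]
  have N: "ideal ?N TQP" by (rule T.tensor_subspace_ideal[OF X.ideal_I Y.ideal_I])
  interpret N: ideal ?N TQP by (rule N)
  have uvN: "u \<otimes>\<^sub>t v \<in> ?N" by (rule ts(2)[OF u(1) v(1)])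
  show "field E"
  proof (rule EC.cring_fieldI2[OF E_nontrivial])
    fix w assume w: "w \<in> carrier E" "w \<noteq> \<zero>\<^bsub>E\<^esub>"
    note wT = inclD(1)[OF w(1)]
    let ?J = "(\<lambda>t. incl w \<otimes>\<^bsub>TQP\<^esub> t) ` ?N"
    have "(\<lambda>t. incl w \<otimes>\<^bsub>TQP\<^esub> t) \<in> linear_maps F TQP TQP"
      by (rule linear_mapsI) (use wT in \<open>simp_all add: T.T.r_distr assoc_algebraD(6)[OF T.assoc_algebra_tensor]\<close>)
    then have Jsub: "submodule ?J F TQP"
      by (rule submodule_image[OF T.TM.module_axioms T.TM.module_axioms _ ts(1)])
    have "ideal ?J TQP"
    proof (rule idealI[OF T.T.ring_axioms submodule.axioms(1)[OF Jsub]])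
      fix a x assume "a \<in> ?J" and x: "x \<in> carrier TQP"
      then obtain t where t: "t \<in> ?N" "a = incl w \<otimes>\<^bsub>TQP\<^esub> t" by blast
      have tT: "t \<in> carrier TQP" using t(1) by simp
      have "x \<otimes>\<^bsub>TQP\<^esub> a = incl w \<otimes>\<^bsub>TQP\<^esub> (x \<otimes>\<^bsub>TQP\<^esub> t)"
        using incl_central[OF w(1) x] t(2) wT x tT by (simp add: T.T.m_assoc[symmetric])
      then show "x \<otimes>\<^bsub>TQP\<^esub> a \<in> ?J" using N.I_l_closed[OF t(1) x] by blast
      have "a \<otimes>\<^bsub>TQP\<^esub> x = incl w \<otimes>\<^bsub>TQP\<^esub> (t \<otimes>\<^bsub>TQP\<^esub> x)"
        using t(2) wT x tT by (simp add: T.T.m_assoc)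
      then show "a \<otimes>\<^bsub>TQP\<^esub> x \<in> ?J" using N.I_r_closed[OF t(1) x] by blast
    qed
    moreover have "?J \<noteq> {\<zero>\<^bsub>TQP\<^esub>}"
    proof
      assume "?J = {\<zero>\<^bsub>TQP\<^esub>}"
      then have "incl w \<otimes>\<^bsub>TQP\<^esub> (u \<otimes>\<^sub>t v) = \<zero>\<^bsub>TQP\<^esub>" using uvN by blast
      then have "w = \<chi> \<zero>\<^bsub>TQP\<^esub>" using ch_lin[OF w(1) uvT] ch1 w(1) by simp
      then show False
        using w(2) linear_maps_additive(1)[OF ch(1) T.T.abelian_group_axioms E.T.abelian_group_axioms] by simp
    qed
    moreover have "?J \<subseteq> ?N" using N.I_l_closed wT by blast
    ultimately have "u \<otimes>\<^sub>t v \<in> ?J" using large uvN by blast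
    then obtain t where t: "t \<in> ?N" "u \<otimes>\<^sub>t v = incl w \<otimes>\<^bsub>TQP\<^esub> t" by blast
    then have "\<one>\<^bsub>E\<^esub> = w \<otimes>\<^bsub>E\<^esub> \<chi> t" using ch_lin[OF w(1), of t] ch1 ts(4) by auto
    moreover have "\<chi> t \<in> carrier E" using chD(1) t(1) ts(4) by blast
    ultimately show "\<exists>b\<in>carrier E. w \<otimes>\<^bsub>E\<^esub> b = \<one>\<^bsub>E\<^esub>" by force
  qed
qed

end

section \<open>Closed monoliths from nearly simple algebras\<close>

text \<open>
  A bimodule endomorphism \<open>f\<close> of a unital algebra satisfies \<open>f 1 x = f x = x f 1\<close>.
\<close>

lemma closed_monolith_simple:
  assumes alg: "assoc_algebra F Q" and nt: "carrier Q \<noteq> {\<zero>\<^bsub>Q\<^esub>}"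
    and simple: "\<And>N. \<lbrakk>ideal N Q; N \<noteq> {\<zero>\<^bsub>Q\<^esub>}\<rbrakk> \<Longrightarrow> N = carrier Q"
  shows "closed_monolith F Q (carrier Q)"
proof (rule closed_monolith.intro)
  interpret Q: ring Q by (rule assoc_algebraD(2)[OF alg])
  show "assoc_algebra F Q" by (rule alg)
  show "ideal (carrier Q) Q" by (rule Q.oneideal)
  show "carrier Q \<noteq> {\<zero>\<^bsub>Q\<^esub>}" by (rule nt)
  show "carrier Q \<subseteq> N" if "ideal N Q" "N \<noteq> {\<zero>\<^bsub>Q\<^esub>}" for N using simple[OF that] by simp
  show "q = \<zero>\<^bsub>Q\<^esub>" if "q \<in> carrier Q" "\<And>x. x \<in> carrier Q \<Longrightarrow> q \<otimes>\<^bsub>Q\<^esub> x = \<zero>\<^bsub>Q\<^esub>" for q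
    using that(1) that(2)[OF Q.one_closed] by simp
  show "q = \<zero>\<^bsub>Q\<^esub>" if "q \<in> carrier Q" "\<And>x. x \<in> carrier Q \<Longrightarrow> x \<otimes>\<^bsub>Q\<^esub> q = \<zero>\<^bsub>Q\<^esub>" for q
    using that(1) that(2)[OF Q.one_closed] by simp
  fix f
  assume f: "\<And>x. x \<in> carrier Q \<Longrightarrow> f x \<in> carrier Q"
    "\<And>q x. \<lbrakk>q \<in> carrier Q; x \<in> carrier Q\<rbrakk> \<Longrightarrow> f (q \<otimes>\<^bsub>Q\<^esub> x) = q \<otimes>\<^bsub>Q\<^esub> f x"
    "\<And>q x. \<lbrakk>q \<in> carrier Q; x \<in> carrier Q\<rbrakk> \<Longrightarrow> f (x \<otimes>\<^bsub>Q\<^esub> q) = f x \<otimes>\<^bsub>Q\<^esub> q"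
  have r: "f \<one>\<^bsub>Q\<^esub> \<otimes>\<^bsub>Q\<^esub> x = f x" if "x \<in> carrier Q" for x
    using f(3)[OF that Q.one_closed] that by simp
  have l: "x \<otimes>\<^bsub>Q\<^esub> f \<one>\<^bsub>Q\<^esub> = f x" if "x \<in> carrier Q" for x
    using f(2)[OF that Q.one_closed] that by simp
  have "f \<one>\<^bsub>Q\<^esub> \<in> carrier (center_algebra Q)"
    by (rule center_algebraI) (simp_all add: f(1) r l)
  moreover have "\<forall>x\<in>carrier Q. f x = f \<one>\<^bsub>Q\<^esub> \<otimes>\<^bsub>Q\<^esub> x" using r by simp
  ultimately show "\<exists>c\<in>carrier (center_algebra Q). \<forall>x\<in>carrier Q. f x = c \<otimes>\<^bsub>Q\<^esub> x" by (rule bexI[rotated])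
qed

text \<open>
  The ideal \<open>I\<close> is idempotent because its square is a non-zero ideal inside it.
\<close>

lemma nearly_simpleD:
  assumes "nearly_simple F A" "nontrivial_ideal I A"
  shows "assoc_algebra F A" "ideal I A" "I \<noteq> {\<zero>\<^bsub>A\<^esub>}" "I \<noteq> carrier A" "I \<cdot>\<^bsub>A\<^esub> I = I"
    and "\<And>N. \<lbrakk>ideal N A; N \<noteq> {\<zero>\<^bsub>A\<^esub>}; N \<noteq> carrier A\<rbrakk> \<Longrightarrow> N = I"
    and "\<And>N. \<lbrakk>ideal N A; N \<noteq> {\<zero>\<^bsub>A\<^esub>}\<rbrakk> \<Longrightarrow> I \<subseteq> N"
proof -
  note ns = assms(1)[unfolded nearly_simple_def] and nI = assms(2)[unfolded nontrivial_ideal_def]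
  show alg: "assoc_algebra F A" by (rule conjunct1[OF ns])
  interpret A: ring A by (rule assoc_algebraD(2)[OF alg])
  show I: "ideal I A" "I \<noteq> {\<zero>\<^bsub>A\<^esub>}" "I \<noteq> carrier A" using nI by simp_all
  interpret I: ideal I A by (rule I)
  have ex1: "\<exists>!N. nontrivial_ideal N A" and sq: "\<forall>N. nontrivial_ideal N A \<longrightarrow> N \<cdot>\<^bsub>A\<^esub> N \<noteq> {\<zero>\<^bsub>A\<^esub>}"
    using ns by simp_all
  show u: "N = I" if "ideal N A" "N \<noteq> {\<zero>\<^bsub>A\<^esub>}" "N \<noteq> carrier A" for N
  proof -
    have "nontrivial_ideal N A" unfolding nontrivial_ideal_def using that by simp
    then show ?thesis using ex1 assms(2) by (metis)
  qed
  show "I \<subseteq> N" if "ideal N A" "N \<noteq> {\<zero>\<^bsub>A\<^esub>}" for N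
    using u[OF that] I.a_subset by (cases "N = carrier A") simp_all
  have "I \<cdot>\<^bsub>A\<^esub> I \<noteq> {\<zero>\<^bsub>A\<^esub>}" using sq assms(2) by simp
  moreover have "I \<cdot>\<^bsub>A\<^esub> I \<subseteq> I" using A.ideal_prod_inter[OF I(1) I(1)] by simp
  then have "I \<cdot>\<^bsub>A\<^esub> I \<noteq> carrier A" using I(3) I.a_subset by blast
  ultimately show "I \<cdot>\<^bsub>A\<^esub> I = I" by (intro u A.ideal_prod_is_ideal I)
qed

lemma quotient_map_kernel:
  assumes "assoc_algebra F A" "ideal I A" "a \<in> carrier A" "I +>\<^bsub>A\<^esub> a = \<zero>\<^bsub>quotient_algebra A I\<^esub>"
  shows "a \<in> I"
proof -
  interpret I: ideal I A by fact
  show ?thesis using assms(3,4) I.a_rcos_self by (auto simp: quotient_algebra_simps)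
qed

lemma quotient_map_surj: "(\<lambda>x. I +>\<^bsub>A\<^esub> x) ` carrier A = carrier (quotient_algebra A I)"
  unfolding quotient_algebra_simps A_RCOSETS_def' by auto

lemma closed_monolith_top_quotient:
  assumes "nearly_simple F A" "nontrivial_ideal I A"
  shows "closed_monolith F (quotient_algebra A I) (carrier (quotient_algebra A I))"
proof -
  note ns = nearly_simpleD[OF assms]
  interpret A: ring A by (rule assoc_algebraD(2)[OF ns(1)])
  interpret I: ideal I A by (rule ns(2))
  interpret QA: ring "quotient_algebra A I" by (rule ring_quotient_algebra[OF ns(1,2)])
  note qa = assoc_algebra_quotient[OF ns(1,2)] and qh = quotient_map_hom[OF ns(1,2)]
  have z: "I +>\<^bsub>A\<^esub> x = \<zero>\<^bsub>quotient_algebra A I\<^esub> \<longleftrightarrow> x \<in> I" if "x \<in> carrier A" for x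
    using quotient_map_kernel[OF ns(1,2) that] by (auto simp: quotient_algebra_simps I.a_rcos_const)
  show ?thesis
  proof (rule closed_monolith_simple[OF qa])
    obtain x where x: "x \<in> carrier A" "x \<notin> I" using ns(4) I.a_subset by blast
    have "I +>\<^bsub>A\<^esub> x \<in> carrier (quotient_algebra A I)" by (rule quotient_algebra_ops(1)[OF ns(1,2) x(1)])
    then show "carrier (quotient_algebra A I) \<noteq> {\<zero>\<^bsub>quotient_algebra A I\<^esub>}" using z[OF x(1)] x(2) by blast
    fix N assume N: "ideal N (quotient_algebra A I)" "N \<noteq> {\<zero>\<^bsub>quotient_algebra A I\<^esub>}"
    interpret N: ideal N "quotient_algebra A I" by (rule N)
    let ?J = "{x \<in> carrier A. I +>\<^bsub>A\<^esub> x \<in> N}"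
    have J: "ideal ?J A" by (rule ideal_vimage[OF ns(1) qa qh N(1)])
    obtain X where X: "X \<in> N" "X \<noteq> \<zero>\<^bsub>quotient_algebra A I\<^esub>" using N(2) N.zero_closed by blast
    obtain y where y: "y \<in> carrier A" "X = I +>\<^bsub>A\<^esub> y"
      by (rule quotient_algebra_elem[OF N.Icarr[OF X(1)]])
    have yJ: "y \<in> ?J" "y \<notin> I" using X y z[OF y(1)] by simp_all
    then have "y \<noteq> \<zero>\<^bsub>A\<^esub>" using I.zero_closed by auto
    then have "?J \<noteq> {\<zero>\<^bsub>A\<^esub>}" using yJ(1) by (metis singletonD)
    moreover have "?J \<noteq> I" using yJ by metis
    ultimately have "?J = carrier A" using ns(6)[OF J] by metis
    then have all: "I +>\<^bsub>A\<^esub> x \<in> N" if "x \<in> carrier A" for x using that by blast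
    have "X \<in> N" if X: "X \<in> carrier (quotient_algebra A I)" for X
    proof -
      obtain x where "x \<in> carrier A" "X = I +>\<^bsub>A\<^esub> x" by (rule quotient_algebra_elem[OF X])
      then show ?thesis using all by simp
    qed
    then have "carrier (quotient_algebra A I) \<subseteq> N" by (rule subsetI)
    from equalityI[OF N.a_subset this] show "N = carrier (quotient_algebra A I)" .
  qed
qed

text \<open>
  Every non-zero ideal of \<open>A\<close> contains \<open>I\<close>, so \<open>I\<close> itself is a denominator ideal of every element of
  \<open>Q\<close>. A bimodule endomorphism of \<open>e I\<close> is both a left and a right module map, compatible with
  itself; so it is the multiplication by an element of \<open>Q\<close>, and it is central because the
  endomorphism commutes with left multiplications.
\<close>

lemma closed_monolith_symmetric_quotient:
  assumes "nearly_simple F A" "nontrivial_ideal I A" "symmetric_quotient_algebra F A Q e"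
  shows "closed_monolith F Q (e ` I)"
proof -
  note ns = nearly_simpleD[OF assms(1,2)]
  interpret A: ring A by (rule assoc_algebraD(2)[OF ns(1)])
  interpret I: ideal I A by (rule ns(2))
  have Qalg: "assoc_algebra F Q" and hom: "e \<in> algebra_hom F A Q" and inj: "inj_on e (carrier A)"
    and denom: "\<forall>q\<in>carrier Q. \<exists>N. ideal N A \<and> N \<noteq> {\<zero>\<^bsub>A\<^esub>} \<and>
        (\<forall>x\<in>N. q \<otimes>\<^bsub>Q\<^esub> e x \<in> e ` carrier A \<and> e x \<otimes>\<^bsub>Q\<^esub> q \<in> e ` carrier A)"
    and ann: "\<forall>q\<in>carrier Q. \<forall>N. ideal N A \<and> N \<noteq> {\<zero>\<^bsub>A\<^esub>} \<and>
        ((\<forall>x\<in>N. q \<otimes>\<^bsub>Q\<^esub> e x = \<zero>\<^bsub>Q\<^esub>) \<or> (\<forall>x\<in>N. e x \<otimes>\<^bsub>Q\<^esub> q = \<zero>\<^bsub>Q\<^esub>)) \<longrightarrow> q = \<zero>\<^bsub>Q\<^esub>"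
    and lift: "\<forall>N f g. ideal N A \<and> N \<noteq> {\<zero>\<^bsub>A\<^esub>} \<and> right_module_map A N f \<and> left_module_map A N g \<and>
        (\<forall>x\<in>N. \<forall>y\<in>N. x \<otimes>\<^bsub>A\<^esub> f y = g x \<otimes>\<^bsub>A\<^esub> y) \<longrightarrow>
        (\<exists>q\<in>carrier Q. \<forall>x\<in>N. e (f x) = q \<otimes>\<^bsub>Q\<^esub> e x \<and> e (g x) = e x \<otimes>\<^bsub>Q\<^esub> q)"
    using assms(3) unfolding symmetric_quotient_algebra_def by - ((elim conjE, assumption)+)
  interpret Q: ring Q by (rule assoc_algebraD(2)[OF Qalg])
  note eD = algebra_homD[OF hom]
  note lin = algebra_hom_linear[OF hom] and ag = assoc_algebraD(4)
  have e0: "e \<zero>\<^bsub>A\<^esub> = \<zero>\<^bsub>Q\<^esub>" by (rule linear_maps_additive(1)[OF lin ag[OF ns(1)] ag[OF Qalg]])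
  have q1: "q \<otimes>\<^bsub>Q\<^esub> e x \<in> e ` carrier A" "e x \<otimes>\<^bsub>Q\<^esub> q \<in> e ` carrier A"
    if q: "q \<in> carrier Q" and x: "x \<in> I" for q x
  proof -
    obtain N where N: "ideal N A" "N \<noteq> {\<zero>\<^bsub>A\<^esub>}"
      "\<forall>x\<in>N. q \<otimes>\<^bsub>Q\<^esub> e x \<in> e ` carrier A \<and> e x \<otimes>\<^bsub>Q\<^esub> q \<in> e ` carrier A" using denom q by blast
    then show "q \<otimes>\<^bsub>Q\<^esub> e x \<in> e ` carrier A" "e x \<otimes>\<^bsub>Q\<^esub> q \<in> e ` carrier A" using ns(7)[OF N(1,2)] x by auto
  qed
  \<comment> \<open>Since \<open>I = I I\<close>, multiplication by \<open>Q\<close> maps \<open>e I\<close> not only into \<open>e A\<close> but into itself.\<close>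
  have qI: "q \<otimes>\<^bsub>Q\<^esub> e x \<in> e ` I \<and> e x \<otimes>\<^bsub>Q\<^esub> q \<in> e ` I"
    if q: "q \<in> carrier Q" and x: "x \<in> I" for q x
  proof -
    have "x \<in> I \<cdot>\<^bsub>A\<^esub> I" using x ns(5) by simp
    then have "x \<in> carrier A \<and> q \<otimes>\<^bsub>Q\<^esub> e x \<in> e ` I \<and> e x \<otimes>\<^bsub>Q\<^esub> q \<in> e ` I"
    proof (induction x rule: ideal_prod.induct)
      case (prod i j)
      note ic = I.Icarr[OF prod(1)] and jc = I.Icarr[OF prod(2)]
      obtain a where a: "a \<in> carrier A" "q \<otimes>\<^bsub>Q\<^esub> e i = e a" using q1(1)[OF q prod(1)] by blast
      obtain b where b: "b \<in> carrier A" "e j \<otimes>\<^bsub>Q\<^esub> q = e b" using q1(2)[OF q prod(2)] by blast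
      have "q \<otimes>\<^bsub>Q\<^esub> e (i \<otimes>\<^bsub>A\<^esub> j) = e (a \<otimes>\<^bsub>A\<^esub> j)"
        using a ic jc q by (simp add: eD Q.m_assoc[symmetric])
      moreover have "e (i \<otimes>\<^bsub>A\<^esub> j) \<otimes>\<^bsub>Q\<^esub> q = e (i \<otimes>\<^bsub>A\<^esub> b)"
        using b ic jc q by (simp add: eD Q.m_assoc)
      ultimately show ?case using I.I_l_closed[OF prod(2) a(1)] I.I_r_closed[OF prod(1) b(1)] ic jc by simp
    next
      case (sum s t)
      then obtain s1 s2 t1 t2 where s: "q \<otimes>\<^bsub>Q\<^esub> e s = e s1" "e s \<otimes>\<^bsub>Q\<^esub> q = e s2" "s1 \<in> I" "s2 \<in> I"
        and t: "q \<otimes>\<^bsub>Q\<^esub> e t = e t1" "e t \<otimes>\<^bsub>Q\<^esub> q = e t2" "t1 \<in> I" "t2 \<in> I" by blast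
      have c: "s \<in> carrier A" "t \<in> carrier A" using sum by auto
      have "q \<otimes>\<^bsub>Q\<^esub> e (s \<oplus>\<^bsub>A\<^esub> t) = e (s1 \<oplus>\<^bsub>A\<^esub> t1)"
        using s t c q by (simp add: eD Q.r_distr)
      moreover have "e (s \<oplus>\<^bsub>A\<^esub> t) \<otimes>\<^bsub>Q\<^esub> q = e (s2 \<oplus>\<^bsub>A\<^esub> t2)"
        using s t c q by (simp add: eD Q.l_distr)
      ultimately show ?case using c I.a_closed[OF s(3) t(3)] I.a_closed[OF s(4) t(4)] by simp
    qed
    then show ?thesis by blast
  qed
  have idl: "ideal (e ` I) Q"
  proof (rule ideal_image[OF ns(1) Qalg hom ns(2)])
    fix y x assume "y \<in> carrier Q" "x \<in> I"
    from qI[OF this] show "\<exists>x'\<in>I. y \<otimes>\<^bsub>Q\<^esub> e x = e x'" "\<exists>x'\<in>I. e x \<otimes>\<^bsub>Q\<^esub> y = e x'"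
      by (simp_all add: image_iff)
  qed
  have nz: "e ` I \<noteq> {\<zero>\<^bsub>Q\<^esub>}"
  proof
    assume h: "e ` I = {\<zero>\<^bsub>Q\<^esub>}"
    have "x = \<zero>\<^bsub>A\<^esub>" if x: "x \<in> I" for x
    proof -
      have "e x = e \<zero>\<^bsub>A\<^esub>" using x h e0 by auto
      from inj_onD[OF inj this I.Icarr[OF x] A.zero_closed] show ?thesis .
    qed
    then show False using ns(3) I.zero_closed by blast
  qed
  have fl: "q = \<zero>\<^bsub>Q\<^esub>" if "q \<in> carrier Q" "\<And>x. x \<in> e ` I \<Longrightarrow> q \<otimes>\<^bsub>Q\<^esub> x = \<zero>\<^bsub>Q\<^esub>" for q
    using ann[rule_format, OF that(1), of I] ns(2,3) that(2) by auto
  have fr: "q = \<zero>\<^bsub>Q\<^esub>" if "q \<in> carrier Q" "\<And>x. x \<in> e ` I \<Longrightarrow> x \<otimes>\<^bsub>Q\<^esub> q = \<zero>\<^bsub>Q\<^esub>" for q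
    using ann[rule_format, OF that(1), of I] ns(2,3) that(2) by auto
  have minim: "e ` I \<subseteq> N" if N: "ideal N Q" "N \<noteq> {\<zero>\<^bsub>Q\<^esub>}" for N
  proof -
    interpret N: ideal N Q by (rule N)
    obtain n where n: "n \<in> N" "n \<noteq> \<zero>\<^bsub>Q\<^esub>" using N(2) N.zero_closed by blast
    obtain x where x: "x \<in> I" "n \<otimes>\<^bsub>Q\<^esub> e x \<noteq> \<zero>\<^bsub>Q\<^esub>" using fl[OF N.Icarr[OF n(1)]] n(2) by blast
    obtain y where y: "y \<in> I" "n \<otimes>\<^bsub>Q\<^esub> e x = e y" using qI[OF N.Icarr[OF n(1)] x(1)] by blast
    let ?J = "{a \<in> carrier A. e a \<in> N}"
    have J: "ideal ?J A" by (rule ideal_vimage[OF ns(1) Qalg hom N(1)])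
    have "y \<in> ?J" using y N.I_r_closed[OF n(1) eD(1)[OF I.Icarr[OF x(1)]]] I.Icarr by simp
    moreover have "y \<noteq> \<zero>\<^bsub>A\<^esub>" using y(2) x(2) e0 by auto
    ultimately have "?J \<noteq> {\<zero>\<^bsub>A\<^esub>}" by blast
    then show ?thesis using ns(7)[OF J] by blast
  qed
  have cen: "\<exists>c\<in>carrier (center_algebra Q). \<forall>x\<in>e ` I. f x = c \<otimes>\<^bsub>Q\<^esub> x"
    if f: "\<And>x. x \<in> e ` I \<Longrightarrow> f x \<in> e ` I"
      "\<And>x y. \<lbrakk>x \<in> e ` I; y \<in> e ` I\<rbrakk> \<Longrightarrow> f (x \<oplus>\<^bsub>Q\<^esub> y) = f x \<oplus>\<^bsub>Q\<^esub> f y"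
      "\<And>q x. \<lbrakk>q \<in> carrier Q; x \<in> e ` I\<rbrakk> \<Longrightarrow> f (q \<otimes>\<^bsub>Q\<^esub> x) = q \<otimes>\<^bsub>Q\<^esub> f x"
      "\<And>q x. \<lbrakk>q \<in> carrier Q; x \<in> e ` I\<rbrakk> \<Longrightarrow> f (x \<otimes>\<^bsub>Q\<^esub> q) = f x \<otimes>\<^bsub>Q\<^esub> q" for f
  proof -
    define g where "g x = inv_into I e (f (e x))" for x
    have g: "g x \<in> I" "e (g x) = f (e x)" if "x \<in> I" for x
      unfolding g_def using f(1)[of "e x"] that by (auto intro: inv_into_into f_inv_into_f)
    have gc: "g x \<in> carrier A" if "x \<in> I" for x using g(1)[OF that] I.Icarr by blast
    have uniq: "x = y" if "x \<in> carrier A" "y \<in> carrier A" "e x = e y" for x y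
      using inj_onD[OF inj that(3,1,2)] .
    have add: "g (x \<oplus>\<^bsub>A\<^esub> y) = g x \<oplus>\<^bsub>A\<^esub> g y" if "x \<in> I" "y \<in> I" for x y
      using that gc g(2) by (intro uniq) (simp_all add: eD f(2))
    have r: "g (x \<otimes>\<^bsub>A\<^esub> a) = g x \<otimes>\<^bsub>A\<^esub> a" if "x \<in> I" "a \<in> carrier A" for x a
      using that gc g(2) by (intro uniq) (simp_all add: eD f(4) I.I_r_closed)
    have l: "g (a \<otimes>\<^bsub>A\<^esub> x) = a \<otimes>\<^bsub>A\<^esub> g x" if "x \<in> I" "a \<in> carrier A" for x a
      using that gc g(2) by (intro uniq) (simp_all add: eD f(3) I.I_l_closed)
    have "right_module_map A I g" "left_module_map A I g"
      unfolding right_module_map_def left_module_map_def using gc add r l by auto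
    moreover have "x \<otimes>\<^bsub>A\<^esub> g y = g x \<otimes>\<^bsub>A\<^esub> y" if "x \<in> I" "y \<in> I" for x y
      using r[OF that(1) I.Icarr[OF that(2)]] l[OF that(2) I.Icarr[OF that(1)]] by simp
    ultimately have "ideal I A \<and> I \<noteq> {\<zero>\<^bsub>A\<^esub>} \<and> right_module_map A I g \<and> left_module_map A I g \<and>
        (\<forall>x\<in>I. \<forall>y\<in>I. x \<otimes>\<^bsub>A\<^esub> g y = g x \<otimes>\<^bsub>A\<^esub> y)"
      using ns(2,3) by simp
    from lift[rule_format, OF this]
    obtain q where q: "q \<in> carrier Q" "\<forall>x\<in>I. e (g x) = q \<otimes>\<^bsub>Q\<^esub> e x \<and> e (g x) = e x \<otimes>\<^bsub>Q\<^esub> q"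
      by (elim bexE)
    have fq: "f x = q \<otimes>\<^bsub>Q\<^esub> x" if "x \<in> e ` I" for x using q(2) g(2) that by auto
    have "q \<in> carrier (center_algebra Q)"
    proof (rule center_algebraI[OF q(1)])
      fix p assume p: "p \<in> carrier Q"
      have "q \<otimes>\<^bsub>Q\<^esub> p \<ominus>\<^bsub>Q\<^esub> p \<otimes>\<^bsub>Q\<^esub> q = \<zero>\<^bsub>Q\<^esub>"
      proof (rule fl)
        show "q \<otimes>\<^bsub>Q\<^esub> p \<ominus>\<^bsub>Q\<^esub> p \<otimes>\<^bsub>Q\<^esub> q \<in> carrier Q" using p q(1) by simp
        fix x assume x: "x \<in> e ` I"
        obtain i where i: "i \<in> I" "x = e i" using x by blast
        have xc: "x \<in> carrier Q" using i eD(1)[OF I.Icarr] by simp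
        have px: "p \<otimes>\<^bsub>Q\<^esub> x \<in> e ` I" using qI[OF p i(1)] i(2) by simp
        have "q \<otimes>\<^bsub>Q\<^esub> (p \<otimes>\<^bsub>Q\<^esub> x) = p \<otimes>\<^bsub>Q\<^esub> (q \<otimes>\<^bsub>Q\<^esub> x)" using f(3)[OF p x] fq[OF px] fq[OF x] by simp
        then show "(q \<otimes>\<^bsub>Q\<^esub> p \<ominus>\<^bsub>Q\<^esub> p \<otimes>\<^bsub>Q\<^esub> q) \<otimes>\<^bsub>Q\<^esub> x = \<zero>\<^bsub>Q\<^esub>"
          using p q(1) xc by (simp add: Q.minus_eq Q.l_distr Q.l_minus Q.m_assoc Q.r_neg)
      qed
      then show "q \<otimes>\<^bsub>Q\<^esub> p = p \<otimes>\<^bsub>Q\<^esub> q" using p q(1) by (simp add: Q.minus_eq_zero_iff)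
    qed
    then show ?thesis using fq by blast
  qed
  show ?thesis
    by (rule closed_monolith.intro[OF Qalg idl nz minim fl fr cen])
qed

text \<open>
  Let \<open>g\<close> be the injection \<open>e \<otimes> f\<close>. The image under \<open>g\<close> of an ideal of \<open>A \<otimes> B\<close> is stable under
  multiplication by \<open>e I \<otimes> 1\<close> and \<open>1 \<otimes> f L\<close>. Conversely, an ideal of \<open>Q \<otimes> P\<close> inside
  \<open>e I \<otimes> f L = g (I \<otimes> L)\<close> lies in the range of \<open>g\<close>, so that its preimage is non-zero if the ideal
  is.
\<close>

lemma field_iff_contains:
  assumes Q: "closed_monolith F Q (e ` I)" and P: "closed_monolith F P (f ` L)"
    and A: "assoc_algebra F A" "ideal I A" and B: "assoc_algebra F B" "ideal L B"
    and e: "e \<in> algebra_hom F A Q" "inj_on e (carrier A)"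
    and f: "f \<in> algebra_hom F B P" "inj_on f (carrier B)"
  shows "field (tensor_algebra F (center_algebra Q) (center_algebra P)) \<longleftrightarrow>
    (\<forall>J. ideal J (tensor_algebra F A B) \<longrightarrow> J \<noteq> {\<zero>\<^bsub>tensor_algebra F A B\<^esub>} \<longrightarrow>
      tensor_subspace F A B I L \<subseteq> J)"
proof -
  interpret QP: monolith_pair F Q "e ` I" P "f ` L" by (rule monolith_pair.intro[OF Q P])
  interpret AB: algebra_pair F A B by (rule algebra_pair.intro[OF A(1) B(1)])
  interpret I: ideal I A by (rule A(2))
  interpret L: ideal L B by (rule B(2))
  note el = algebra_hom_linear[OF e(1)] and fl = algebra_hom_linear[OF f(1)]
  define g where "g = tensor_map F A B Q P e f"
  note gh = tensor_map_hom[OF A(1) B(1) QP.X.alg QP.Y.alg e(1) f(1), folded g_def]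
  note gp = tensor_map(2)[OF A(1) B(1) QP.X.alg QP.Y.alg el fl, folded g_def]
  note ginj = tensor_map_inj[OF A(1) B(1) QP.X.alg QP.Y.alg el fl e(2) f(2), folded g_def]
  note gim = tensor_map_image[OF A(1) B(1) QP.X.alg QP.Y.alg el fl I.a_subset L.a_subset, folded g_def]
  note gl = algebra_hom_linear[OF gh] and gD = algebra_homD[OF gh]
  note eD = algebra_homD[OF e(1)] and fD = algebra_homD[OF f(1)]
  have g0: "g \<zero>\<^bsub>AB.T\<^esub> = \<zero>\<^bsub>QP.T.T\<^esub>"
    by (rule linear_maps_additive(1)[OF gl AB.T.abelian_group_axioms QP.T.T.abelian_group_axioms])
  have sub: "tensor_subspace F A B I L \<subseteq> carrier AB.T"
    by (rule AB.tensor_subspace(4)[OF I.a_subset L.a_subset])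
  show ?thesis
  proof (intro iffI allI impI)
    fix J assume E: "field (tensor_algebra F (center_algebra Q) (center_algebra P))"
      and J: "ideal J AB.T" "J \<noteq> {\<zero>\<^bsub>AB.T\<^esub>}"
    interpret J: ideal J "tensor_algebra F A B" by (rule J)
    have lft: "x \<otimes>\<^bsub>QP.T.T\<^esub> y \<in> g ` J" "y \<otimes>\<^bsub>QP.T.T\<^esub> x \<in> g ` J"
      if x: "x \<in> g ` carrier AB.T" and y: "y \<in> g ` J" for x y
    proof -
      obtain s t where "s \<in> carrier AB.T" "x = g s" "t \<in> J" "y = g t" using x y by blast
      then have "x \<otimes>\<^bsub>QP.T.T\<^esub> y = g (s \<otimes>\<^bsub>AB.T\<^esub> t)"
        "y \<otimes>\<^bsub>QP.T.T\<^esub> x = g (t \<otimes>\<^bsub>AB.T\<^esub> s)"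
        "s \<otimes>\<^bsub>AB.T\<^esub> t \<in> J" "t \<otimes>\<^bsub>AB.T\<^esub> s \<in> J"
        by (simp_all add: gD J.I_l_closed J.I_r_closed)
      then show "x \<otimes>\<^bsub>QP.T.T\<^esub> y \<in> g ` J" "y \<otimes>\<^bsub>QP.T.T\<^esub> x \<in> g ` J" by simp_all
    qed
    have s: "pure_tensor F Q P u \<one>\<^bsub>P\<^esub> \<in> g ` carrier AB.T" if u: "u \<in> e ` I" for u
    proof -
      obtain i where i: "i \<in> I" "u = e i" using u by blast
      then have "pure_tensor F Q P u \<one>\<^bsub>P\<^esub> = g (pure_tensor F A B i \<one>\<^bsub>B\<^esub>)"
        using gp I.Icarr fD(4) by simp
      then show ?thesis using AB.pure_closed[OF I.Icarr[OF i(1)] AB.B.one_closed] by blast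
    qed
    have r: "pure_tensor F Q P \<one>\<^bsub>Q\<^esub> v \<in> g ` carrier AB.T" if v: "v \<in> f ` L" for v
    proof -
      obtain i where i: "i \<in> L" "v = f i" using v by blast
      then have "pure_tensor F Q P \<one>\<^bsub>Q\<^esub> v = g (pure_tensor F A B \<one>\<^bsub>A\<^esub> i)"
        using gp L.Icarr eD(4) by simp
      then show ?thesis using AB.pure_closed[OF AB.A.one_closed L.Icarr[OF i(1)]] by blast
    qed
    have "tensor_subspace F Q P (e ` I) (f ` L) \<subseteq> g ` J"
    proof (rule QP.field_imp_contains[OF E])
      show "submodule (g ` J) F QP.T.T"
        by (rule submodule_image[OF AB.TM.module_axioms QP.T.TM.module_axioms gl
          ideal_is_submodule[OF AB.assoc_algebra_tensor J(1)]])
      show "g ` J \<noteq> {\<zero>\<^bsub>QP.T.T\<^esub>}"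
      proof
        assume h: "g ` J = {\<zero>\<^bsub>QP.T.T\<^esub>}"
        have "x = \<zero>\<^bsub>AB.T\<^esub>" if x: "x \<in> J" for x
        proof -
          have "g x = g \<zero>\<^bsub>AB.T\<^esub>" using x h g0 by auto
          from inj_onD[OF ginj this J.Icarr[OF x] AB.T.zero_closed] show ?thesis .
        qed
        then have "J \<subseteq> {\<zero>\<^bsub>AB.T\<^esub>}" by blast
        then show False using J(2) J.zero_closed by blast
      qed
    qed (use lft[OF s] lft[OF r] in simp_all)
    then have "g ` tensor_subspace F A B I L \<subseteq> g ` J" unfolding gim .
    then have im: "g x \<in> g ` J" if "x \<in> tensor_subspace F A B I L" for x using that by blast
    show "tensor_subspace F A B I L \<subseteq> J"
    proof
      fix x assume x: "x \<in> tensor_subspace F A B I L"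
      then obtain j where j: "j \<in> J" "g x = g j" using im[OF x] by blast
      from inj_onD[OF ginj j(2) subsetD[OF sub x] J.Icarr[OF j(1)]] j(1) show "x \<in> J" by simp
    qed
  next
    assume large: "\<forall>J. ideal J AB.T \<longrightarrow> J \<noteq> {\<zero>\<^bsub>AB.T\<^esub>} \<longrightarrow>
      tensor_subspace F A B I L \<subseteq> J"
    show "field (tensor_algebra F (center_algebra Q) (center_algebra P))"
    proof (rule QP.contains_imp_field)
      fix J assume J: "ideal J QP.T.T" "J \<noteq> {\<zero>\<^bsub>QP.T.T\<^esub>}"
        "J \<subseteq> tensor_subspace F Q P (e ` I) (f ` L)"
      interpret J: ideal J "tensor_algebra F Q P" by (rule J)
      let ?J = "{x \<in> carrier AB.T. g x \<in> J}"
      have id: "ideal ?J AB.T"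
        by (rule ideal_vimage[OF AB.assoc_algebra_tensor QP.T.assoc_algebra_tensor gh J(1)])
      obtain j where j: "j \<in> J" "j \<noteq> \<zero>\<^bsub>QP.T.T\<^esub>" using J(2) J.zero_closed by blast
      have "j \<in> g ` tensor_subspace F A B I L" unfolding gim by (rule subsetD[OF J(3) j(1)])
      then obtain x where x: "x \<in> tensor_subspace F A B I L" "j = g x" by blast
      have "x \<in> ?J" using x(2) j(1) subsetD[OF sub x(1)] by simp
      moreover have "x \<noteq> \<zero>\<^bsub>AB.T\<^esub>" using x(2) j(2) g0 by metis
      ultimately have "?J \<noteq> {\<zero>\<^bsub>AB.T\<^esub>}" by (metis singletonD)
      then have "tensor_subspace F A B I L \<subseteq> ?J" by (rule large[rule_format, OF id])
      then have "g x \<in> J" if "x \<in> tensor_subspace F A B I L" for x using that by blast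
      then show "tensor_subspace F Q P (e ` I) (f ` L) \<subseteq> J"
        unfolding gim[symmetric] by (rule image_subsetI)
    qed
  qed
qed

section \<open>Ideals modulo a kernel and admissible ideals\<close>

lemma id_hom: "(\<lambda>x. x) \<in> algebra_hom F A A"
  by (rule algebra_homI) simp_all

lemma set_addI: "\<lbrakk>x \<in> X; y \<in> Y\<rbrakk> \<Longrightarrow> x \<oplus>\<^bsub>R\<^esub> y \<in> X <+>\<^bsub>R\<^esub> Y"
  unfolding set_add_def' by blast

lemma set_addE:
  assumes "z \<in> X <+>\<^bsub>R\<^esub> Y"
  obtains x y where "x \<in> X" "y \<in> Y" "z = x \<oplus>\<^bsub>R\<^esub> y"
  using assms unfolding set_add_def' by blast

text \<open>
  Ideals of \<open>A' \<otimes> B'\<close> correspond to ideals of \<open>A \<otimes> B\<close> by image and preimage along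
  \<open>\<alpha> \<otimes> \<beta>\<close>, whose kernel is \<open>H\<close>.
\<close>

lemma contains_iff_mod_kernel:
  assumes A: "assoc_algebra F A" and B: "assoc_algebra F B"
    and A': "assoc_algebra F A'" and B': "assoc_algebra F B'"
    and \<alpha>: "\<alpha> \<in> algebra_hom F A A'" "\<alpha> ` carrier A = carrier A'"
    and \<beta>: "\<beta> \<in> algebra_hom F B B'" "\<beta> ` carrier B = carrier B'"
    and I: "ideal I A" "\<And>a. a \<in> carrier A \<Longrightarrow> \<alpha> a = \<zero>\<^bsub>A'\<^esub> \<longleftrightarrow> a \<in> I"
    and L: "ideal L B" "\<And>b. b \<in> carrier B \<Longrightarrow> \<beta> b = \<zero>\<^bsub>B'\<^esub> \<longleftrightarrow> b \<in> L"
    and S: "ideal S A" and U: "ideal U B"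
  defines "T \<equiv> tensor_algebra F A B" and "T' \<equiv> tensor_algebra F A' B'"
  defines "H \<equiv> tensor_subspace F A B I (carrier B) <+>\<^bsub>T\<^esub> tensor_subspace F A B (carrier A) L"
  shows "(\<forall>J. ideal J T' \<longrightarrow> J \<noteq> {\<zero>\<^bsub>T'\<^esub>} \<longrightarrow> tensor_subspace F A' B' (\<alpha> ` S) (\<beta> ` U) \<subseteq> J) \<longleftrightarrow>
    (\<forall>J. ideal J T \<longrightarrow> J \<subseteq> H \<or> tensor_subspace F A B S U \<subseteq> J <+>\<^bsub>T\<^esub> H)"
proof -
  interpret AB: algebra_pair F A B by (rule algebra_pair.intro[OF A B])
  interpret AB': algebra_pair F A' B' by (rule algebra_pair.intro[OF A' B'])
  interpret I: ideal I A by (rule I)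
  interpret L: ideal L B by (rule L)
  interpret S: ideal S A by (rule S)
  interpret U: ideal U B by (rule U)
  interpret T: ring T unfolding T_def by (rule AB.T.ring_axioms)
  interpret T': ring T' unfolding T'_def by (rule AB'.T.ring_axioms)
  define g where "g = tensor_map F A B A' B' \<alpha> \<beta>"
  note \<alpha>l = algebra_hom_linear[OF \<alpha>(1)] and \<beta>l = algebra_hom_linear[OF \<beta>(1)]
  have Talg: "assoc_algebra F T" "assoc_algebra F T'"
    unfolding T_def T'_def by (rule AB.assoc_algebra_tensor AB'.assoc_algebra_tensor)+
  have gh: "g \<in> algebra_hom F T T'"
    unfolding g_def T_def T'_def by (rule tensor_map_hom[OF A B A' B' \<alpha>(1) \<beta>(1)])
  note gl = algebra_hom_linear[OF gh] and gD = algebra_homD[OF gh]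
  note gim = tensor_map_image[OF A B A' B' \<alpha>l \<beta>l, folded g_def]
  have surj: "g ` carrier T = carrier T'"
    using gim[OF subset_refl subset_refl] AB.tensor_subspace_top AB'.tensor_subspace_top \<alpha>(2) \<beta>(2)
    unfolding T_def T'_def by simp
  have gSU: "g ` tensor_subspace F A B S U = tensor_subspace F A' B' (\<alpha> ` S) (\<beta> ` U)"
    by (rule gim[OF S.a_subset U.a_subset])
  have subSU: "tensor_subspace F A B S U \<subseteq> carrier T"
    unfolding T_def by (rule AB.tensor_subspace(4)[OF S.a_subset U.a_subset])
  have ker: "x \<in> H" if "x \<in> carrier T" "g x = \<zero>\<^bsub>T'\<^esub>" for x
    unfolding H_def T_def
    by (rule tensor_map_kernel[OF A B A' B' \<alpha>l \<beta>l \<alpha>(2) \<beta>(2) I(1) L(1)])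
      (use I(2) L(2) that in \<open>simp_all add: T_def T'_def g_def\<close>)
  have H: "ideal H T"
    unfolding H_def T_def
    by (intro AB.T.add_ideals AB.tensor_subspace_ideal I(1) L(1) AB.A.oneideal AB.B.oneideal)
  interpret H: ideal H T by (rule H)
  note g_add = linear_maps_additive[OF gl T.abelian_group_axioms T'.abelian_group_axioms]
  have gH: "g x = \<zero>\<^bsub>T'\<^esub>" if x: "x \<in> H" for x
  proof -
    have z: "submodule {y \<in> carrier T. g y \<in> {\<zero>\<^bsub>T'\<^esub>}} F T"
      by (rule submodule_vimage[OF assoc_algebraD(3)[OF Talg(1)] assoc_algebraD(3)[OF Talg(2)] gl
        ideal_is_submodule[OF Talg(2) T'.zeroideal]])
    have gp: "g (pure_tensor F A B a b) = pure_tensor F A' B' (\<alpha> a) (\<beta> b)"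
      if "a \<in> carrier A" "b \<in> carrier B" for a b
      using tensor_map(2)[OF A B A' B' \<alpha>l \<beta>l that] by (simp add: g_def)
    have I0: "\<alpha> a = \<zero>\<^bsub>A'\<^esub>" if "a \<in> I" for a using I(2)[OF I.Icarr[OF that]] that by blast
    have L0: "\<beta> b = \<zero>\<^bsub>B'\<^esub>" if "b \<in> L" for b using L(2)[OF L.Icarr[OF that]] that by blast
    note aD = algebra_homD(1)[OF \<alpha>(1)] and bD = algebra_homD(1)[OF \<beta>(1)]
    have 1: "tensor_subspace F A B I (carrier B) \<subseteq> {y \<in> carrier T. g y \<in> {\<zero>\<^bsub>T'\<^esub>}}"
      unfolding T_def by (rule AB.tensor_subspace(3)[OF I.a_subset subset_refl z[unfolded T_def]])
        (use I.Icarr bD in \<open>simp add: gp T'_def I0\<close>)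
    have 2: "tensor_subspace F A B (carrier A) L \<subseteq> {y \<in> carrier T. g y \<in> {\<zero>\<^bsub>T'\<^esub>}}"
      unfolding T_def by (rule AB.tensor_subspace(3)[OF subset_refl L.a_subset z[unfolded T_def]])
        (use L.Icarr aD in \<open>simp add: gp T'_def L0\<close>)
    obtain y z where yz: "y \<in> tensor_subspace F A B I (carrier B)" "z \<in> tensor_subspace F A B (carrier A) L"
        "x = y \<oplus>\<^bsub>T\<^esub> z"
      using x unfolding H_def by (rule set_addE)
    have "y \<in> carrier T" "z \<in> carrier T" "g y = \<zero>\<^bsub>T'\<^esub>" "g z = \<zero>\<^bsub>T'\<^esub>"
      using subsetD[OF 1 yz(1)] subsetD[OF 2 yz(2)] by simp_all
    then show ?thesis using yz(3) gD(3) by simp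
  qed
  show ?thesis
  proof (intro iffI allI impI)
    fix J assume large: "\<forall>J. ideal J T' \<longrightarrow> J \<noteq> {\<zero>\<^bsub>T'\<^esub>} \<longrightarrow> tensor_subspace F A' B' (\<alpha> ` S) (\<beta> ` U) \<subseteq> J"
      and J: "ideal J T"
    interpret J: ideal J T by (rule J)
    have im: "ideal (g ` J) T'" by (rule ideal_image_surj[OF Talg gh J surj])
    show "J \<subseteq> H \<or> tensor_subspace F A B S U \<subseteq> J <+>\<^bsub>T\<^esub> H"
    proof (cases "g ` J = {\<zero>\<^bsub>T'\<^esub>}")
      case True
      have "x \<in> H" if x: "x \<in> J" for x
      proof (rule ker[OF J.Icarr[OF x]])
        have "g x \<in> g ` J" using x by (rule imageI)
        then show "g x = \<zero>\<^bsub>T'\<^esub>" unfolding True by (rule singletonD)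
      qed
      then have "J \<subseteq> H" by (rule subsetI)
      then show ?thesis ..
    next
      case False
      then have "tensor_subspace F A' B' (\<alpha> ` S) (\<beta> ` U) \<subseteq> g ` J" by (rule large[rule_format, OF im])
      then have sub: "g ` tensor_subspace F A B S U \<subseteq> g ` J" unfolding gSU .
      have "x \<in> J <+>\<^bsub>T\<^esub> H" if x: "x \<in> tensor_subspace F A B S U" for x
      proof -
        obtain j where j: "j \<in> J" "g x = g j" using sub x by blast
        have c: "x \<in> carrier T" "j \<in> carrier T" using x subSU J.Icarr[OF j(1)] by auto
        have "g (x \<ominus>\<^bsub>T\<^esub> j) = \<zero>\<^bsub>T'\<^esub>"
          using g_add(3)[OF c] j(2) gD(1)[OF c(2)] by (simp add: T'.minus_eq T'.r_neg)
        then have "x \<ominus>\<^bsub>T\<^esub> j \<in> H" using ker c by simp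
        moreover have "x = j \<oplus>\<^bsub>T\<^esub> (x \<ominus>\<^bsub>T\<^esub> j)" using c T.a_lcomm[of j x "\<ominus>\<^bsub>T\<^esub> j"] by (simp add: T.minus_eq T.r_neg)
        ultimately show ?thesis using set_addI[OF j(1)] by metis
      qed
      then have "tensor_subspace F A B S U \<subseteq> J <+>\<^bsub>T\<^esub> H" by (rule subsetI)
      then show ?thesis ..
    qed
  next
    fix J assume large: "\<forall>J. ideal J T \<longrightarrow> J \<subseteq> H \<or> tensor_subspace F A B S U \<subseteq> J <+>\<^bsub>T\<^esub> H"
      and J: "ideal J T'" "J \<noteq> {\<zero>\<^bsub>T'\<^esub>}"
    interpret J: ideal J T' by (rule J(1))
    define N where "N = {x \<in> carrier T. g x \<in> J}"
    have im: "ideal N T" unfolding N_def by (rule ideal_vimage[OF Talg gh J(1)])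
    have N: "g s \<in> J" "s \<in> carrier T" if "s \<in> N" for s using that unfolding N_def by simp_all
    obtain j where j: "j \<in> J" "j \<noteq> \<zero>\<^bsub>T'\<^esub>" using J(2) J.zero_closed by blast
    have "j \<in> g ` carrier T" unfolding surj by (rule J.Icarr[OF j(1)])
    then obtain x where x: "x \<in> carrier T" "j = g x" by (elim imageE)
    have "x \<in> N" unfolding N_def using x j(1) by simp
    moreover have "x \<notin> H" using gH[of x] x(2) j(2) by metis
    ultimately have "\<not> N \<subseteq> H" by blast
    then have sub: "tensor_subspace F A B S U \<subseteq> N <+>\<^bsub>T\<^esub> H"
      using large[rule_format, OF im] by blast
    have "g y \<in> J" if y: "y \<in> tensor_subspace F A B S U" for y
    proof -
      have "y \<in> N <+>\<^bsub>T\<^esub> H" using y sub by (rule rev_subsetD)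
      then obtain s t where st: "s \<in> N" "t \<in> H" "y = s \<oplus>\<^bsub>T\<^esub> t" by (rule set_addE)
      have "g y = g s \<oplus>\<^bsub>T'\<^esub> \<zero>\<^bsub>T'\<^esub>" using st(3) gD(3)[OF N(2)[OF st(1)] H.Icarr[OF st(2)]] gH[OF st(2)] by simp
      then show ?thesis using N(1)[OF st(1)] J.Icarr by simp
    qed
    then show "tensor_subspace F A' B' (\<alpha> ` S) (\<beta> ` U) \<subseteq> J"
      unfolding gSU[symmetric] by (rule image_subsetI)
  qed
qed

context algebra_pair
begin

lemma tensor_subspace_zero:
  "U \<subseteq> carrier B \<Longrightarrow> tensor_subspace F A B {\<zero>\<^bsub>A\<^esub>} U \<subseteq> {\<zero>\<^bsub>T\<^esub>}"
  "S \<subseteq> carrier A \<Longrightarrow> tensor_subspace F A B S {\<zero>\<^bsub>B\<^esub>} \<subseteq> {\<zero>\<^bsub>T\<^esub>}"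
proof -
  have z: "submodule {\<zero>\<^bsub>T\<^esub>} F T" by (rule ideal_is_submodule[OF assoc_algebra_tensor T.zeroideal])
  show "tensor_subspace F A B {\<zero>\<^bsub>A\<^esub>} U \<subseteq> {\<zero>\<^bsub>T\<^esub>}" if "U \<subseteq> carrier B"
    using that by (intro tensor_subspace(3)[OF _ that z]) auto
  show "tensor_subspace F A B S {\<zero>\<^bsub>B\<^esub>} \<subseteq> {\<zero>\<^bsub>T\<^esub>}" if "S \<subseteq> carrier A"
    using that by (intro tensor_subspace(3)[OF that _ z]) auto
qed

text \<open>
  If \<open>J \<noteq> 0\<close>, then \<open>J\<close> contains \<open>I \<otimes> L\<close>, which is the intersection of \<open>I \<otimes> B\<close> and
  \<open>A \<otimes> L\<close> and contains their products. So if \<open>I \<otimes> B\<close> is contained in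
  \<open>J + A \<otimes> L\<close>, multiplying this inclusion by \<open>I \<otimes> B\<close> and using that \<open>I\<close> is idempotent shows that
  \<open>I \<otimes> B\<close> is contained in \<open>J\<close>; likewise for \<open>A \<otimes> L\<close>. Hence each of the two ideals contains \<open>J\<close>
  or is contained in it. This determines \<open>J\<close>; if \<open>J\<close> contains both, the last condition decides
  between their sum and the whole algebra.
\<close>

lemma admissible_iff:
  assumes I: "ideal I A" "I \<cdot>\<^bsub>A\<^esub> I = I" and L: "ideal L B" "L \<cdot>\<^bsub>B\<^esub> L = L"
  defines "IB \<equiv> tensor_subspace F A B I (carrier B)" and "AL \<equiv> tensor_subspace F A B (carrier A) L"
    and "IL \<equiv> tensor_subspace F A B I L"
  assumes J: "ideal J T"
  shows "admissible F A B I L J \<longleftrightarrow> (J \<subseteq> {\<zero>\<^bsub>T\<^esub>} \<or> IL \<subseteq> J) \<and> (J \<subseteq> IB \<or> AL \<subseteq> J <+>\<^bsub>T\<^esub> IB) \<and>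
      (J \<subseteq> AL \<or> IB \<subseteq> J <+>\<^bsub>T\<^esub> AL) \<and> (J \<subseteq> IB <+>\<^bsub>T\<^esub> AL \<or> carrier T \<subseteq> J <+>\<^bsub>T\<^esub> (IB <+>\<^bsub>T\<^esub> AL))"
    (is "_ \<longleftrightarrow> ?dichotomies")
proof -
  interpret I: ideal I A by (rule I)
  interpret L: ideal L B by (rule L)
  interpret J: ideal J T by (rule J)
  note tI = tensor_subspace[OF I.a_subset subset_refl, folded IB_def]
    and tL = tensor_subspace[OF subset_refl L.a_subset, folded AL_def]
    and tIL = tensor_subspace[OF I.a_subset L.a_subset, folded IL_def]
  have idl: "ideal IB T" "ideal AL T" "ideal IL T"
    unfolding IB_def AL_def IL_def by (intro tensor_subspace_ideal I L A.oneideal B.oneideal)+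
  interpret IB: ideal IB T by (rule idl)
  interpret AL: ideal AL T by (rule idl)
  interpret IL: ideal IL T by (rule idl)
  have sumE: "\<exists>x\<in>X. \<exists>y\<in>Y. z = x \<oplus>\<^bsub>T\<^esub> y" if "z \<in> X <+>\<^bsub>T\<^esub> Y" for z X Y
    using that unfolding set_add_def' by blast
  have left: "X \<subseteq> X <+>\<^bsub>T\<^esub> Y" if "ideal X T" "ideal Y T" for X Y
  proof
    fix x assume x: "x \<in> X"
    have "x = x \<oplus>\<^bsub>T\<^esub> \<zero>\<^bsub>T\<^esub>" using ideal.Icarr[OF that(1) x] by simp
    then show "x \<in> X <+>\<^bsub>T\<^esub> Y"
      using set_addI[where R = T, OF x additive_subgroup.zero_closed[OF ideal.axioms(1)[OF that(2)]]] by simp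
  qed
  have right: "Y \<subseteq> X <+>\<^bsub>T\<^esub> Y" if "ideal X T" "ideal Y T" for X Y
  proof
    fix y assume y: "y \<in> Y"
    have "y = \<zero>\<^bsub>T\<^esub> \<oplus>\<^bsub>T\<^esub> y" using ideal.Icarr[OF that(2) y] by simp
    then show "y \<in> X <+>\<^bsub>T\<^esub> Y"
      using set_addI[where R = T, OF additive_subgroup.zero_closed[OF ideal.axioms(1)[OF that(1)]] y] by simp
  qed
  have least: "X <+>\<^bsub>T\<^esub> Y \<subseteq> Z" if "X \<subseteq> Z" "Y \<subseteq> Z" "ideal Z T" for X Y Z
  proof
    interpret Z: ideal Z T by (rule that(3))
    fix z assume "z \<in> X <+>\<^bsub>T\<^esub> Y"
    then show "z \<in> Z" using sumE[of z X Y] that(1,2) Z.a_closed by blast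
  qed
  have sm: "ideal (IB <+>\<^bsub>T\<^esub> AL) T" by (rule T.add_ideals[OF idl(1,2)])
  have ILs: "IL \<subseteq> IB" "IL \<subseteq> AL"
    unfolding IL_def IB_def AL_def using I.a_subset L.a_subset by (intro tensor_subspace_mono; simp)+
  note adm = admissible_def[of F A B I L J, folded IB_def AL_def IL_def]
  have admissible_imp: ?dichotomies
    if a: "admissible F A B I L J"
  proof -
    note l = left[OF J idl(1)] left[OF J idl(2)] left[OF J sm] right[OF J idl(1)] right[OF J idl(2)]
      left[OF idl(1,2)] right[OF idl(1,2)]
    consider "J = {\<zero>\<^bsub>T\<^esub>}" | "J = carrier T" | "J = IL" | "J = IB" | "J = AL" | "J = IB <+>\<^bsub>T\<^esub> AL"
      using a unfolding adm by blast
    then show ?thesis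
    proof cases
      case 1
      then show ?thesis using IB.zero_closed AL.zero_closed l(6) by (intro conjI disjI1) auto
    next
      case 2
      then show ?thesis using l(4,5) l(3) IB.a_subset AL.a_subset IL.a_subset l(1,2)
        by (intro conjI disjI2) simp_all
    next
      case 3
      then show ?thesis using ILs l(6) by (intro conjI, blast, blast, blast) (intro disjI1, auto)
    next
      case 4
      then show ?thesis using ILs(1) l(2,4,6) by (intro conjI) auto
    next
      case 5
      then show ?thesis using ILs(2) l(1,5,7) by (intro conjI) auto
    next
      case 6
      have 1: "IL \<subseteq> J" unfolding 6 using ILs(1) l(6) by (rule subset_trans)
      have 2: "AL \<subseteq> J <+>\<^bsub>T\<^esub> IB" using l(7) l(1) unfolding 6 by (rule subset_trans)
      have 3: "IB \<subseteq> J <+>\<^bsub>T\<^esub> AL" using l(6) l(2) unfolding 6 by (rule subset_trans)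
      show ?thesis using 1 2 3 6 by simp
    qed
  qed
  have inter: "x \<in> IL" if "x \<in> IB" "x \<in> AL" for x
    using tensor_subspace_inter[OF I(1) L(1)] that unfolding IB_def AL_def IL_def by blast
  have imp_admissible: "admissible F A B I L J"
    if c1: "J \<subseteq> {\<zero>\<^bsub>T\<^esub>} \<or> IL \<subseteq> J" and c2: "J \<subseteq> IB \<or> AL \<subseteq> J <+>\<^bsub>T\<^esub> IB"
      and c3: "J \<subseteq> AL \<or> IB \<subseteq> J <+>\<^bsub>T\<^esub> AL"
      and c4: "J \<subseteq> IB <+>\<^bsub>T\<^esub> AL \<or> carrier T \<subseteq> J <+>\<^bsub>T\<^esub> (IB <+>\<^bsub>T\<^esub> AL)"
  proof (cases "J \<subseteq> {\<zero>\<^bsub>T\<^esub>}")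
    case True
    then have "J = {\<zero>\<^bsub>T\<^esub>}" using J.zero_closed by blast
    then show ?thesis unfolding adm by blast
  next
    case False
    then have ILJ: "IL \<subseteq> J" using c1 by blast
    have prod1: "x \<otimes>\<^bsub>T\<^esub> y \<in> J" if "x \<in> IB" "y \<in> AL" for x y
      using inter[OF IB.I_r_closed[OF that(1)] AL.I_l_closed[OF that(2)]] that ILJ by auto
    have prod2: "y \<otimes>\<^bsub>T\<^esub> x \<in> J" if "x \<in> IB" "y \<in> AL" for x y
      using inter[OF IB.I_l_closed[OF that(1)] AL.I_r_closed[OF that(2)]] that ILJ by auto
    \<comment> \<open>The ideals \<open>I \<otimes> B\<close> and \<open>A \<otimes> L\<close> are idempotent, and their product lies in \<open>J\<close>.\<close>
    have absorb1: "IB \<subseteq> J" if sub: "IB \<subseteq> J <+>\<^bsub>T\<^esub> AL"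
    proof (unfold IB_def, rule tensor_subspace(3)[OF I.a_subset subset_refl ideal_is_submodule[OF assoc_algebra_tensor J]])
      fix a b assume a: "a \<in> I" and b: "b \<in> carrier B"
      have "a \<in> I \<cdot>\<^bsub>A\<^esub> I" using a I(2) by simp
      then have "a \<in> carrier A \<and> a \<otimes>\<^sub>t b \<in> J"
      proof (induction a rule: ideal_prod.induct)
        case (prod i i')
        note ic = I.Icarr[OF prod(1)] I.Icarr[OF prod(2)]
        have 1: "i \<otimes>\<^sub>t \<one>\<^bsub>B\<^esub> \<in> IB" "i' \<otimes>\<^sub>t b \<in> IB" using tI(2) prod b by simp_all
        obtain j y where j: "j \<in> J" "y \<in> AL" "i \<otimes>\<^sub>t \<one>\<^bsub>B\<^esub> = j \<oplus>\<^bsub>T\<^esub> y"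
          using sumE[of "i \<otimes>\<^sub>t \<one>\<^bsub>B\<^esub>" J AL] sub 1(1) by blast
        have "(i \<otimes>\<^bsub>A\<^esub> i') \<otimes>\<^sub>t b = (i \<otimes>\<^sub>t \<one>\<^bsub>B\<^esub>) \<otimes>\<^bsub>T\<^esub> (i' \<otimes>\<^sub>t b)"
          using ic b by (simp add: pure_mult)
        also have "\<dots> = j \<otimes>\<^bsub>T\<^esub> (i' \<otimes>\<^sub>t b) \<oplus>\<^bsub>T\<^esub> y \<otimes>\<^bsub>T\<^esub> (i' \<otimes>\<^sub>t b)"
          using j(3) J.Icarr[OF j(1)] AL.Icarr[OF j(2)] IB.Icarr[OF 1(2)] by (simp add: T.l_distr)
        finally show ?case
          using ic J.a_closed[OF J.I_r_closed[OF j(1) IB.Icarr[OF 1(2)]] prod2[OF 1(2) j(2)]] by simp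
      next
        case (sum s t)
        then show ?case using b J.a_closed by (simp add: pure_add_left)
      qed
      then show "a \<otimes>\<^sub>t b \<in> J" by blast
    qed
    have absorb2: "AL \<subseteq> J" if sub: "AL \<subseteq> J <+>\<^bsub>T\<^esub> IB"
    proof (unfold AL_def, rule tensor_subspace(3)[OF subset_refl L.a_subset ideal_is_submodule[OF assoc_algebra_tensor J]])
      fix a b assume a: "a \<in> carrier A" and b: "b \<in> L"
      have "b \<in> L \<cdot>\<^bsub>B\<^esub> L" using b L(2) by simp
      then have "b \<in> carrier B \<and> a \<otimes>\<^sub>t b \<in> J"
      proof (induction b rule: ideal_prod.induct)
        case (prod i i')
        note ic = L.Icarr[OF prod(1)] L.Icarr[OF prod(2)]
        have 1: "\<one>\<^bsub>A\<^esub> \<otimes>\<^sub>t i \<in> AL" "a \<otimes>\<^sub>t i' \<in> AL" using tL(2) prod a by simp_all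
        obtain j y where j: "j \<in> J" "y \<in> IB" "\<one>\<^bsub>A\<^esub> \<otimes>\<^sub>t i = j \<oplus>\<^bsub>T\<^esub> y"
          using sumE[of "\<one>\<^bsub>A\<^esub> \<otimes>\<^sub>t i" J IB] sub 1(1) by blast
        have "a \<otimes>\<^sub>t (i \<otimes>\<^bsub>B\<^esub> i') = (\<one>\<^bsub>A\<^esub> \<otimes>\<^sub>t i) \<otimes>\<^bsub>T\<^esub> (a \<otimes>\<^sub>t i')"
          using ic a by (simp add: pure_mult)
        also have "\<dots> = j \<otimes>\<^bsub>T\<^esub> (a \<otimes>\<^sub>t i') \<oplus>\<^bsub>T\<^esub> y \<otimes>\<^bsub>T\<^esub> (a \<otimes>\<^sub>t i')"
          using j(3) J.Icarr[OF j(1)] IB.Icarr[OF j(2)] AL.Icarr[OF 1(2)] by (simp add: T.l_distr)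
        finally show ?case
          using ic J.a_closed[OF J.I_r_closed[OF j(1) AL.Icarr[OF 1(2)]] prod1[OF j(2) 1(2)]] by simp
      next
        case (sum s t)
        then show ?case using a J.a_closed by (simp add: pure_add_right)
      qed
      then show "a \<otimes>\<^sub>t b \<in> J" by blast
    qed
    consider "IB \<subseteq> J" "AL \<subseteq> J" | "IB \<subseteq> J" "J \<subseteq> IB" | "J \<subseteq> AL" "AL \<subseteq> J" | "J \<subseteq> AL" "J \<subseteq> IB"
      using c2 c3 absorb1 absorb2 by blast
    then show ?thesis
    proof cases
      case 1
      then have sJ: "IB <+>\<^bsub>T\<^esub> AL \<subseteq> J" by (rule least[OF _ _ J])
      show ?thesis
      proof (cases "J \<subseteq> IB <+>\<^bsub>T\<^esub> AL")
        case True
        then have "J = IB <+>\<^bsub>T\<^esub> AL" using sJ by blast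
        then show ?thesis unfolding adm by blast
      next
        case False
        then have "carrier T \<subseteq> J <+>\<^bsub>T\<^esub> (IB <+>\<^bsub>T\<^esub> AL)" using c4 by blast
        also have "\<dots> \<subseteq> J" by (rule least[OF subset_refl sJ J])
        finally have "J = carrier T" using J.a_subset by blast
        then show ?thesis unfolding adm by blast
      qed
    next
      case 2
      then have "J = IB" by blast
      then show ?thesis unfolding adm by blast
    next
      case 3
      then have "J = AL" by blast
      then show ?thesis unfolding adm by blast
    next
      case 4
      then have "J = IL" using inter ILJ by blast
      then show ?thesis unfolding adm by blast
    qed
  qed
  show ?thesis
  proof
    assume "admissible F A B I L J"
    then show ?dichotomies by (rule admissible_imp)
  next
    assume ?dichotomies
    then show "admissible F A B I L J" by (elim conjE) (rule imp_admissible)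
  qed
qed

end

section \<open>Tensor products of nearly simple algebras\<close>

theorem theorem3p9:
  fixes F :: "('f, 'm) ring_scheme"
    and A :: "('f, 'a) module" and B :: "('f, 'b) module"
    and I\<^sub>A :: "'a set" and I\<^sub>B :: "'b set"
    and Q\<^sub>A :: "('f, 'p) module" and Q\<^sub>B :: "('f, 'q) module"
    and e\<^sub>A :: "'a \<Rightarrow> 'p" and e\<^sub>B :: "'b \<Rightarrow> 'q"
  assumes "field F"
    and "nearly_simple F A" and "nearly_simple F B"
    and "nontrivial_ideal I\<^sub>A A" and "nontrivial_ideal I\<^sub>B B"
    and "symmetric_quotient_algebra F A Q\<^sub>A e\<^sub>A" and "symmetric_quotient_algebra F B Q\<^sub>B e\<^sub>B"
  shows "(\<forall>J. ideal J (tensor_algebra F A B) \<longrightarrow> admissible F A B I\<^sub>A I\<^sub>B J) \<longleftrightarrow>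
    field (tensor_algebra F (center_algebra (quotient_algebra A I\<^sub>A))
                            (center_algebra (quotient_algebra B I\<^sub>B))) \<and>
    field (tensor_algebra F (center_algebra Q\<^sub>A) (center_algebra (quotient_algebra B I\<^sub>B))) \<and>
    field (tensor_algebra F (center_algebra (quotient_algebra A I\<^sub>A)) (center_algebra Q\<^sub>B)) \<and>
    field (tensor_algebra F (center_algebra Q\<^sub>A) (center_algebra Q\<^sub>B))"
proof -
  note nA = nearly_simpleD[OF assms(2,4)] and nB = nearly_simpleD[OF assms(3,5)]
  interpret AB: algebra_pair F A B by (rule algebra_pair.intro[OF nA(1) nB(1)])
  interpret I: ideal I\<^sub>A A by (rule nA(2))
  interpret L: ideal I\<^sub>B B by (rule nB(2))
  let ?T = "tensor_algebra F A B" and ?A = "quotient_algebra A I\<^sub>A" and ?B = "quotient_algebra B I\<^sub>B"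
  let ?IB = "tensor_subspace F A B I\<^sub>A (carrier B)" and ?AL = "tensor_subspace F A B (carrier A) I\<^sub>B"
    and ?IL = "tensor_subspace F A B I\<^sub>A I\<^sub>B"
  let ?\<alpha> = "\<lambda>x. I\<^sub>A +>\<^bsub>A\<^esub> x" and ?\<beta> = "\<lambda>x. I\<^sub>B +>\<^bsub>B\<^esub> x"
  note algA = nA(1) assoc_algebra_quotient[OF nA(1,2)] and algB = nB(1) assoc_algebra_quotient[OF nB(1,2)]
  interpret QA: ring ?A by (rule assoc_algebraD(2)[OF algA(2)])
  interpret QB: ring ?B by (rule assoc_algebraD(2)[OF algB(2)])
  note homA = quotient_map_hom[OF nA(1,2)] and homB = quotient_map_hom[OF nB(1,2)]
  have kerA: "?\<alpha> a = \<zero>\<^bsub>?A\<^esub> \<longleftrightarrow> a \<in> I\<^sub>A" if "a \<in> carrier A" for a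
    using quotient_map_kernel[OF nA(1,2) that] I.a_rcos_const by (auto simp: quotient_algebra_simps)
  have kerB: "?\<beta> b = \<zero>\<^bsub>?B\<^esub> \<longleftrightarrow> b \<in> I\<^sub>B" if "b \<in> carrier B" for b
    using quotient_map_kernel[OF nB(1,2) that] L.a_rcos_const by (auto simp: quotient_algebra_simps)
  have unA: "symmetric_quotient_algebra F A Q\<^sub>A e\<^sub>A \<Longrightarrow> e\<^sub>A \<in> algebra_hom F A Q\<^sub>A \<and> inj_on e\<^sub>A (carrier A)"
    unfolding symmetric_quotient_algebra_def by (elim conjE, intro conjI)
  have unB: "symmetric_quotient_algebra F B Q\<^sub>B e\<^sub>B \<Longrightarrow> e\<^sub>B \<in> algebra_hom F B Q\<^sub>B \<and> inj_on e\<^sub>B (carrier B)"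
    unfolding symmetric_quotient_algebra_def by (elim conjE, intro conjI)
  note eA = unA[OF assms(6), THEN conjunct1] unA[OF assms(6), THEN conjunct2]
  note eB = unB[OF assms(7), THEN conjunct1] unB[OF assms(7), THEN conjunct2]
  note mA = closed_monolith_symmetric_quotient[OF assms(2,4,6)] closed_monolith_top_quotient[OF assms(2,4)]
  note mB = closed_monolith_symmetric_quotient[OF assms(3,5,7)] closed_monolith_top_quotient[OF assms(3,5)]
  have mA': "closed_monolith F ?A ((\<lambda>x. x) ` carrier ?A)" and mB': "closed_monolith F ?B ((\<lambda>x. x) ` carrier ?B)"
    using mA(2) mB(2) by simp_all
  note idA = id_hom[of F ?A] inj_on_id2[of "carrier ?A"] and idB = id_hom[of F ?B] inj_on_id2[of "carrier ?B"]
  have zA: "\<And>a. a \<in> carrier A \<Longrightarrow> a = \<zero>\<^bsub>A\<^esub> \<longleftrightarrow> a \<in> {\<zero>\<^bsub>A\<^esub>}" by simp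
  have zB: "\<And>b. b \<in> carrier B \<Longrightarrow> b = \<zero>\<^bsub>B\<^esub> \<longleftrightarrow> b \<in> {\<zero>\<^bsub>B\<^esub>}" by simp
  have z0: "ideal ?IB ?T" "ideal ?AL ?T"
    by (intro AB.tensor_subspace_ideal nA(2) nB(2) AB.A.oneideal AB.B.oneideal)+
  have ts0: "tensor_subspace F A B {\<zero>\<^bsub>A\<^esub>} (carrier B) = {\<zero>\<^bsub>?T\<^esub>}"
    "tensor_subspace F A B (carrier A) {\<zero>\<^bsub>B\<^esub>} = {\<zero>\<^bsub>?T\<^esub>}"
  proof -
    have "\<zero>\<^bsub>?T\<^esub> \<in> tensor_subspace F A B {\<zero>\<^bsub>A\<^esub>} (carrier B)"
      "\<zero>\<^bsub>?T\<^esub> \<in> tensor_subspace F A B (carrier A) {\<zero>\<^bsub>B\<^esub>}"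
      by (rule submodule_zero[OF AB.tensor_subspace(1)]; simp)+
    then show "tensor_subspace F A B {\<zero>\<^bsub>A\<^esub>} (carrier B) = {\<zero>\<^bsub>?T\<^esub>}"
      "tensor_subspace F A B (carrier A) {\<zero>\<^bsub>B\<^esub>} = {\<zero>\<^bsub>?T\<^esub>}"
      using AB.tensor_subspace_zero(1)[of "carrier B"] AB.tensor_subspace_zero(2)[of "carrier A"] by auto
  qed
  have add0: "X <+>\<^bsub>?T\<^esub> {\<zero>\<^bsub>?T\<^esub>} = X" "{\<zero>\<^bsub>?T\<^esub>} <+>\<^bsub>?T\<^esub> X = X" if "X \<subseteq> carrier ?T" for X
  proof -
    have "x \<oplus>\<^bsub>?T\<^esub> \<zero>\<^bsub>?T\<^esub> = x" "\<zero>\<^bsub>?T\<^esub> \<oplus>\<^bsub>?T\<^esub> x = x" if "x \<in> X" for x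
      using subsetD[OF \<open>X \<subseteq> carrier ?T\<close> that] by simp_all
    then show "X <+>\<^bsub>?T\<^esub> {\<zero>\<^bsub>?T\<^esub>} = X" "{\<zero>\<^bsub>?T\<^esub>} <+>\<^bsub>?T\<^esub> X = X"
      unfolding set_add_def' by simp_all
  qed
  have carr: "?IB \<subseteq> carrier ?T" "?AL \<subseteq> carrier ?T"
    by (rule additive_subgroup.a_subset[OF ideal.axioms(1)[OF z0(1)]],
        rule additive_subgroup.a_subset[OF ideal.axioms(1)[OF z0(2)]])
  \<comment> \<open>A factor that is not divided by its ideal enters the transfer of ideals through the identity
    map, with kernel zero, so that its summand of the total kernel vanishes.\<close>
  have f1: "field (tensor_algebra F (center_algebra Q\<^sub>A) (center_algebra Q\<^sub>B)) \<longleftrightarrow>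
      (\<forall>J. ideal J ?T \<longrightarrow> J \<subseteq> {\<zero>\<^bsub>?T\<^esub>} \<or> ?IL \<subseteq> J)"
  proof -
    have "J = {\<zero>\<^bsub>?T\<^esub>} \<longleftrightarrow> J \<subseteq> {\<zero>\<^bsub>?T\<^esub>}" if "ideal J ?T" for J
      using additive_subgroup.zero_closed[OF ideal.axioms(1)[OF that]] by auto
    then have "(J \<noteq> {\<zero>\<^bsub>?T\<^esub>} \<longrightarrow> ?IL \<subseteq> J) \<longleftrightarrow> (J \<subseteq> {\<zero>\<^bsub>?T\<^esub>} \<or> ?IL \<subseteq> J)" if "ideal J ?T" for J
      using that by (simp only:) blast
    then show ?thesis
      unfolding field_iff_contains[OF mA(1) mB(1) nA(1,2) nB(1,2) eA eB]
      by (intro iff_allI imp_cong refl)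
  qed
  have f2: "field (tensor_algebra F (center_algebra ?A) (center_algebra Q\<^sub>B)) \<longleftrightarrow>
      (\<forall>J. ideal J ?T \<longrightarrow> J \<subseteq> ?IB \<or> ?AL \<subseteq> J <+>\<^bsub>?T\<^esub> ?IB)"
    unfolding field_iff_contains[OF mA' mB(1) algA(2) QA.oneideal nB(1,2) idA eB]
    using contains_iff_mod_kernel[OF nA(1) nB(1) algA(2) nB(1) homA quotient_map_surj id_hom image_ident nA(2) kerA
        AB.B.zeroideal zB AB.A.oneideal nB(2)]
    unfolding ts0 add0(1)[OF carr(1)] quotient_map_surj image_ident .
  have f3: "field (tensor_algebra F (center_algebra Q\<^sub>A) (center_algebra ?B)) \<longleftrightarrow>
      (\<forall>J. ideal J ?T \<longrightarrow> J \<subseteq> ?AL \<or> ?IB \<subseteq> J <+>\<^bsub>?T\<^esub> ?AL)"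
    unfolding field_iff_contains[OF mA(1) mB' nA(1,2) algB(2) QB.oneideal eA idB]
    using contains_iff_mod_kernel[OF nA(1) nB(1) nA(1) algB(2) id_hom image_ident homB quotient_map_surj AB.A.zeroideal zA
        nB(2) kerB nA(2) AB.B.oneideal]
    unfolding ts0 add0(2)[OF carr(2)] quotient_map_surj image_ident .
  have f4: "field (tensor_algebra F (center_algebra ?A) (center_algebra ?B)) \<longleftrightarrow>
      (\<forall>J. ideal J ?T \<longrightarrow> J \<subseteq> ?IB <+>\<^bsub>?T\<^esub> ?AL \<or> carrier ?T \<subseteq> J <+>\<^bsub>?T\<^esub> (?IB <+>\<^bsub>?T\<^esub> ?AL))"
    unfolding field_iff_contains[OF mA' mB' algA(2) QA.oneideal algB(2) QB.oneideal idA idB]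
    using contains_iff_mod_kernel[OF nA(1) nB(1) algA(2) algB(2) homA quotient_map_surj homB quotient_map_surj nA(2) kerA
        nB(2) kerB AB.A.oneideal AB.B.oneideal]
    unfolding quotient_map_surj AB.tensor_subspace_top .
  have split: "(\<forall>J. P J \<longrightarrow> Q J) \<longleftrightarrow> (\<forall>J. P J \<longrightarrow> R4 J) \<and> (\<forall>J. P J \<longrightarrow> R3 J) \<and> (\<forall>J. P J \<longrightarrow> R2 J) \<and> (\<forall>J. P J \<longrightarrow> R1 J)"
    if "\<And>J. P J \<Longrightarrow> Q J \<longleftrightarrow> R1 J \<and> R2 J \<and> R3 J \<and> R4 J" for P Q R1 R2 R3 R4 :: "('a \<times> 'b \<Rightarrow> 'f) set set \<Rightarrow> bool"
    using that by blast
  show ?thesis unfolding f1 f2 f3 f4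
    by (rule split, rule AB.admissible_iff[OF nA(2,5) nB(2,5)])
qed

end
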